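(* Let $X$ be a separable Hilbert space, let $1<p<\infty$, and let $f\in\mathbb{D}_{p,1}(X)$. Assume that the weak derivative $\nabla f$ (for some fixed measurable representative $\nabla f:\mathbb{W}\to X\otimes H$) satisfies: for $\mu$-a.e. $w\in\mathbb{W}$, the map $h\mapsto\nabla f(w+h)\in X\otimes H$ is uniformly continuous on $B_m$ for every $m\in\mathbb{N}^*$. Then $f$ is $H$-$C^1$ (that is, the $\mu$-equivalence class $f$ has a representative which is $H$-$C^1$), and its $H$-derivative is equal to the weak derivative $\nabla f$ $\mu$-a.s.
   Context: Fix $n\ge 1$. $\mathbb{W}=C([0,1],\mathbb{R}^n)$ is the canonical Wiener space, $\mu$ the Wiener measure on it, and $W$ the coordinate process (a Brownian motion under $\mu$). $\mathbb{N}^*=\{1,2,\dots\}$. The Cameron-Martin space is $H=\{\int_0^{\cdot}\dot h(s)\,ds:\dot h\in L^2([0,1];\mathbb{R}^n)\}\subset\mathbb{W}$, with norm $|h|_H=|\dot h|_{L^2}$. For $m\in\mathbb{N}^*$, $B_m=\{h\in H:|h|_H\le m\}$. Tensor products such as $X\otimes H$ are Hilbert space tensor products, with their Hilbert (Hilbert-Schmidt) norm; an element of $X\otimes H$ is identified with a Hilbert-Schmidt operator from $H$ to $X$. Weak derivative. $Cyl$ is the set of functions $F(W_{t_1},\dots,W_{t_q})$ with $q\in\mathbb{N}^*$, $0\le t_1<\dots<t_q\le 1$ and $F$ a real-valued Schwartz function on $(\mathbb{R}^n)^q$. For $f\in Cyl$, $w\in\mathbb{W}$, $h\in H$, set $\nabla_hf(w)=\frac{d}{d\lambda}f(w+\lambda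 h)|_{\lambda=0}$; by the Riesz theorem $\nabla f(w)$ is an element of $H$. For a separable Hilbert space $X$ with Hilbert basis $(e_i)$, $Cyl(X)$ is the set of finite sums $f=\sum_k f_ke_{i_k}$ with $f_k\in Cyl$, and $\nabla f(w)[h]=\sum_k\nabla_hf_k(w)\,e_{i_k}$ defines $\nabla f(w)\in X\otimes H$. For $1<p<\infty$, the operator $\nabla$ is closable from $L^p(\mu,X)$ to $L^p(\mu,X\otimes H)$, and $\mathbb{D}_{p,1}(X)$ is the closure of $Cyl(X)$ for the norm $|f|_{p,1}=|f|_{L^p(\mu,X)}+|\nabla f|_{L^p(\mu,X\otimes H)}$; $\nabla$ also denotes the extension to $\mathbb{D}_{p,1}(X)$ (the weak derivative). Elements of $\mathbb{D}_{p,1}(X)$ and their weak derivatives are $\mu$-equivalence classes. Strong derivative. Let $Y$ be a separable Hilbert space and $u:\mathbb{W}\to Y$ measurable. (i) $u$ is $H$-continuous ($H$-$C$) if for $\mu$-a.e. $w$ the map $h\mapsto u(w+h)$ is continuous on $H$. (ii) $u$ is $H$-$C^1$ if for $\mu$-a.e. $w$ the map $h\mapsto u(w+h)$ is Fréchet differentiable on $H$ and its Fréchet derivative is given by an $H$-continuous map from $\mathbb{W}$ to $Y\otimes H$ (the value of this map at $w$ being the Fréchet derivative of $h\mapsto u(w+h)$ at $h=0$, so that its value at $w+h$ is the Fréchet derivative at $h$). This map is called the $H$-derivative of $u$. *)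

theory Defs
  imports "HOL-Probability.Probability"
begin

section \<open>The Wiener space\<close>

text \<open>
  A continuous path on $[0,1]$ is represented by its extension by zero to the whole real line.
\<close>

typedef (overloaded) ('n::finite) wiener =
  "{w :: real \<Rightarrow> real^'n. continuous_on {0..1} w \<and> (\<forall>t. t \<notin> {0..1} \<longrightarrow> w t = 0)}"
  morphisms path_at Path
  by (intro exI[of _ "\<lambda>_. 0"]) auto

setup_lifting type_definition_wiener

lemma path_at_outside: "t \<notin> {0..1} \<Longrightarrow> path_at w t = 0"
  using path_at[of w] by auto

lemma continuous_path_at: "continuous_on {0..1} (path_at w)"
  using path_at[of w] by auto

lemma bdd_above_path: "bdd_above ((\<lambda>t. norm (path_at w t)) ` {0..1})"
  by (intro bounded_imp_bdd_above compact_imp_bounded compact_continuous_image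
      continuous_on_norm continuous_path_at compact_Icc)

lemma wiener_eqI: "(\<And>t. t \<in> {0..1} \<Longrightarrow> path_at v t = path_at w t) \<Longrightarrow> v = w"
  by (metis path_at_inject path_at_outside ext)

instantiation wiener :: (finite) real_vector
begin

lift_definition zero_wiener :: "'a wiener" is "\<lambda>_. 0" by auto
lift_definition plus_wiener :: "'a wiener \<Rightarrow> 'a wiener \<Rightarrow> 'a wiener" is "\<lambda>v w t. v t + w t"
  by (auto intro: continuous_on_add)
lift_definition minus_wiener :: "'a wiener \<Rightarrow> 'a wiener \<Rightarrow> 'a wiener" is "\<lambda>v w t. v t - w t"
  by (auto intro: continuous_on_diff)
lift_definition uminus_wiener :: "'a wiener \<Rightarrow> 'a wiener" is "\<lambda>w t. - w t"
  by (auto intro: continuous_on_minus)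
lift_definition scaleR_wiener :: "real \<Rightarrow> 'a wiener \<Rightarrow> 'a wiener" is "\<lambda>r w t. r *\<^sub>R w t"
  by (auto intro: continuous_on_scaleR continuous_on_const)

instance
  by standard (transfer; auto simp: algebra_simps fun_eq_iff)+

end

lemmas path_at_simps [simp] =
  zero_wiener.rep_eq plus_wiener.rep_eq minus_wiener.rep_eq uminus_wiener.rep_eq scaleR_wiener.rep_eq

instantiation wiener :: (finite) real_normed_vector
begin

definition norm_wiener :: "'a wiener \<Rightarrow> real"
  where "norm_wiener w = (SUP t\<in>{0..1}. norm (path_at w t))"
definition sgn_wiener :: "'a wiener \<Rightarrow> 'a wiener"
  where "sgn_wiener w = w /\<^sub>R norm w"
definition dist_wiener :: "'a wiener \<Rightarrow> 'a wiener \<Rightarrow> real"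
  where "dist_wiener v w = norm (v - w)"
definition uniformity_wiener :: "('a wiener \<times> 'a wiener) filter"
  where "uniformity_wiener = (INF e\<in>{0 <..}. principal {(x, y). dist x y < e})"
definition open_wiener :: "'a wiener set \<Rightarrow> bool"
  where "open_wiener U \<longleftrightarrow> (\<forall>x\<in>U. \<forall>\<^sub>F (x', y) in uniformity. x' = x \<longrightarrow> y \<in> U)"

lemma norm_path_at_le: "norm (path_at w t) \<le> norm w"
proof (cases "t \<in> {0..1}")
  case True
  then show ?thesis
    unfolding norm_wiener_def by (intro cSUP_upper bdd_above_path)
next
  case False
  have "0 \<le> norm (path_at w 0)" by simp
  also have "\<dots> \<le> norm w"
    unfolding norm_wiener_def by (intro cSUP_upper bdd_above_path) simp
  finally show ?thesis using False by (simp add: path_at_outside)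
qed

lemma norm_wiener_le: "(\<And>t. t \<in> {0..1} \<Longrightarrow> norm (path_at w t) \<le> b) \<Longrightarrow> norm w \<le> b"
  unfolding norm_wiener_def by (intro cSUP_least) auto

instance
proof
  fix a :: real and v w :: "'a wiener"
  show "norm w = 0 \<longleftrightarrow> w = 0"
  proof
    assume "norm w = 0"
    then show "w = 0"
      using norm_path_at_le[of w] by (intro wiener_eqI) auto
  qed (simp add: norm_wiener_def)
  show "norm (v + w) \<le> norm v + norm w"
    by (rule norm_wiener_le)
       (auto intro!: norm_triangle_le add_mono norm_path_at_le)
  have le: "norm (r *\<^sub>R u) \<le> \<bar>r\<bar> * norm u" for r and u :: "'a wiener"
    by (rule norm_wiener_le) (auto intro!: mult_left_mono norm_path_at_le)
  show "norm (a *\<^sub>R w) = \<bar>a\<bar> * norm w"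
  proof (cases "a = 0")
    case True
    then show ?thesis by (simp add: norm_wiener_def)
  next
    case False
    have "norm w = norm (inverse a *\<^sub>R a *\<^sub>R w)" using False by simp
    also have "\<dots> \<le> \<bar>inverse a\<bar> * norm (a *\<^sub>R w)" by (rule le)
    finally have "\<bar>a\<bar> * norm w \<le> norm (a *\<^sub>R w)"
      using False by (simp add: field_simps)
    with le[of a w] show ?thesis by simp
  qed
qed (simp_all add: sgn_wiener_def dist_wiener_def uniformity_wiener_def open_wiener_def)

end

text \<open>
  The Wiener measure is the law on the Borel sets of $C([0,1],\mathbb{R}^n)$ for which the
  coordinate process is a Brownian motion started at the origin; this determines it uniquely.
\<close>

definition wiener_measure :: "('n::finite) wiener measure \<Rightarrow> bool" where
  "wiener_measure M \<longleftrightarrow>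
     prob_space M \<and> sets M = sets borel \<and>
     (AE w in M. path_at w 0 = 0) \<and>
     (\<forall>s t. 0 \<le> s \<longrightarrow> s < t \<longrightarrow> t \<le> 1 \<longrightarrow>
        distributed M lborel (\<lambda>w. path_at w t - path_at w s)
          (\<lambda>x. ennreal (\<Prod>i\<in>UNIV. normal_density 0 (sqrt (t - s)) (x $ i)))) \<and>
     (\<forall>(q::nat) (t :: nat \<Rightarrow> real). (\<forall>k\<le>q. t k \<in> {0..1}) \<longrightarrow> strict_mono_on {..q} t \<longrightarrow>
        prob_space.indep_vars M (\<lambda>_. borel) (\<lambda>k w. path_at w (t (Suc k)) - path_at w (t k)) {..<q})"


section \<open>The Cameron-Martin space\<close>

definition L2_unit :: "(real \<Rightarrow> real^'n::finite) set" where
  "L2_unit = {g \<in> borel_measurable borel. set_integrable lborel {0..1} (\<lambda>s. (norm (g s))\<^sup>2)}"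

definition is_primitive :: "(real \<Rightarrow> real^'n::finite) \<Rightarrow> 'n wiener \<Rightarrow> bool" where
  "is_primitive g h \<longleftrightarrow> (\<forall>t\<in>{0..1}. path_at h t = (LBINT s:{0..t}. g s))"

typedef (overloaded) ('n::finite) cameron_martin = "{h :: 'n wiener. \<exists>g\<in>L2_unit. is_primitive g h}"
  morphisms cm_path Cm
  by (intro exI[of _ 0] CollectI bexI[of _ "\<lambda>_. 0"])
     (auto simp: L2_unit_def is_primitive_def set_integrable_def)

setup_lifting type_definition_cameron_martin

definition cm_deriv :: "('n::finite) cameron_martin \<Rightarrow> real \<Rightarrow> real^'n" where
  "cm_deriv h = (SOME g. g \<in> L2_unit \<and> is_primitive g (cm_path h))"

text \<open>
  The choice of \<open>cm_deriv\<close> is immaterial for the inner product defined below, by lemma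
  \<open>is_primitive_unique\<close>.
\<close>

lemma L2_unit_measurable [measurable_dest]: "g \<in> L2_unit \<Longrightarrow> g \<in> borel_measurable borel"
  by (simp add: L2_unit_def)

lemma L2_unit_inner_integrable:
  assumes "f \<in> L2_unit" "g \<in> L2_unit"
  shows "set_integrable lborel {0..1} (\<lambda>s. f s \<bullet> g s)"
  unfolding set_integrable_def
proof (rule Bochner_Integration.integrable_bound)
  have [measurable]: "f \<in> borel_measurable borel" "g \<in> borel_measurable borel"
    using assms by (auto simp: L2_unit_def)
  show "integrable lborel (\<lambda>s. indicator {0..1} s *\<^sub>R (norm (f s))\<^sup>2 + indicator {0..1} s *\<^sub>R (norm (g s))\<^sup>2)"
    using assms by (auto simp: L2_unit_def set_integrable_def)
  show "(\<lambda>s. indicator {0..1} s *\<^sub>R (f s \<bullet> g s)) \<in> borel_measurable lborel"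
    by measurable
  show "AE s in lborel. norm (indicator {0..1} s *\<^sub>R (f s \<bullet> g s))
          \<le> norm (indicator {0..1} s *\<^sub>R (norm (f s))\<^sup>2 + indicator {0..1} s *\<^sub>R (norm (g s))\<^sup>2)"
  proof (rule AE_I2)
    fix s
    have "\<bar>f s \<bullet> g s\<bar> \<le> norm (f s) * norm (g s)" by (rule Cauchy_Schwarz_ineq2)
    also have "\<dots> \<le> (norm (f s))\<^sup>2 + (norm (g s))\<^sup>2"
      using sum_squares_bound[of "norm (f s)" "norm (g s)"]
        mult_nonneg_nonneg[OF norm_ge_zero[of "f s"] norm_ge_zero[of "g s"]] by linarith
    finally show "norm (indicator {0..1} s *\<^sub>R (f s \<bullet> g s))
          \<le> norm (indicator {0..1} s *\<^sub>R (norm (f s))\<^sup>2 + indicator {0..1} s *\<^sub>R (norm (g s))\<^sup>2)"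
      by (auto simp: indicator_def)
  qed
qed

lemma L2_unit_integrable:
  assumes "g \<in> L2_unit" "t \<le> 1"
  shows "set_integrable lborel {0..t} g"
proof -
  have [measurable]: "g \<in> borel_measurable borel" using assms by (auto simp: L2_unit_def)
  have "set_integrable lborel {0..1} g"
    unfolding set_integrable_def
  proof (rule Bochner_Integration.integrable_bound)
    show "integrable lborel (\<lambda>s. indicator {0..1::real} s + indicator {0..1} s *\<^sub>R (norm (g s))\<^sup>2)"
      using assms by (auto simp: L2_unit_def set_integrable_def)
    show "(\<lambda>s. indicator {0..1} s *\<^sub>R g s) \<in> borel_measurable lborel"
      by measurable
    have "x \<le> 1 + x\<^sup>2" if "x \<ge> 0" for x :: real
      using sum_squares_bound[of 1 x] that by auto
    then show "AE s in lborel. norm (indicator {0..1} s *\<^sub>R g s)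
          \<le> norm (indicator {0..1} s + indicator {0..1} s *\<^sub>R (norm (g s))\<^sup>2)"
      by (intro AE_I2) (auto simp: indicator_def abs_of_nonneg)
  qed
  then show ?thesis
    by (rule set_integrable_subset) (use assms in auto)
qed

lemma L2_unit_add:
  assumes f: "f \<in> L2_unit" and g: "g \<in> L2_unit"
  shows "(\<lambda>s. f s + g s) \<in> L2_unit"
proof -
  have "(norm (x + y))\<^sup>2 = (x \<bullet> x + 2 * (x \<bullet> y)) + y \<bullet> y" for x y :: "real^'a"
    unfolding power2_norm_eq_inner by (simp only: inner_add_left inner_add_right inner_commute[of y x])
  moreover have "set_integrable lborel {0..1} (\<lambda>s. (f s \<bullet> f s + 2 * (f s \<bullet> g s)) + g s \<bullet> g s)"
    by (intro set_integral_add(1) set_integrable_mult_right L2_unit_inner_integrable f g)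
  ultimately have "set_integrable lborel {0..1} (\<lambda>s. (norm (f s + g s))\<^sup>2)" by simp
  moreover have "(\<lambda>s. f s + g s) \<in> borel_measurable borel"
    using f g by (auto simp: L2_unit_def)
  ultimately show ?thesis by (simp add: L2_unit_def)
qed

lemma L2_unit_scaleR:
  assumes g: "g \<in> L2_unit"
  shows "(\<lambda>s. r *\<^sub>R g s) \<in> L2_unit"
proof -
  have "set_integrable lborel {0..1} (\<lambda>s. r\<^sup>2 * (norm (g s))\<^sup>2)"
    by (rule set_integrable_mult_right) (use g in \<open>simp only: L2_unit_def mem_Collect_eq\<close>)
  moreover have "(\<lambda>s. r *\<^sub>R g s) \<in> borel_measurable borel"
    using g by (intro borel_measurable_scaleR borel_measurable_const) (simp only: L2_unit_def mem_Collect_eq)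
  ultimately show ?thesis
    by (simp only: L2_unit_def mem_Collect_eq norm_scaleR power_mult_distrib power2_abs)
qed

lemma is_primitive_add:
  assumes "f \<in> L2_unit" "g \<in> L2_unit" "is_primitive f h" "is_primitive g k"
  shows "is_primitive (\<lambda>s. f s + g s) (h + k)"
  unfolding is_primitive_def
proof
  fix t :: real assume t: "t \<in> {0..1}"
  have "(LBINT s:{0..t}. f s + g s) = (LBINT s:{0..t}. f s) + (LBINT s:{0..t}. g s)"
    using t by (intro set_integral_add(2) L2_unit_integrable assms(1,2)) auto
  also have "(LBINT s:{0..t}. f s) = path_at h t"
    using assms(3) t by (simp only: is_primitive_def)
  also have "(LBINT s:{0..t}. g s) = path_at k t"
    using assms(4) t by (simp only: is_primitive_def)
  finally show "path_at (h + k) t = (LBINT s:{0..t}. f s + g s)" by simp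
qed

lemma is_primitive_scaleR:
  assumes "is_primitive g h"
  shows "is_primitive (\<lambda>s. r *\<^sub>R g s) (r *\<^sub>R h)"
  unfolding is_primitive_def
proof
  fix t :: real assume t: "t \<in> {0..1}"
  have "(LBINT s:{0..t}. g s) = path_at h t"
    using assms t by (simp only: is_primitive_def)
  then show "path_at (r *\<^sub>R h) t = (LBINT s:{0..t}. r *\<^sub>R g s)"
    by simp
qed

lemma L2_unit_zero: "(\<lambda>_. 0) \<in> L2_unit"
  by (auto simp: L2_unit_def set_integrable_def)

lemma is_primitive_zero: "is_primitive (\<lambda>_. 0) 0"
  by (auto simp: is_primitive_def)

lemma is_primitive_unique:
  assumes f: "f \<in> L2_unit" "is_primitive f h" and g: "g \<in> L2_unit" "is_primitive g h"
  shows "AE s in lborel. s \<in> {0..1} \<longrightarrow> f s = g s"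
proof -
  define d where "d s = indicator {0..1::real} s *\<^sub>R (f s - g s)" for s
  have int: "integrable lborel d"
    using set_integral_diff(1)[OF L2_unit_integrable[OF f(1), of 1] L2_unit_integrable[OF g(1), of 1]]
    by (simp add: d_def[abs_def] set_integrable_def)
  have prim_diff: "(LBINT s:{0..t}. f s - g s) = 0" if t: "t \<in> {0..1}" for t
  proof -
    have "(LBINT s:{0..t}. f s - g s) = (LBINT s:{0..t}. f s) - (LBINT s:{0..t}. g s)"
      using t by (intro set_integral_diff(2) L2_unit_integrable f(1) g(1)) auto
    also have "(LBINT s:{0..t}. f s) = path_at h t"
      using f(2) t by (simp only: is_primitive_def)
    also have "(LBINT s:{0..t}. g s) = path_at h t"
      using g(2) t by (simp only: is_primitive_def)
    finally show ?thesis by simp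
  qed
  have iic: "(LBINT s:{..t}. d s) = 0" for t
  proof -
    consider "t < 0" | "t \<in> {0..1}" | "t > 1"
      unfolding atLeastAtMost_iff by linarith
    then show ?thesis
    proof cases
      case 1
      then have "indicator {..t} s *\<^sub>R d s = 0" for s by (auto simp: d_def indicator_def)
      then show ?thesis
        unfolding set_lebesgue_integral_def by (simp only: Bochner_Integration.integral_zero)
    next
      case 2
      have "(LBINT s:{..t}. d s) = (LBINT s:{0..t}. f s - g s)"
        unfolding set_lebesgue_integral_def
        by (rule Bochner_Integration.integral_cong) (use 2 in \<open>auto simp: d_def indicator_def\<close>)
      also have "\<dots> = 0"
        using prim_diff[of t] 2 by simp
      finally show ?thesis .
    next
      case 3
      have "(LBINT s:{..t}. d s) = (LBINT s:{0..1}. f s - g s)"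
        unfolding set_lebesgue_integral_def
        by (rule Bochner_Integration.integral_cong) (use 3 in \<open>auto simp: d_def indicator_def\<close>)
      also have "\<dots> = 0"
        using prim_diff[of 1] by simp
      finally show ?thesis .
    qed
  qed
  have total: "(LBINT s. d s) = 0"
  proof -
    have "(LBINT s. d s) = (LBINT s:{..1}. d s)"
      unfolding set_lebesgue_integral_def
      by (rule Bochner_Integration.integral_cong) (auto simp: d_def indicator_def)
    then show ?thesis using iic by simp
  qed
  have sint: "set_integrable lborel A d" if "A \<in> sets borel" for A
    unfolding set_integrable_def using that int by (intro integrable_mult_indicator) auto
  have borel_eq: "sets (borel :: real measure) = sigma_sets UNIV (range atMost)"
    by (subst borel_eq_atMost) simp
  have zero: "(LBINT s:A. d s) = 0" if "A \<in> sets borel" for A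
  proof -
    have "Int_stable (range (atMost :: real \<Rightarrow> real set))"
      by (auto simp: Int_stable_def)
    moreover have "range (atMost :: real \<Rightarrow> real set) \<subseteq> Pow UNIV" by simp
    moreover have "A \<in> sigma_sets UNIV (range atMost)" using that borel_eq by simp
    ultimately show ?thesis
    proof (induction rule: sigma_sets_induct_disjoint)
      case (basic A)
      then show ?case using iic by auto
    next
      case empty
      show ?case by (simp add: set_lebesgue_integral_def)
    next
      case (compl A)
      have A: "A \<in> sets borel" using compl borel_eq by simp
      have "(LBINT s:A \<union> (UNIV - A). d s) = (LBINT s:A. d s) + (LBINT s:UNIV - A. d s)"
        by (rule set_integral_Un) (use A in \<open>auto intro!: sint\<close>)
      moreover have "(LBINT s:A \<union> (UNIV - A). d s) = 0"
        using total by (simp add: set_lebesgue_integral_def)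
      ultimately show ?case using compl by simp
    next
      case (union A)
      have A: "A i \<in> sets borel" for i using union(2) borel_eq by auto
      have "(LBINT s:(\<Union>i. A i). d s) = (\<Sum>i. LBINT s:A i. d s)"
      proof (rule lebesgue_integral_countable_add)
        show "A i \<in> sets lborel" for i using A by simp
        show "i \<noteq> j \<Longrightarrow> A i \<inter> A j = {}" for i j
          using union(1) by (auto simp: disjoint_family_on_def)
        show "set_integrable lborel (\<Union>i. A i) d" using A by (intro sint) auto
      qed
      then show ?case using union(3) by simp
    qed
  qed
  have "AE s in lborel. d s = 0"
    by (rule sigma_finite_measure.density_zero[OF lborel.sigma_finite_measure_axioms int]) (use zero in auto)
  then show ?thesis
    by eventually_elim (auto simp: d_def)
qed

lemma cm_deriv: "cm_deriv h \<in> L2_unit" "is_primitive (cm_deriv h) (cm_path h)"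
proof -
  have "\<exists>g. g \<in> L2_unit \<and> is_primitive g (cm_path h)"
    using cm_path[of h] by auto
  from someI_ex[OF this] show "cm_deriv h \<in> L2_unit" "is_primitive (cm_deriv h) (cm_path h)"
    by (auto simp: cm_deriv_def)
qed

instantiation cameron_martin :: (finite) real_vector
begin

lift_definition zero_cameron_martin :: "'a cameron_martin" is 0
  by (rule bexI, rule is_primitive_zero, rule L2_unit_zero)
lift_definition plus_cameron_martin :: "'a cameron_martin \<Rightarrow> 'a cameron_martin \<Rightarrow> 'a cameron_martin"
  is "(+)" by (elim bexE, rule bexI, rule is_primitive_add, assumption+, rule L2_unit_add, assumption+)
lift_definition scaleR_cameron_martin :: "real \<Rightarrow> 'a cameron_martin \<Rightarrow> 'a cameron_martin"
  is "(*\<^sub>R)" by (elim bexE, rule bexI, rule is_primitive_scaleR, assumption, rule L2_unit_scaleR, assumption)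
definition uminus_cameron_martin :: "'a cameron_martin \<Rightarrow> 'a cameron_martin"
  where "uminus_cameron_martin h = (-1) *\<^sub>R h"
definition minus_cameron_martin :: "'a cameron_martin \<Rightarrow> 'a cameron_martin \<Rightarrow> 'a cameron_martin"
  where "minus_cameron_martin h k = h + - k"

instance
proof
  fix a b :: real and h k l :: "'a cameron_martin"
  show "h + k + l = h + (k + l)" by transfer (simp add: add.assoc)
  show "h + k = k + h" by transfer (simp add: add.commute)
  show "0 + h = h" by transfer simp
  show "- h + h = 0" unfolding uminus_cameron_martin_def by transfer simp
  show "h - k = h + - k" by (fact minus_cameron_martin_def)
  show "a *\<^sub>R (h + k) = a *\<^sub>R h + a *\<^sub>R k" by transfer (simp add: scaleR_right_distrib)
  show "(a + b) *\<^sub>R h = a *\<^sub>R h + b *\<^sub>R h" by transfer (simp add: scaleR_left_distrib)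
  show "a *\<^sub>R b *\<^sub>R h = (a * b) *\<^sub>R h" by transfer simp
  show "1 *\<^sub>R h = h" by transfer simp
qed

end

lemma cm_path_simps [simp]:
  "cm_path 0 = 0" "cm_path (h + k) = cm_path h + cm_path k"
  "cm_path (r *\<^sub>R h) = r *\<^sub>R cm_path h"
  "cm_path (- h) = - cm_path h" "cm_path (h - k) = cm_path h - cm_path k"
proof -
  show add: "cm_path (h + k) = cm_path h + cm_path k" for h k by (rule plus_cameron_martin.rep_eq)
  show scale: "cm_path (r *\<^sub>R h) = r *\<^sub>R cm_path h" for r h by (rule scaleR_cameron_martin.rep_eq)
  show minus: "cm_path (- h) = - cm_path h" for h
    by (subst uminus_cameron_martin_def, subst scale) simp
  show "cm_path (h - k) = cm_path h - cm_path k"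
    by (subst minus_cameron_martin_def) (simp only: add minus diff_conv_add_uminus)
qed (rule zero_cameron_martin.rep_eq)

lemma cm_deriv_add:
  "AE s in lborel. s \<in> {0..1} \<longrightarrow> cm_deriv (h + k) s = cm_deriv h s + cm_deriv k s"
  using cm_deriv(2)[of "h + k"] unfolding cm_path_simps
  by (rule is_primitive_unique[OF cm_deriv(1) _ L2_unit_add is_primitive_add])
     (rule cm_deriv)+

lemma cm_deriv_scaleR:
  "AE s in lborel. s \<in> {0..1} \<longrightarrow> cm_deriv (r *\<^sub>R h) s = r *\<^sub>R cm_deriv h s"
  using cm_deriv(2)[of "r *\<^sub>R h"] unfolding cm_path_simps
  by (rule is_primitive_unique[OF cm_deriv(1) _ L2_unit_scaleR is_primitive_scaleR])
     (rule cm_deriv)+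

instantiation cameron_martin :: (finite) real_inner
begin

definition inner_cameron_martin :: "'a cameron_martin \<Rightarrow> 'a cameron_martin \<Rightarrow> real"
  where "inner_cameron_martin h k = (LBINT s:{0..1}. cm_deriv h s \<bullet> cm_deriv k s)"
definition norm_cameron_martin :: "'a cameron_martin \<Rightarrow> real"
  where "norm_cameron_martin h = sqrt (h \<bullet> h)"
definition sgn_cameron_martin :: "'a cameron_martin \<Rightarrow> 'a cameron_martin"
  where "sgn_cameron_martin h = h /\<^sub>R norm h"
definition dist_cameron_martin :: "'a cameron_martin \<Rightarrow> 'a cameron_martin \<Rightarrow> real"
  where "dist_cameron_martin h k = norm (h - k)"
definition uniformity_cameron_martin :: "('a cameron_martin \<times> 'a cameron_martin) filter"
  where "uniformity_cameron_martin = (INF e\<in>{0 <..}. principal {(x, y). dist x y < e})"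
definition open_cameron_martin :: "'a cameron_martin set \<Rightarrow> bool"
  where "open_cameron_martin U \<longleftrightarrow> (\<forall>x\<in>U. \<forall>\<^sub>F (x', y) in uniformity. x' = x \<longrightarrow> y \<in> U)"

lemma cm_integral_cong:
  fixes u v :: "real \<Rightarrow> 'b::{banach, second_countable_topology}"
  assumes "u \<in> borel_measurable borel" "v \<in> borel_measurable borel"
    and "AE s in lborel. s \<in> {0..1} \<longrightarrow> u s = v s" and "t \<le> 1"
  shows "(LBINT s:{0..t}. u s) = (LBINT s:{0..t}. v s)"
proof (rule set_lebesgue_integral_cong_AE)
  show "AE s\<in>{0..t} in lborel. u s = v s"
    using assms(3) by eventually_elim (use assms(4) in auto)
qed (use assms in simp_all)

instance
proof
  fix r :: real and h k l :: "'a cameron_martin"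
  have meas: "cm_deriv m \<in> borel_measurable borel" for m :: "'a cameron_martin"
    by (rule L2_unit_measurable[OF cm_deriv(1)])
  show "h \<bullet> k = k \<bullet> h"
    unfolding inner_cameron_martin_def by (subst inner_commute) (rule refl)
  have "(h + k) \<bullet> l = (LBINT s:{0..1}. cm_deriv h s \<bullet> cm_deriv l s + cm_deriv k s \<bullet> cm_deriv l s)"
    unfolding inner_cameron_martin_def
  proof (rule cm_integral_cong)
    show "AE s in lborel. s \<in> {0..1} \<longrightarrow>
        cm_deriv (h + k) s \<bullet> cm_deriv l s = cm_deriv h s \<bullet> cm_deriv l s + cm_deriv k s \<bullet> cm_deriv l s"
      using cm_deriv_add[of h k] by eventually_elim (simp add: inner_add_left)
  qed (intro borel_measurable_inner borel_measurable_add borel_measurable_times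
      borel_measurable_const meas order_refl)+
  also have "\<dots> = h \<bullet> l + k \<bullet> l"
    unfolding inner_cameron_martin_def
    by (intro set_integral_add(2) L2_unit_inner_integrable cm_deriv(1))
  finally show "(h + k) \<bullet> l = h \<bullet> l + k \<bullet> l" .
  have scale: "(a *\<^sub>R m) \<bullet> m' = a * (m \<bullet> m')" for a and m m' :: "'a cameron_martin"
  proof -
    have "(a *\<^sub>R m) \<bullet> m' = (LBINT s:{0..1}. a * (cm_deriv m s \<bullet> cm_deriv m' s))"
      unfolding inner_cameron_martin_def
    proof (rule cm_integral_cong)
      show "AE s in lborel. s \<in> {0..1} \<longrightarrow>
          cm_deriv (a *\<^sub>R m) s \<bullet> cm_deriv m' s = a * (cm_deriv m s \<bullet> cm_deriv m' s)"
        using cm_deriv_scaleR[of a m] by eventually_elim simp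
    qed (intro borel_measurable_inner borel_measurable_add borel_measurable_times
      borel_measurable_const meas order_refl)+
    then show ?thesis by (simp add: inner_cameron_martin_def)
  qed
  show "(r *\<^sub>R h) \<bullet> k = r * (h \<bullet> k)" by (rule scale)
  show "0 \<le> h \<bullet> h"
    unfolding inner_cameron_martin_def set_lebesgue_integral_def
    by (rule Bochner_Integration.integral_nonneg) simp
  show "h \<bullet> h = 0 \<longleftrightarrow> h = 0"
  proof
    assume "h \<bullet> h = 0"
    then have "(LBINT s. indicator {0..1} s *\<^sub>R (cm_deriv h s \<bullet> cm_deriv h s)) = 0"
      by (simp only: inner_cameron_martin_def set_lebesgue_integral_def)
    moreover have "integrable lborel (\<lambda>s. indicator {0..1} s *\<^sub>R (cm_deriv h s \<bullet> cm_deriv h s))"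
      using L2_unit_inner_integrable[OF cm_deriv(1) cm_deriv(1), of h h]
      by (simp only: set_integrable_def)
    ultimately have "AE s in lborel. indicator {0..1} s *\<^sub>R (cm_deriv h s \<bullet> cm_deriv h s) = 0"
      using integral_nonneg_eq_0_iff_AE[of lborel "\<lambda>s. indicator {0..1} s *\<^sub>R (cm_deriv h s \<bullet> cm_deriv h s)"]
      by simp
    then have ae: "AE s in lborel. s \<in> {0..1} \<longrightarrow> cm_deriv h s = 0"
      by eventually_elim (simp add: indicator_def)
    have "path_at (cm_path h) t = path_at 0 t" if t: "t \<in> {0..1}" for t
    proof -
      have "path_at (cm_path h) t = (LBINT s:{0..t}. cm_deriv h s)"
        using cm_deriv(2)[of h] t by (simp only: is_primitive_def)
      also have "\<dots> = (LBINT s:{0..t}. 0)"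
        by (rule cm_integral_cong) (use ae t meas in simp_all)
      finally show ?thesis by simp
    qed
    then have "cm_path h = cm_path 0" unfolding cm_path_simps by (rule wiener_eqI)
    then show "h = 0" by (simp only: cm_path_inject)
  next
    assume "h = 0"
    then show "h \<bullet> h = 0" using scale[of 0 h h] by simp
  qed
qed (simp_all add: norm_cameron_martin_def sgn_cameron_martin_def dist_cameron_martin_def
    uniformity_cameron_martin_def open_cameron_martin_def)

end


section \<open>Hilbert-Schmidt operators\<close>

definition orthonormal :: "'a::real_inner set \<Rightarrow> bool" where
  "orthonormal B \<longleftrightarrow> pairwise orthogonal B \<and> (\<forall>e\<in>B. norm e = 1)"

definition hilbert_basis :: "'a::real_inner set \<Rightarrow> bool" where
  "hilbert_basis B \<longleftrightarrow> orthonormal B \<and> closure (span B) = UNIV"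

text \<open>
  The Hilbert-Schmidt norm of \<open>T\<close> is the supremum, over the finite orthonormal sets \<open>F\<close>,
  of $(\sum_{e \in F} |T e|^2)^{1/2}$.  This form makes no choice of a basis.  Lemmas
  \<open>is_hilbert_schmidt_iff\<close> and \<open>hs_norm_hilbert_basis\<close> below show that it agrees with
  the definition by the sum of $|T e|^2$ over any Hilbert basis.
\<close>

definition finite_orthonormal :: "'a::real_inner set set" where
  "finite_orthonormal = {F. finite F \<and> orthonormal F}"

definition is_hilbert_schmidt :: "('h::real_inner \<Rightarrow> 'x::real_inner) \<Rightarrow> bool" where
  "is_hilbert_schmidt T \<longleftrightarrow> bounded_linear T \<and>
     bdd_above ((\<lambda>F. L2_set (\<lambda>e. norm (T e)) F) ` finite_orthonormal)"

lemma L2_set_norm_add_le: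
  "L2_set (\<lambda>e. norm (f e + g e)) F \<le> L2_set (\<lambda>e. norm (f e)) F + L2_set (\<lambda>e. norm (g e)) F"
  by (rule order_trans[OF L2_set_mono L2_set_triangle_ineq]) (auto intro: norm_triangle_ineq)

lemma L2_set_norm_scaleR:
  "L2_set (\<lambda>e. norm (r *\<^sub>R f e)) F = \<bar>r\<bar> * L2_set (\<lambda>e. norm (f e)) F"
  by (simp add: L2_set_right_distrib)

lemma is_hilbert_schmidt_zero: "is_hilbert_schmidt (\<lambda>_. 0)"
  by (auto simp: is_hilbert_schmidt_def L2_set_def intro!: bdd_aboveI[of _ 0])

lemma is_hilbert_schmidt_add:
  assumes S: "is_hilbert_schmidt S" and T: "is_hilbert_schmidt T"
  shows "is_hilbert_schmidt (\<lambda>h. S h + T h)"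
  unfolding is_hilbert_schmidt_def
proof
  show "bounded_linear (\<lambda>h. S h + T h)"
    using S T by (auto simp: is_hilbert_schmidt_def intro: bounded_linear_add)
  obtain a where a: "\<And>F. F \<in> finite_orthonormal \<Longrightarrow> L2_set (\<lambda>e. norm (S e)) F \<le> a"
    using S by (auto simp: is_hilbert_schmidt_def bdd_above_def)
  obtain b where b: "\<And>F. F \<in> finite_orthonormal \<Longrightarrow> L2_set (\<lambda>e. norm (T e)) F \<le> b"
    using T by (auto simp: is_hilbert_schmidt_def bdd_above_def)
  show "bdd_above ((\<lambda>F. L2_set (\<lambda>e. norm (S e + T e)) F) ` finite_orthonormal)"
    by (intro bdd_aboveI2[of _ _ "a + b"] order_trans[OF L2_set_norm_add_le] add_mono a b)
qed

lemma is_hilbert_schmidt_scaleR: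
  assumes T: "is_hilbert_schmidt T"
  shows "is_hilbert_schmidt (\<lambda>h. r *\<^sub>R T h)"
  unfolding is_hilbert_schmidt_def
proof
  show "bounded_linear (\<lambda>h. r *\<^sub>R T h)"
    using T by (auto simp: is_hilbert_schmidt_def intro: bounded_linear_const_scaleR)
  obtain b where b: "\<And>F. F \<in> finite_orthonormal \<Longrightarrow> L2_set (\<lambda>e. norm (T e)) F \<le> b"
    using T by (auto simp: is_hilbert_schmidt_def bdd_above_def)
  show "bdd_above ((\<lambda>F. L2_set (\<lambda>e. norm (r *\<^sub>R T e)) F) ` finite_orthonormal)"
    unfolding L2_set_norm_scaleR
    by (intro bdd_aboveI2[of _ _ "\<bar>r\<bar> * b"] mult_left_mono b) auto
qed

typedef (overloaded) ('h::real_inner, 'x::real_inner) hilbert_schmidt =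
  "{T :: 'h \<Rightarrow> 'x. is_hilbert_schmidt T}"
  morphisms hs_apply Hs
  using is_hilbert_schmidt_zero by blast

setup_lifting type_definition_hilbert_schmidt

lemma finite_orthonormal_empty [simp]: "{} \<in> finite_orthonormal"
  by (auto simp: finite_orthonormal_def orthonormal_def)

lemma bounded_linear_hs_apply: "bounded_linear (hs_apply T)"
  using hs_apply[of T] by (simp add: is_hilbert_schmidt_def)

lemma bdd_above_hs: "bdd_above ((\<lambda>F. L2_set (\<lambda>e. norm (hs_apply T e)) F) ` finite_orthonormal)"
  using hs_apply[of T] by (simp add: is_hilbert_schmidt_def)

instantiation hilbert_schmidt :: (real_inner, real_inner) real_vector
begin

lift_definition zero_hilbert_schmidt :: "('a, 'b) hilbert_schmidt" is "\<lambda>_. 0"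
  by (rule is_hilbert_schmidt_zero)
lift_definition plus_hilbert_schmidt ::
  "('a, 'b) hilbert_schmidt \<Rightarrow> ('a, 'b) hilbert_schmidt \<Rightarrow> ('a, 'b) hilbert_schmidt"
  is "\<lambda>S T h. S h + T h" by (rule is_hilbert_schmidt_add)
lift_definition scaleR_hilbert_schmidt ::
  "real \<Rightarrow> ('a, 'b) hilbert_schmidt \<Rightarrow> ('a, 'b) hilbert_schmidt"
  is "\<lambda>r T h. r *\<^sub>R T h" by (rule is_hilbert_schmidt_scaleR)
definition uminus_hilbert_schmidt :: "('a, 'b) hilbert_schmidt \<Rightarrow> ('a, 'b) hilbert_schmidt"
  where "uminus_hilbert_schmidt T = (-1) *\<^sub>R T"
definition minus_hilbert_schmidt ::
  "('a, 'b) hilbert_schmidt \<Rightarrow> ('a, 'b) hilbert_schmidt \<Rightarrow> ('a, 'b) hilbert_schmidt"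
  where "minus_hilbert_schmidt S T = S + - T"

instance
proof
  fix a b :: real and R S T :: "('a, 'b) hilbert_schmidt"
  show "R + S + T = R + (S + T)" by transfer (simp add: add.assoc)
  show "R + S = S + R" by transfer (simp add: add.commute)
  show "0 + R = R" by transfer simp
  show "- R + R = 0" unfolding uminus_hilbert_schmidt_def by transfer simp
  show "R - S = R + - S" by (fact minus_hilbert_schmidt_def)
  show "a *\<^sub>R (R + S) = a *\<^sub>R R + a *\<^sub>R S" by transfer (simp add: scaleR_right_distrib)
  show "(a + b) *\<^sub>R R = a *\<^sub>R R + b *\<^sub>R R" by transfer (simp add: scaleR_left_distrib)
  show "a *\<^sub>R b *\<^sub>R R = (a * b) *\<^sub>R R" by transfer simp
  show "1 *\<^sub>R R = R" by transfer simp
qed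

end

lemma hs_apply_simps [simp]:
  "hs_apply 0 h = 0" "hs_apply (S + T) h = hs_apply S h + hs_apply T h"
  "hs_apply (r *\<^sub>R T) h = r *\<^sub>R hs_apply T h"
  "hs_apply (- T) h = - hs_apply T h" "hs_apply (S - T) h = hs_apply S h - hs_apply T h"
proof -
  show add: "hs_apply (S + T) h = hs_apply S h + hs_apply T h" for S T
    by (simp only: plus_hilbert_schmidt.rep_eq)
  show scale: "hs_apply (r *\<^sub>R T) h = r *\<^sub>R hs_apply T h" for r T
    by (simp only: scaleR_hilbert_schmidt.rep_eq)
  show minus: "hs_apply (- T) h = - hs_apply T h" for T
    by (subst uminus_hilbert_schmidt_def, subst scale) simp
  show "hs_apply (S - T) h = hs_apply S h - hs_apply T h"
    by (subst minus_hilbert_schmidt_def) (simp only: add minus diff_conv_add_uminus)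
qed (simp only: zero_hilbert_schmidt.rep_eq)

instantiation hilbert_schmidt :: (real_inner, real_inner) real_normed_vector
begin

definition norm_hilbert_schmidt :: "('a, 'b) hilbert_schmidt \<Rightarrow> real"
  where "norm_hilbert_schmidt T = (SUP F\<in>finite_orthonormal. L2_set (\<lambda>e. norm (hs_apply T e)) F)"
definition sgn_hilbert_schmidt :: "('a, 'b) hilbert_schmidt \<Rightarrow> ('a, 'b) hilbert_schmidt"
  where "sgn_hilbert_schmidt T = T /\<^sub>R norm T"
definition dist_hilbert_schmidt :: "('a, 'b) hilbert_schmidt \<Rightarrow> ('a, 'b) hilbert_schmidt \<Rightarrow> real"
  where "dist_hilbert_schmidt S T = norm (S - T)"
definition uniformity_hilbert_schmidt :: "(('a, 'b) hilbert_schmidt \<times> ('a, 'b) hilbert_schmidt) filter"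
  where "uniformity_hilbert_schmidt = (INF e\<in>{0 <..}. principal {(x, y). dist x y < e})"
definition open_hilbert_schmidt :: "('a, 'b) hilbert_schmidt set \<Rightarrow> bool"
  where "open_hilbert_schmidt U \<longleftrightarrow> (\<forall>x\<in>U. \<forall>\<^sub>F (x', y) in uniformity. x' = x \<longrightarrow> y \<in> U)"

lemma L2_set_le_hs_norm:
  "F \<in> finite_orthonormal \<Longrightarrow> L2_set (\<lambda>e. norm (hs_apply T e)) F \<le> norm T"
  unfolding norm_hilbert_schmidt_def by (intro cSUP_upper bdd_above_hs)

lemma hs_norm_le:
  "(\<And>F. F \<in> finite_orthonormal \<Longrightarrow> L2_set (\<lambda>e. norm (hs_apply T e)) F \<le> b) \<Longrightarrow> norm T \<le> b"
  unfolding norm_hilbert_schmidt_def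
  by (intro cSUP_least) (use finite_orthonormal_empty in blast)+

lemma norm_hs_apply_le: "norm (hs_apply T h) \<le> norm T * norm h"
proof (cases "h = 0")
  case True
  then show ?thesis
    using linear_0[OF bounded_linear.linear[OF bounded_linear_hs_apply[of T]]] by simp
next
  case False
  have "{sgn h} \<in> finite_orthonormal"
    using False by (auto simp: finite_orthonormal_def orthonormal_def norm_sgn)
  from L2_set_le_hs_norm[OF this, of T] have "norm (hs_apply T (sgn h)) \<le> norm T" by simp
  then show ?thesis
    using False linear_scale[OF bounded_linear.linear[OF bounded_linear_hs_apply[of T]]]
    by (simp add: sgn_div_norm field_simps)
qed

instance
proof
  fix r :: real and S T :: "('a, 'b) hilbert_schmidt"
  show "norm T = 0 \<longleftrightarrow> T = 0"
  proof
    assume "norm T = 0"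
    then have "hs_apply T h = hs_apply 0 h" for h
      using norm_hs_apply_le[of T h] by simp
    then show "T = 0" by (metis ext hs_apply_inject)
  next
    assume "T = 0"
    have "norm (0 :: ('a, 'b) hilbert_schmidt) \<le> 0"
      by (rule hs_norm_le) (simp add: L2_set_def)
    moreover have "0 \<le> norm (0 :: ('a, 'b) hilbert_schmidt)"
      using L2_set_le_hs_norm[OF finite_orthonormal_empty, of "0 :: ('a, 'b) hilbert_schmidt"] by simp
    ultimately have "norm (0 :: ('a, 'b) hilbert_schmidt) = 0" by (rule antisym)
    with \<open>T = 0\<close> show "norm T = 0" by simp
  qed
  show "norm (S + T) \<le> norm S + norm T"
    unfolding hs_apply_simps
    by (rule hs_norm_le)
       (auto intro!: order_trans[OF L2_set_norm_add_le] add_mono L2_set_le_hs_norm)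
  have le: "norm (a *\<^sub>R U) \<le> \<bar>a\<bar> * norm U" for a and U :: "('a, 'b) hilbert_schmidt"
    by (rule hs_norm_le)
       (auto simp: L2_set_norm_scaleR simp del: norm_scaleR intro!: mult_left_mono L2_set_le_hs_norm)
  show "norm (r *\<^sub>R T) = \<bar>r\<bar> * norm T"
  proof (cases "r = 0")
    case True
    then show ?thesis using \<open>norm T = 0 \<longleftrightarrow> T = 0\<close> le[of r T]
      L2_set_le_hs_norm[OF finite_orthonormal_empty, of "r *\<^sub>R T"] by simp
  next
    case False
    have "norm T = norm (inverse r *\<^sub>R r *\<^sub>R T)" using False by simp
    also have "\<dots> \<le> \<bar>inverse r\<bar> * norm (r *\<^sub>R T)" by (rule le)
    finally have "\<bar>r\<bar> * norm T \<le> norm (r *\<^sub>R T)"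
      using False by (simp add: field_simps)
    with le[of r T] show ?thesis by simp
  qed
qed (simp_all add: sgn_hilbert_schmidt_def dist_hilbert_schmidt_def
    uniformity_hilbert_schmidt_def open_hilbert_schmidt_def)

end

lemma orthonormal_inner:
  "orthonormal B \<Longrightarrow> x \<in> B \<Longrightarrow> y \<in> B \<Longrightarrow> x \<bullet> y = (if x = y then 1 else 0)"
  by (auto simp: orthonormal_def pairwise_def orthogonal_def norm_eq_1)

lemma orthonormal_subset: "orthonormal B \<Longrightarrow> F \<subseteq> B \<Longrightarrow> orthonormal F"
  by (auto simp: orthonormal_def pairwise_def)

lemma inner_orthonormal_sum:
  assumes "finite F" "orthonormal F"
  shows "(\<Sum>e\<in>F. a e *\<^sub>R e) \<bullet> (\<Sum>e\<in>F. b e *\<^sub>R e) = (\<Sum>e\<in>F. a e * b e)"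
proof -
  have "(\<Sum>e\<in>F. a e *\<^sub>R e) \<bullet> (\<Sum>e\<in>F. b e *\<^sub>R e) = (\<Sum>e\<in>F. \<Sum>e'\<in>F. a e * (b e' * (e \<bullet> e')))"
    unfolding inner_sum_left inner_scaleR_left inner_sum_right inner_scaleR_right sum_distrib_left
    by (subst sum.swap) (simp only: mult.left_commute)
  also have "\<dots> = (\<Sum>e\<in>F. \<Sum>e'\<in>F. if e = e' then a e * b e' else 0)"
    by (intro sum.cong refl) (simp add: orthonormal_inner[OF assms(2)])
  also have "\<dots> = (\<Sum>e\<in>F. a e * b e)"
    using assms(1) by (intro sum.cong refl) simp
  finally show ?thesis .
qed

lemma norm_orthonormal_sum:
  assumes "finite F" "orthonormal F"
  shows "norm (\<Sum>e\<in>F. a e *\<^sub>R e) = L2_set a F"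
  by (simp add: norm_eq_sqrt_inner inner_orthonormal_sum[OF assms] L2_set_def power2_eq_square)

lemma orthonormal_residual:
  assumes "finite Y" "orthonormal Y"
  defines "P \<equiv> \<lambda>z. \<Sum>y\<in>Y. (z \<bullet> y) *\<^sub>R y"
  shows "(norm (z - P z))\<^sup>2 = (norm z)\<^sup>2 - (\<Sum>y\<in>Y. (z \<bullet> y)\<^sup>2)"
proof -
  have "z \<bullet> P z = (\<Sum>y\<in>Y. (z \<bullet> y)\<^sup>2)"
    by (simp add: P_def inner_sum_right power2_eq_square)
  moreover have "P z \<bullet> P z = (\<Sum>y\<in>Y. (z \<bullet> y)\<^sup>2)"
    unfolding P_def by (subst inner_orthonormal_sum[OF assms(1,2)]) (simp add: power2_eq_square)
  moreover have "(norm (z - P z))\<^sup>2 = z \<bullet> z - 2 * (z \<bullet> P z) + P z \<bullet> P z"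
    by (simp add: power2_norm_eq_inner inner_diff_left inner_diff_right inner_commute[of "P z" z])
  ultimately show ?thesis by (simp add: power2_norm_eq_inner)
qed

lemma orthonormal_bessel:
  assumes "finite Y" "orthonormal Y"
  shows "(\<Sum>y\<in>Y. (z \<bullet> y)\<^sup>2) \<le> (norm z)\<^sup>2"
  using orthonormal_residual[OF assms, of z]
    zero_le_power2[of "norm (z - (\<Sum>y\<in>Y. (z \<bullet> y) *\<^sub>R y))"] by linarith

lemma orthonormal_parseval_span:
  assumes "finite Y" "orthonormal Y" "z \<in> span Y"
  shows "(\<Sum>y\<in>Y. (z \<bullet> y)\<^sup>2) = (norm z)\<^sup>2"
proof -
  define d where "d = z - (\<Sum>y\<in>Y. (z \<bullet> y) *\<^sub>R y)"
  have dY: "d \<bullet> x = 0" if x: "x \<in> Y" for x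
  proof -
    have "(\<Sum>y\<in>Y. (z \<bullet> y) *\<^sub>R y) \<bullet> x = (\<Sum>y\<in>Y. if y = x then z \<bullet> x else 0)"
      unfolding inner_sum_left
      by (intro sum.cong refl) (simp add: orthonormal_inner[OF assms(2) _ x])
    also have "\<dots> = z \<bullet> x" using assms(1) x by simp
    finally show ?thesis by (simp add: d_def inner_diff_left)
  qed
  have "d \<in> span Y"
    unfolding d_def by (intro span_diff assms(3) span_sum span_scale span_base)
  then have "d \<bullet> d = 0"
    by (rule orthogonal_to_span[unfolded orthogonal_def]) (rule dY)
  then have "d = 0" by simp
  then show ?thesis
    using orthonormal_residual[OF assms(1,2), of z] unfolding d_def by simp
qed

lemma functional_orthonormal_le:
  fixes \<phi> :: "'h::real_inner \<Rightarrow> real"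
  assumes \<phi>: "bounded_linear \<phi>" and B: "hilbert_basis B"
    and c: "\<And>G. finite G \<Longrightarrow> G \<subseteq> B \<Longrightarrow> (\<Sum>e\<in>G. (\<phi> e)\<^sup>2) \<le> c"
    and F: "finite F" "orthonormal F"
  shows "(\<Sum>e\<in>F. (\<phi> e)\<^sup>2) \<le> c"
proof -
  interpret \<phi>: bounded_linear \<phi> by (rule \<phi>)
  have c0: "0 \<le> c" using c[of "{}"] by simp
  have on_span: "\<phi> x \<le> norm x * sqrt c" if x: "x \<in> span B" for x
  proof -
    obtain G a where G: "finite G" "G \<subseteq> B" and x_eq: "x = (\<Sum>e\<in>G. a e *\<^sub>R e)"
      using x unfolding span_explicit by blast
    have oG: "orthonormal G" using B G by (auto simp: hilbert_basis_def intro: orthonormal_subset)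
    have "\<phi> x = (\<Sum>e\<in>G. a e * \<phi> e)" by (simp add: x_eq \<phi>.sum \<phi>.scaleR)
    also have "\<dots> \<le> (\<Sum>e\<in>G. \<bar>a e\<bar> * \<bar>\<phi> e\<bar>)"
      by (intro sum_mono) (simp add: abs_mult[symmetric])
    also have "\<dots> \<le> L2_set a G * L2_set \<phi> G" by (rule L2_set_mult_ineq)
    also have "\<dots> \<le> norm x * sqrt c"
      unfolding x_eq norm_orthonormal_sum[OF G(1) oG]
      by (intro mult_left_mono) (auto simp: L2_set_def[of \<phi>] c G)
    finally show ?thesis .
  qed
  have "closed {x. \<phi> x \<le> norm x * sqrt c}"
    by (intro closed_Collect_le \<phi>.continuous_on continuous_intros)
  then have "closure (span B) \<subseteq> {x. \<phi> x \<le> norm x * sqrt c}"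
    using on_span by (intro closure_minimal) auto
  then have bound: "\<phi> x \<le> norm x * sqrt c" for x
    using B by (auto simp: hilbert_basis_def)
  define S where "S = (\<Sum>e\<in>F. (\<phi> e)\<^sup>2)"
  have S0: "0 \<le> S" by (simp add: S_def sum_nonneg)
  have "S = \<phi> (\<Sum>e\<in>F. \<phi> e *\<^sub>R e)"
    by (simp add: S_def \<phi>.sum \<phi>.scaleR power2_eq_square)
  also have "\<dots> \<le> sqrt S * sqrt c"
    using bound[of "\<Sum>e\<in>F. \<phi> e *\<^sub>R e"] by (simp add: norm_orthonormal_sum[OF F] L2_set_def S_def)
  finally have "sqrt S * sqrt S \<le> sqrt S * sqrt c" using S0 by (simp only: real_sqrt_mult_self abs_of_nonneg)
  then have "S = 0 \<or> sqrt S \<le> sqrt c"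
    using S0 by (metis mult_le_cancel_left_pos real_sqrt_gt_0_iff order_le_less)
  then have "S \<le> c" using c0 by auto
  then show ?thesis by (simp add: S_def)
qed

lemma has_sum_finite_sum:
  fixes u :: "'a \<Rightarrow> 'b \<Rightarrow> real"
  assumes "finite Y" "\<And>y. y \<in> Y \<Longrightarrow> (u y has_sum s y) B"
  shows "((\<lambda>e. \<Sum>y\<in>Y. u y e) has_sum (\<Sum>y\<in>Y. s y)) B"
  using assms by (induction Y rule: finite_induct) (auto intro: has_sum_add)

lemma sum_orthonormal_le_infsum:
  fixes T :: "'h::real_inner \<Rightarrow> 'x::real_inner"
  assumes T: "bounded_linear T" and B: "hilbert_basis B"
    and sm: "(\<lambda>e. (norm (T e))\<^sup>2) summable_on B"
    and F: "finite F" "orthonormal F"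
  shows "(\<Sum>f\<in>F. (norm (T f))\<^sup>2) \<le> (\<Sum>\<^sub>\<infinity>e\<in>B. (norm (T e))\<^sup>2)"
proof -
  obtain C where C: "finite C" "span C = span (T ` F)" "pairwise orthogonal C"
    using basis_orthogonal[of "T ` F"] F(1) by auto
  define Y where "Y = (\<lambda>y. y /\<^sub>R norm y) ` (C - {0})"
  have Y: "finite Y" "orthonormal Y"
    using C(1,3) by (auto simp: Y_def orthonormal_def pairwise_def orthogonal_def)
  have "C \<subseteq> span Y"
  proof
    fix y assume y: "y \<in> C"
    show "y \<in> span Y"
    proof (cases "y = 0")
      case False
      then have "norm y *\<^sub>R (y /\<^sub>R norm y) \<in> span Y"
        using y by (intro span_scale span_base) (auto simp: Y_def)
      then show ?thesis using False by simp
    qed (simp add: span_zero)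
  qed
  then have "span C \<subseteq> span Y" by (rule span_minimal) simp
  then have TF: "T f \<in> span Y" if "f \<in> F" for f
    using that C(2) span_base[of "T f" "T ` F"] by auto
  have le: "(T e \<bullet> y)\<^sup>2 \<le> (norm (T e))\<^sup>2" if "y \<in> Y" for e y
    using orthonormal_bessel[OF Y, of "T e"] member_le_sum[of y Y "\<lambda>y. (T e \<bullet> y)\<^sup>2"] that Y(1) by auto
  have sy: "(\<lambda>e. (T e \<bullet> y)\<^sup>2) summable_on B" if "y \<in> Y" for y
    by (rule summable_on_comparison_test[OF sm]) (use le[OF that] in auto)
  have "(\<Sum>f\<in>F. (norm (T f))\<^sup>2) = (\<Sum>f\<in>F. \<Sum>y\<in>Y. (T f \<bullet> y)\<^sup>2)"
    by (intro sum.cong refl orthonormal_parseval_span[symmetric] Y TF)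
  also have "\<dots> = (\<Sum>y\<in>Y. \<Sum>f\<in>F. (T f \<bullet> y)\<^sup>2)" by (rule sum.swap)
  also have "\<dots> \<le> (\<Sum>y\<in>Y. \<Sum>\<^sub>\<infinity>e\<in>B. (T e \<bullet> y)\<^sup>2)"
  proof (intro sum_mono functional_orthonormal_le[OF _ B _ F])
    fix y assume y: "y \<in> Y"
    show "bounded_linear (\<lambda>h. T h \<bullet> y)"
      using T by (rule bounded_linear_inner_left_comp)
    show "(\<Sum>e\<in>G. (T e \<bullet> y)\<^sup>2) \<le> (\<Sum>\<^sub>\<infinity>e\<in>B. (T e \<bullet> y)\<^sup>2)" if "finite G" "G \<subseteq> B" for G
      by (rule finite_sum_le_infsum[OF sy[OF y]]) (use that in auto)
  qed
  also have "\<dots> \<le> (\<Sum>\<^sub>\<infinity>e\<in>B. (norm (T e))\<^sup>2)"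
    by (rule has_sum_mono[OF has_sum_finite_sum[OF Y(1) has_sum_infsum[OF sy]] has_sum_infsum[OF sm]])
       (use orthonormal_bessel[OF Y] in auto)
  finally show ?thesis .
qed

lemma is_hilbert_schmidt_iff:
  assumes B: "hilbert_basis B"
  shows "is_hilbert_schmidt T \<longleftrightarrow> bounded_linear T \<and> (\<lambda>e. (norm (T e))\<^sup>2) summable_on B"
proof (intro iffI conjI)
  assume T: "is_hilbert_schmidt T"
  then show "bounded_linear T" by (simp add: is_hilbert_schmidt_def)
  obtain b where b: "\<And>F. F \<in> finite_orthonormal \<Longrightarrow> L2_set (\<lambda>e. norm (T e)) F \<le> b"
    using T by (auto simp: is_hilbert_schmidt_def bdd_above_def)
  show "(\<lambda>e. (norm (T e))\<^sup>2) summable_on B"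
  proof (rule nonneg_bdd_above_summable_on)
    show "bdd_above (sum (\<lambda>e. (norm (T e))\<^sup>2) ` {F. F \<subseteq> B \<and> finite F})"
    proof (rule bdd_aboveI2)
      fix F assume "F \<in> {F. F \<subseteq> B \<and> finite F}"
      then have "F \<in> finite_orthonormal"
        using B by (auto simp: finite_orthonormal_def hilbert_basis_def intro: orthonormal_subset)
      from b[OF this] show "(\<Sum>e\<in>F. (norm (T e))\<^sup>2) \<le> b\<^sup>2"
        unfolding L2_set_def by (rule sqrt_le_D)
    qed
  qed simp
next
  assume T: "bounded_linear T \<and> (\<lambda>e. (norm (T e))\<^sup>2) summable_on B"
  show "is_hilbert_schmidt T"
    unfolding is_hilbert_schmidt_def
  proof (intro conjI bdd_aboveI2)
    fix F :: "'a set" assume "F \<in> finite_orthonormal"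
    then have "finite F" "orthonormal F" by (auto simp: finite_orthonormal_def)
    with sum_orthonormal_le_infsum[OF _ B, of T F] T
    show "L2_set (\<lambda>e. norm (T e)) F \<le> sqrt (\<Sum>\<^sub>\<infinity>e\<in>B. (norm (T e))\<^sup>2)"
      unfolding L2_set_def by (intro real_sqrt_le_mono) blast
  qed (use T in simp)
qed

lemma hs_norm_hilbert_basis:
  assumes B: "hilbert_basis B"
  shows "((\<lambda>e. (norm (hs_apply T e))\<^sup>2) has_sum (norm T)\<^sup>2) B"
proof -
  have hs: "is_hilbert_schmidt (hs_apply T)" using hs_apply[of T] by simp
  then have sm: "(\<lambda>e. (norm (hs_apply T e))\<^sup>2) summable_on B"
    using is_hilbert_schmidt_iff[OF B] by blast
  define s where "s = (\<Sum>\<^sub>\<infinity>e\<in>B. (norm (hs_apply T e))\<^sup>2)"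
  have s0: "0 \<le> s" unfolding s_def by (rule infsum_nonneg) simp
  have "norm T \<le> sqrt s"
    unfolding s_def
    by (rule hs_norm_le)
       (auto simp: L2_set_def finite_orthonormal_def
         intro!: sum_orthonormal_le_infsum bounded_linear_hs_apply B sm)
  then have "(norm T)\<^sup>2 \<le> s" using s0 by (simp add: real_le_rsqrt sqrt_ge_absD)
  moreover have "s \<le> (norm T)\<^sup>2"
    unfolding s_def
  proof (rule infsum_le_finite_sums[OF sm])
    fix F assume "finite F" "F \<subseteq> B"
    then have "F \<in> finite_orthonormal"
      using B by (auto simp: finite_orthonormal_def hilbert_basis_def intro: orthonormal_subset)
    from L2_set_le_hs_norm[OF this, of T] show "(\<Sum>e\<in>F. (norm (hs_apply T e))\<^sup>2) \<le> (norm T)\<^sup>2"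
      unfolding L2_set_def by (rule sqrt_le_D)
  qed
  ultimately have "s = (norm T)\<^sup>2" by simp
  with has_sum_infsum[OF sm] show ?thesis by (simp add: s_def)
qed


section \<open>Cylindrical functions\<close>

text \<open>
  A function on $(\mathbb{R}^n)^q$ is represented by a function of sequences in
  $\mathbb{R}^n$ that depends on the terms with index below \<open>q\<close> only.  The pair
  \<open>(k, i)\<close> stands for the \<open>i\<close>-th coordinate of the \<open>k\<close>-th argument.
\<close>

definition slice :: "((nat \<Rightarrow> real^'n::finite) \<Rightarrow> real) \<Rightarrow> (nat \<Rightarrow> real^'n) \<Rightarrow> nat \<times> 'n \<Rightarrow> real \<Rightarrow> real" where
  "slice F x a r = F (x(fst a := x (fst a) + r *\<^sub>R axis (snd a) 1))"

primrec partials :: "(nat \<times> 'n) list \<Rightarrow> ((nat \<Rightarrow> real^'n::finite) \<Rightarrow> real) \<Rightarrow> (nat \<Rightarrow> real^'n) \<Rightarrow> real" where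
  "partials [] F = F"
| "partials (a # as) F = (\<lambda>x. deriv (slice (partials as F) x a) 0)"

definition schwartz :: "nat \<Rightarrow> ((nat \<Rightarrow> real^'n::finite) \<Rightarrow> real) \<Rightarrow> bool" where
  "schwartz q F \<longleftrightarrow>
     (\<forall>x y. (\<forall>k<q. x k = y k) \<longrightarrow> F x = F y) \<and>
     (\<forall>as. set as \<subseteq> {..<q} \<times> UNIV \<longrightarrow>
        continuous_on UNIV (partials as F) \<and>
        (\<forall>x. \<forall>a\<in>{..<q} \<times> UNIV. slice (partials as F) x a differentiable at 0) \<and>
        (\<forall>N::nat. \<exists>C. \<forall>x. (1 + L2_set (\<lambda>k. norm (x k)) {..<q}) ^ N * \<bar>partials as F x\<bar> \<le> C))"

definition cyl :: "(('n::finite) wiener \<Rightarrow> real) set" where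
  "cyl = {\<lambda>w. F (\<lambda>k. path_at w (t k)) | F (t :: nat \<Rightarrow> real) q.
            1 \<le> q \<and> (\<forall>k<q. t k \<in> {0..1}) \<and> strict_mono_on {..<q} t \<and> schwartz q F}"

definition directional :: "(('n::finite) wiener \<Rightarrow> real) \<Rightarrow> 'n cameron_martin \<Rightarrow> 'n wiener \<Rightarrow> real" where
  "directional \<phi> h w = deriv (\<lambda>r. \<phi> (w + r *\<^sub>R cm_path h)) 0"

text \<open>
  \<open>cyl_gradient E f G\<close>: with respect to the Hilbert basis \<open>E\<close>, the function \<open>f\<close> is an
  \<open>X\<close>-valued cylindrical function and \<open>G\<close> is its gradient.  Basis vectors may be repeated.
\<close>

definition cyl_gradient ::
  "'x::real_inner set \<Rightarrow> (('n::finite) wiener \<Rightarrow> 'x) \<Rightarrow>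
   ('n wiener \<Rightarrow> ('n cameron_martin, 'x) hilbert_schmidt) \<Rightarrow> bool" where
  "cyl_gradient E f G \<longleftrightarrow>
     (\<exists>(N::nat) \<phi> e. (\<forall>k<N. \<phi> k \<in> cyl \<and> e k \<in> E) \<and>
        (\<forall>w. f w = (\<Sum>k<N. \<phi> k w *\<^sub>R e k)) \<and>
        (\<forall>w h. hs_apply (G w) h = (\<Sum>k<N. directional (\<phi> k) h w *\<^sub>R e k)))"


section \<open>The weak derivative\<close>

definition Lp :: "'a measure \<Rightarrow> real \<Rightarrow> ('a \<Rightarrow> 'b::real_normed_vector) set" where
  "Lp M p = {u \<in> borel_measurable M. integrable M (\<lambda>w. norm (u w) powr p)}"

definition Lp_norm :: "'a measure \<Rightarrow> real \<Rightarrow> ('a \<Rightarrow> 'b::real_normed_vector) \<Rightarrow> real" where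
  "Lp_norm M p u = (\<integral>w. norm (u w) powr p \<partial>M) powr (1 / p)"

text \<open>
  The pair \<open>(f, g)\<close> is a limit of pairs of a cylindrical function and its gradient.  The memberships
  of \<open>F j\<close> and \<open>G j\<close> in \<open>Lp\<close> hold for every cylindrical function; they are listed because
  \<open>Lp_norm\<close> is meaningful on \<open>Lp\<close> only.
\<close>

definition has_weak_derivative ::
  "('n::finite) wiener measure \<Rightarrow> real \<Rightarrow> 'x::real_inner set \<Rightarrow> ('n wiener \<Rightarrow> 'x) \<Rightarrow>
   ('n wiener \<Rightarrow> ('n cameron_martin, 'x) hilbert_schmidt) \<Rightarrow> bool" where
  "has_weak_derivative M p E f g \<longleftrightarrow>
     f \<in> Lp M p \<and> g \<in> Lp M p \<and>
     (\<exists>F G. (\<forall>j::nat. cyl_gradient E (F j) (G j) \<and> F j \<in> Lp M p \<and> G j \<in> Lp M p) \<and>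
        (\<lambda>j. Lp_norm M p (\<lambda>w. F j w - f w) + Lp_norm M p (\<lambda>w. G j w - g w)) \<longlonglongrightarrow> 0)"

definition sobolev :: "('n::finite) wiener measure \<Rightarrow> real \<Rightarrow> 'x::real_inner set \<Rightarrow> ('n wiener \<Rightarrow> 'x) set" where
  "sobolev M p E = {f. \<exists>g. has_weak_derivative M p E f g}"


section \<open>The strong derivative\<close>

definition H_continuous :: "('n::finite) wiener measure \<Rightarrow> ('n wiener \<Rightarrow> 'y::real_normed_vector) \<Rightarrow> bool" where
  "H_continuous M u \<longleftrightarrow>
     u \<in> borel_measurable M \<and> (AE w in M. continuous_on UNIV (\<lambda>h. u (w + cm_path h)))"

definition has_H_derivative ::
  "('n::finite) wiener measure \<Rightarrow> ('n wiener \<Rightarrow> 'y::real_inner) \<Rightarrow>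
   ('n wiener \<Rightarrow> ('n cameron_martin, 'y) hilbert_schmidt) \<Rightarrow> bool" where
  "has_H_derivative M u G \<longleftrightarrow>
     u \<in> borel_measurable M \<and> H_continuous M G \<and>
     (AE w in M. \<forall>h. ((\<lambda>k. u (w + cm_path k)) has_derivative hs_apply (G (w + cm_path h))) (at h))"

definition H_C1 :: "('n::finite) wiener measure \<Rightarrow> ('n wiener \<Rightarrow> 'y::real_inner) \<Rightarrow> bool" where
  "H_C1 M u \<longleftrightarrow> (\<exists>G. has_H_derivative M u G)"

end

(*
  Let c^2 + s^2 = 1 with s small.  For independent Wiener paths w and y the path v = c w + s y is again
  a Wiener path.  For almost every fixed w, the law of v as y varies is quasi-invariant under all of H,
  with a Cameron-Martin bound that is uniform on bounded sets of shifts.  Passing to the limit in the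
  cylindrical approximations therefore yields, for almost every w and for all h and k in H at once,
      f(v + h + k) - f(v + h) = int_0^1 (grad f)(v + h + sigma k)[k] d sigma    for almost every y.
  Along a suitable sequence c_n -> 1, almost every (w, y) is such that f(v_n) -> f(w) and the moduli of
  continuity of grad f(v_n + .) on the balls B_m are eventually controlled by those of grad f(w + .).
  Hence f(c_n (w + h) + s_n y) converges, for almost every w, for all h and for almost every y, to
  f(w) + int_0^1 (grad f)(w + sigma h)[h] d sigma.  The mean over y of the limit of f(c_n w + s_n y) is thus
  a version of f that is differentiable along H with derivative grad f.
*)

theory Submission
  imports Defs
begin

section \<open>Separability of the Wiener space\<close>

text \<open>The obstacle is the order of quantifiers. A null set can meet w + H for every w, and
  quasi-invariance yields an exceptional set for each shift separately, while differentiability at w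
  concerns uncountably many shifts at once. With w frozen and y as the source of randomness, only
  the null set in y depends on the shift. A shift by h in v is a shift by h/s in y; this is harmless
  because s stays fixed while the cylindrical approximation is refined. The second obstacle is that
  convergence of paths in the sup norm says nothing about f or its gradient, which are only
  measurable there. What helps is that all rotated paths have the law of w: every Borel event then
  stabilises in probability, and along a subsequence almost surely for countably many events.
  Uniform continuity on balls enters here, because a modulus of continuity tested on a countable
  dense set of H is a countable list of conditions. The limit of f along the rotations is almost
  surely constant in y; its mean serves to obtain a measurable function that is defined at every
  path, in particular at all w + h.\<close>

lemma second_countable_if_separable:
  fixes D :: "'a::metric_space set"
  assumes "countable D" and dense: "closure D = UNIV"
  shows "\<exists>B::'a set set. countable B \<and> open = generate_topology B"
proof -
  define B where "B = (\<lambda>(d, n::nat). ball d (1 / real (Suc n))) ` (D \<times> UNIV)"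
  have "topological_basis B"
  proof (rule topological_basisI)
    show "open b" if "b \<in> B" for b using that by (auto simp: B_def)
    fix U :: "'a set" and x assume "open U" "x \<in> U"
    then obtain e where e: "e > 0" "ball x e \<subseteq> U" by (auto simp: open_contains_ball)
    obtain n where n: "1 / real (Suc n) < e / 2"
      using reals_Archimedean[of "e / 2"] e(1) by (auto simp: inverse_eq_divide)
    have "x \<in> closure D" by (simp add: dense)
    then obtain d where d: "d \<in> D" "dist d x < 1 / real (Suc n)"
      unfolding closure_approachable by (metis divide_pos_pos of_nat_0_less_iff zero_less_Suc zero_less_one)
    have "ball d (1 / real (Suc n)) \<subseteq> ball x e"
    proof
      fix y assume "y \<in> ball d (1 / real (Suc n))"
      then show "y \<in> ball x e"
        using d(2) n dist_triangle[of x y d] by (simp add: dist_commute)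
    qed
    then show "\<exists>b\<in>B. x \<in> b \<and> b \<subseteq> U"
      using d e(2) by (intro bexI[of _ "ball d (1 / real (Suc n))"]) (auto simp: B_def)
  qed
  moreover have "countable B" using assms(1) by (auto simp: B_def)
  ultimately show ?thesis by (auto intro: topological_basis_imp_subbasis)
qed

definition dyadic :: "nat \<Rightarrow> nat \<Rightarrow> real" where
  "dyadic n k = real k / 2 ^ n"

lemma dyadic_mem: "k \<le> 2 ^ n \<Longrightarrow> dyadic n k \<in> {0..1}"
  using of_nat_le_iff[of k "2 ^ n", where 'a=real] by (simp add: dyadic_def)

lemma dyadic_near:
  assumes "t \<in> {0..1}"
  obtains k where "k \<le> 2 ^ n" "\<bar>t - dyadic n k\<bar> \<le> 1 / 2 ^ n"
proof -
  define k where "k = nat \<lfloor>t * 2 ^ n\<rfloor>"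
  have t: "0 \<le> t * 2 ^ n" "t * 2 ^ n \<le> 2 ^ n"
    using assms by (auto simp: mult_le_cancel_right1)
  have k: "real k \<le> t * 2 ^ n" "t * 2 ^ n \<le> real k + 1"
    using t(1) unfolding k_def by linarith+
  show ?thesis
  proof
    show "k \<le> 2 ^ n"
      using order_trans[OF k(1) t(2)] of_nat_le_iff[of k "2 ^ n", where 'a=real] by simp
    show "\<bar>t - dyadic n k\<bar> \<le> 1 / 2 ^ n"
    proof -
      have "t - dyadic n k = (t * 2 ^ n - real k) / 2 ^ n" by (simp add: dyadic_def diff_divide_distrib)
      moreover have "\<bar>t * 2 ^ n - real k\<bar> \<le> 1" using k by linarith
      ultimately show ?thesis by (simp add: abs_divide divide_right_mono)
    qed
  qed
qed

lemma path_oscillation: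
  fixes w :: "'n::finite wiener"
  assumes "e > 0"
  obtains n :: nat where
    "\<And>s t. s \<in> {0..1} \<Longrightarrow> t \<in> {0..1} \<Longrightarrow> \<bar>s - t\<bar> \<le> 1 / 2 ^ n \<Longrightarrow> norm (path_at w s - path_at w t) \<le> e"
proof -
  have "uniformly_continuous_on {0..1} (path_at w)"
    by (intro compact_uniformly_continuous continuous_path_at compact_Icc)
  then obtain d where d: "d > 0"
    "\<And>s t. s \<in> {0..1} \<Longrightarrow> t \<in> {0..1} \<Longrightarrow> dist t s < d \<Longrightarrow> dist (path_at w t) (path_at w s) < e"
    using assms unfolding uniformly_continuous_on_def by metis
  obtain n where n: "(1 / 2) ^ n < d" using real_arch_pow_inv[OF d(1), of "1/2"] by auto
  show ?thesis
  proof (rule that[of n])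
    fix s t :: real assume "s \<in> {0..1}" "t \<in> {0..1}" "\<bar>s - t\<bar> \<le> 1 / 2 ^ n"
    then show "norm (path_at w s - path_at w t) \<le> e"
      using d(2)[of t s] n by (auto simp: dist_norm power_one_over less_imp_le)
  qed
qed

text \<open>A code \<open>(n, j, qs)\<close> records approximate values near the dyadic points of
  level n. Two paths with the same code are within twice the precision of each other, so one chosen
  path per code gives a dense set, and no interpolating path has to be built.\<close>

lemma wiener_separable: "\<exists>D :: 'n::finite wiener set. countable D \<and> closure D = UNIV"
proof -
  obtain Q :: "(real^'n) set" where Q: "countable Q" "\<And>U. open U \<Longrightarrow> U \<noteq> {} \<Longrightarrow> \<exists>q\<in>Q. q \<in> U"
    using countable_dense_setE by metis
  define P where "P = (\<lambda>(n::nat, j::nat, qs) (w :: 'n wiener). \<forall>s\<in>{0..1}. \<forall>k\<le>2^n. \<bar>s - dyadic n k\<bar> \<le> 1 / 2 ^ n \<longrightarrow>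
      norm (path_at w s - qs ! k) \<le> 1 / real (Suc j))"
  \<comment> \<open>A code that no path realises contributes an arbitrary path, which only enlarges
    the countable set.\<close>
  define D :: "'n wiener set" where "D = (\<lambda>c. SOME w. P c w) ` (UNIV \<times> UNIV \<times> lists Q)"
  have "countable D" unfolding D_def by (intro countable_image countable_SIGMA countable_lists Q) auto
  moreover have "w \<in> closure D" for w
    unfolding closure_approachable
  proof (intro allI impI)
    fix e :: real assume "e > 0"
    then obtain j where j: "1 / real (Suc j) < e / 4"
      using reals_Archimedean[of "e / 4"] by (auto simp: inverse_eq_divide)
    define d where "d = 1 / real (Suc j)"
    have d: "d > 0" "d < e / 4" using j by (auto simp: d_def)
    obtain n :: nat where n: "\<And>s t. s \<in> {0..1} \<Longrightarrow> t \<in> {0..1} \<Longrightarrow> \<bar>s - t\<bar> \<le> 1 / 2 ^ n \<Longrightarrow>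
        norm (path_at w s - path_at w t) \<le> d / 2"
      using path_oscillation[of "d / 2" w] d by auto
    have "\<exists>q\<in>Q. dist q (path_at w (dyadic n k)) < d / 2" for k
      using Q(2)[of "ball (path_at w (dyadic n k)) (d / 2)"] d by (auto simp: dist_commute)
    then obtain q where q: "\<And>k. q k \<in> Q" "\<And>k. dist (q k) (path_at w (dyadic n k)) < d / 2" by metis
    define qs where "qs = map q [0..<Suc (2 ^ n)]"
    have qs: "qs ! k = q k" if "k \<le> 2 ^ n" for k
      unfolding qs_def using that by (subst nth_map) (auto simp del: upt_Suc)
    define c where "c = (n, j, qs)"
    have "P c w"
      unfolding P_def c_def prod.case
    proof (intro ballI allI impI)
      fix s k assume s: "s \<in> {0..1::real}" "k \<le> 2 ^ n" "\<bar>s - dyadic n k\<bar> \<le> 1 / 2 ^ n"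
      have "norm (path_at w s - path_at w (dyadic n k)) \<le> d / 2"
        using s by (intro n dyadic_mem) auto
      moreover have "norm (path_at w (dyadic n k) - q k) \<le> d / 2"
        using q(2)[of k] by (simp add: dist_norm norm_minus_commute)
      ultimately have "norm (path_at w s - q k) \<le> d"
        by norm
      then show "norm (path_at w s - qs ! k) \<le> 1 / real (Suc j)"
        unfolding qs[OF s(2)] d_def .
    qed
    define v where "v = (SOME w. P c w)"
    have "P c v" unfolding v_def by (rule someI[of _ w]) fact
    have "c \<in> UNIV \<times> UNIV \<times> lists Q" using q(1) by (auto simp: c_def qs_def)
    then have "v \<in> D" by (auto simp: D_def v_def)
    moreover have "norm (v - w) \<le> 2 * d"
    proof (rule norm_wiener_le)
      fix t :: real assume t: "t \<in> {0..1}"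
      then obtain k where k: "k \<le> 2 ^ n" "\<bar>t - dyadic n k\<bar> \<le> 1 / 2 ^ n" by (rule dyadic_near)
      have "norm (path_at v t - qs ! k) \<le> d" "norm (path_at w t - qs ! k) \<le> d"
        using \<open>P c v\<close> \<open>P c w\<close> t k by (auto simp: P_def c_def d_def simp del: of_nat_Suc)
      then show "norm (path_at (v - w) t) \<le> 2 * d"
        unfolding path_at_simps by norm
    qed
    ultimately show "\<exists>y\<in>D. dist y w < e"
      using d by (intro bexI[of _ v]) (auto simp: dist_wiener_def)
  qed
  ultimately show ?thesis by blast
qed

text \<open>Second countability identifies the Borel sets of a product with the product
  sigma-algebra, which makes sums such as c w + s y measurable on the product of two path
  spaces.\<close>

instance wiener :: (finite) second_countable_topology
proof
  obtain D :: "'a wiener set" where "countable D" "closure D = UNIV" using wiener_separable by blast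
  then show "\<exists>B :: 'a wiener set set. countable B \<and> open = generate_topology B"
    by (rule second_countable_if_separable)
qed

lemma bounded_linear_path_at: "bounded_linear (\<lambda>w. path_at w t)"
  by (rule bounded_linear_intro[where K = 1]) (simp_all add: norm_path_at_le)

lemma measurable_path_at [measurable]: "(\<lambda>w. path_at w t) \<in> borel_measurable borel"
  by (rule borel_measurable_continuous_onI[OF linear_continuous_on[OF bounded_linear_path_at]])

lemma measurable_path_at_nth [measurable]: "(\<lambda>w. path_at w t $ i) \<in> borel_measurable borel"
  by (intro borel_measurable_continuous_onI continuous_on_component linear_continuous_on bounded_linear_path_at)

section \<open>Dyadic cylinder sets and the Borel sigma-algebra\<close>

abbreviation dyadic_index :: "nat \<Rightarrow> (nat \<times> 'n::finite) set" where
  "dyadic_index n \<equiv> {..2 ^ n} \<times> UNIV"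

abbreviation dyadic_space :: "nat \<Rightarrow> (nat \<times> 'n::finite \<Rightarrow> real) measure" where
  "dyadic_space n \<equiv> Pi\<^sub>M (dyadic_index n) (\<lambda>_. borel)"

definition dyadic_values :: "nat \<Rightarrow> 'n::finite wiener \<Rightarrow> nat \<times> 'n \<Rightarrow> real" where
  "dyadic_values n w = (\<lambda>a\<in>dyadic_index n. path_at w (dyadic n (fst a)) $ snd a)"

text \<open>Dyadic grids are nested, so any two of these sets can be described at a common level.
  This makes the family an algebra, as the approximation argument for measure inequalities
  requires.\<close>

definition cylinder_sets :: "'n::finite wiener set set" where
  "cylinder_sets = (\<Union>n. (\<lambda>B. dyadic_values n -` B) ` sets (dyadic_space n))"

lemma measurable_dyadic_values [measurable]:
  "dyadic_values n \<in> borel \<rightarrow>\<^sub>M dyadic_space n"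
  unfolding dyadic_values_def
  by (intro measurable_restrict measurable_path_at_nth)

lemma cylinder_sets_measurable: "cylinder_sets \<subseteq> sets borel"
  unfolding cylinder_sets_def using measurable_sets[OF measurable_dyadic_values] by auto

lemma dyadic_refine: "m \<le> n \<Longrightarrow> dyadic n (k * 2 ^ (n - m)) = dyadic m k"
  using power_add[of "2::real" m "n - m"] by (simp add: dyadic_def)

lemma cylinder_level:
  fixes B :: "(nat \<times> 'n::finite \<Rightarrow> real) set"
  assumes "m \<le> n" and B: "B \<in> sets (dyadic_space m)"
  shows "\<exists>C\<in>sets (dyadic_space n).
           dyadic_values m -` B = (dyadic_values n -` C :: 'n wiener set)"
proof -
  define r :: "(nat \<times> 'n \<Rightarrow> real) \<Rightarrow> nat \<times> 'n \<Rightarrow> real"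
    where "r x = (\<lambda>a\<in>dyadic_index m. x (fst a * 2 ^ (n - m), snd a))" for x
  have idx: "k * 2 ^ (n - m) \<le> 2 ^ n" if "k \<le> 2 ^ m" for k :: nat
    using mult_le_mono1[OF that, of "2 ^ (n - m)"] assms(1) by (simp flip: power_add)
  have "r \<in> dyadic_space n \<rightarrow>\<^sub>M dyadic_space m"
    unfolding r_def by (intro measurable_restrict measurable_component_singleton) (auto intro: idx)
  from measurable_sets[OF this B] 
  have "r -` B \<inter> space (dyadic_space n) \<in> sets (dyadic_space n)" .
  moreover have "dyadic_values m w = r (dyadic_values n w)" for w :: "'n wiener"
    by (auto simp: dyadic_values_def r_def fun_eq_iff restrict_def idx dyadic_refine[OF assms(1)])
  moreover have "dyadic_values n w \<in> space (dyadic_space n)" for w :: "'n wiener"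
    by (auto simp: dyadic_values_def space_PiM)
  ultimately show ?thesis
    by (intro bexI[of _ "r -` B \<inter> space (dyadic_space n)"]) auto
qed

lemma algebra_cylinder_sets: "algebra UNIV (cylinder_sets :: 'n::finite wiener set set)"
  unfolding algebra_iff_Int
proof (intro conjI ballI)
  show "{} \<in> (cylinder_sets :: 'n wiener set set)"
    unfolding cylinder_sets_def by (intro UN_I[of 0] image_eqI[of _ _ "{}"]) auto
  fix A :: "'n wiener set" assume "A \<in> cylinder_sets"
  then obtain n B where A: "A = dyadic_values n -` B" "B \<in> sets (dyadic_space n)"
    by (auto simp: cylinder_sets_def)
  let ?S = "space (dyadic_space n) :: (nat \<times> 'n \<Rightarrow> real) set"
  have "dyadic_values n w \<in> ?S" for w :: "'n wiener"
    by (auto simp: dyadic_values_def space_PiM)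
  then have "UNIV - A = dyadic_values n -` (?S - B)" by (auto simp: A)
  with A(2) show "UNIV - A \<in> cylinder_sets"
    unfolding cylinder_sets_def by (intro UN_I[of n] image_eqI[of _ _ "?S - B"]) auto
  fix A' :: "'n wiener set" assume "A' \<in> cylinder_sets"
  then obtain n' B' where A': "A' = dyadic_values n' -` B'" "B' \<in> sets (dyadic_space n')"
    by (auto simp: cylinder_sets_def)
  define N where "N = max n n'"
  obtain C where C: "C \<in> sets (dyadic_space N)" "A = dyadic_values N -` C"
    using cylinder_level[OF _ A(2), of N] by (auto simp: N_def A(1))
  obtain C' where C': "C' \<in> sets (dyadic_space N)" "A' = dyadic_values N -` C'"
    using cylinder_level[OF _ A'(2), of N] by (auto simp: N_def A'(1))
  show "A \<inter> A' \<in> cylinder_sets"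
    unfolding cylinder_sets_def by (intro UN_I[of N] image_eqI[of _ _ "C \<inter> C'"]) (use C C' in auto)
qed auto

lemma norm_wiener_le_dyadic:
  fixes w :: "'n::finite wiener"
  assumes "\<And>n k. k \<le> 2 ^ n \<Longrightarrow> norm (path_at w (dyadic n k)) \<le> r"
  shows "norm w \<le> r"
proof (rule norm_wiener_le, rule field_le_epsilon)
  fix t e :: real assume t: "t \<in> {0..1}" and "e > 0"
  obtain n :: nat where n: "\<And>s t. s \<in> {0..1} \<Longrightarrow> t \<in> {0..1} \<Longrightarrow> \<bar>s - t\<bar> \<le> 1 / 2 ^ n \<Longrightarrow>
      norm (path_at w s - path_at w t) \<le> e"
    using path_oscillation[OF \<open>e > 0\<close>, of w] by auto
  obtain k where k: "k \<le> 2 ^ n" "\<bar>t - dyadic n k\<bar> \<le> 1 / 2 ^ n" using t by (rule dyadic_near)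
  show "norm (path_at w t) \<le> r + e"
    using n[OF t dyadic_mem[OF k(1)] k(2)] assms[OF k(1)] by norm
qed

text \<open>By continuity of paths the norm is a supremum over dyadic times, so a closed ball is a
  countable intersection of cylinder conditions; by separability every open set is a countable union
  of closed balls.\<close>

lemma sets_borel_wiener: "sets (borel :: 'n::finite wiener measure) = sigma_sets UNIV cylinder_sets"
proof
  show "sigma_sets UNIV cylinder_sets \<subseteq> sets (borel :: 'n wiener measure)"
    using sets.sigma_sets_subset[of cylinder_sets "borel :: 'n wiener measure"] cylinder_sets_measurable by auto
  define S :: "'n wiener measure" where "S = sigma UNIV cylinder_sets"
  have S: "sets S = sigma_sets UNIV cylinder_sets" "space S = UNIV" by (auto simp: S_def)
  have vals: "dyadic_values n \<in> S \<rightarrow>\<^sub>M dyadic_space n" for n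
  proof (rule measurableI)
    show "dyadic_values n w \<in> space (dyadic_space n)" for w :: "'n wiener"
      by (auto simp: dyadic_values_def space_PiM)
    show "dyadic_values n -` A \<inter> space S \<in> sets S" if "A \<in> sets (dyadic_space n)" for A
      unfolding S using that by (intro sigma_sets.Basic) (auto simp: cylinder_sets_def)
  qed
  have coord: "(\<lambda>w. path_at w (dyadic n k) $ i) \<in> borel_measurable S" if "k \<le> 2 ^ n" for n k i
  proof -
    have "(\<lambda>w. dyadic_values n w (k, i)) \<in> borel_measurable S"
      using that by (intro measurable_compose[OF vals] measurable_component_singleton) auto
    then show ?thesis using that by (simp add: dyadic_values_def)
  qed
  have dyadic_path: "(\<lambda>w. path_at w (dyadic n k)) \<in> borel_measurable S" if "k \<le> 2 ^ n" for n k
  proof (rule borel_measurable_euclidean_space[THEN iffD2], rule ballI)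
    fix b :: "real^'n" assume "b \<in> Basis"
    then obtain i where "b = axis i 1" by (auto simp: Basis_vec_def)
    then show "(\<lambda>w. path_at w (dyadic n k) \<bullet> b) \<in> borel_measurable S"
      using coord[OF that, of i] by (simp add: inner_axis)
  qed
  have dist_meas: "(\<lambda>w. norm (path_at w (dyadic n k) - x)) \<in> borel_measurable S" if "k \<le> 2 ^ n" for n k x
  proof -
    note [measurable] = dyadic_path[OF that]
    show ?thesis by measurable
  qed
  have cball: "cball d r \<in> sets S" for d :: "'n wiener" and r
  proof -
    have "cball d r = {w \<in> space S. \<forall>n. \<forall>k\<in>{..2 ^ n}. norm (path_at w (dyadic n k) - path_at d (dyadic n k)) \<le> r}"
    proof safe
      fix w n and k :: nat assume "w \<in> cball d r"
      then show "norm (path_at w (dyadic n k) - path_at d (dyadic n k)) \<le> r"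
        using norm_path_at_le[of "w - d" "dyadic n k"]
        by (simp add: dist_wiener_def norm_minus_commute)
    next
      fix w assume "\<forall>n. \<forall>k\<in>{..2 ^ n}. norm (path_at w (dyadic n k) - path_at d (dyadic n k)) \<le> r"
      then have "norm (w - d) \<le> r" by (intro norm_wiener_le_dyadic) auto
      then show "w \<in> cball d r" by (simp add: dist_wiener_def norm_minus_commute)
    qed (simp add: S)
    also have "\<dots> \<in> sets S"
      by (intro sets.sets_Collect_countable_All sets.sets_Collect_finite_All)
         (auto intro!: borel_measurable_le dist_meas borel_measurable_const)
    finally show ?thesis .
  qed
  have "U \<in> sets S" if U: "open U" for U :: "'n wiener set"
  proof -
    obtain D :: "'n wiener set" where D: "countable D" "closure D = UNIV" using wiener_separable by blast
    define I where "I = {(d, n::nat). d \<in> D \<and> cball d (1 / real (Suc n)) \<subseteq> U}"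
    have eq: "U = (\<Union>(d, n)\<in>I. cball d (1 / real (Suc n)))"
    proof safe
      fix x assume "x \<in> U"
      then obtain e where e: "e > 0" "ball x e \<subseteq> U" using U by (auto simp: open_contains_ball)
      obtain n where n: "1 / real (Suc n) < e / 2"
        using reals_Archimedean[of "e / 2"] e(1) by (auto simp: inverse_eq_divide)
      have "x \<in> closure D" by (simp add: D)
      then obtain d where d: "d \<in> D" "dist d x < 1 / real (Suc n)"
        unfolding closure_approachable by (metis divide_pos_pos of_nat_0_less_iff zero_less_Suc zero_less_one)
      have "cball d (1 / real (Suc n)) \<subseteq> ball x e"
      proof
        fix y assume "y \<in> cball d (1 / real (Suc n))"
        then show "y \<in> ball x e"
          using d(2) n dist_triangle[of x y d] by (simp add: dist_commute)
      qed
      then show "x \<in> (\<Union>(d, n)\<in>I. cball d (1 / real (Suc n)))"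
        using d e(2) by (intro UN_I[of "(d, n)"]) (auto simp: I_def less_imp_le)
    qed (auto simp: I_def)
    have "countable I"
      by (rule countable_subset[of _ "D \<times> UNIV"]) (auto simp: I_def D)
    have "(\<Union>(d, n)\<in>I. cball d (1 / real (Suc n))) \<in> sets S"
      by (rule sets.countable_UN'[OF \<open>countable I\<close>]) (simp add: case_prod_beta cball image_subset_iff)
    then show ?thesis by (simp only: eq[symmetric])
  qed
  then have "sigma_sets (space S) {U. open U} \<subseteq> sets S"
    by (intro sets.sigma_sets_subset) auto
  then show "sets (borel :: 'n wiener measure) \<subseteq> sigma_sets UNIV cylinder_sets"
    by (simp add: borel_def S)
qed

section \<open>Dyadic increments\<close>

lemma algebra_approximation:
  fixes P :: "'i \<Rightarrow> 'a measure"
  assumes "finite I" and fin: "\<And>i. i \<in> I \<Longrightarrow> finite_measure (P i)"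
    and alg: "algebra \<Omega> \<A>" and sets: "\<And>i. i \<in> I \<Longrightarrow> sets (P i) = sigma_sets \<Omega> \<A>"
    and S: "S \<in> sigma_sets \<Omega> \<A>" and "e > 0"
  shows "\<exists>B\<in>\<A>. \<forall>i\<in>I. measure (P i) (sym_diff S B) < e"
  using S \<open>e > 0\<close>
proof (induction arbitrary: e rule: sigma_sets.induct)
  case (Basic a)
  then show ?case by (intro bexI[of _ a]) auto
next
  case Empty
  then show ?case using alg by (intro bexI[of _ "{}"]) (auto simp: algebra_iff_Int)
next
  case (Compl a)
  obtain B where B: "B \<in> \<A>" "\<forall>i\<in>I. measure (P i) (sym_diff a B) < e" using Compl by blast
  have "B \<subseteq> \<Omega>" "\<A> \<subseteq> Pow \<Omega>" using B alg by (auto simp: algebra_iff_Int)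
  moreover have "a \<subseteq> \<Omega>" using sigma_sets_into_sp[OF _ Compl(1)] alg by (auto simp: algebra_iff_Int)
  ultimately have "sym_diff (\<Omega> - a) (\<Omega> - B) = sym_diff a B" by auto
  then show ?case using B alg by (intro bexI[of _ "\<Omega> - B"]) (auto simp: algebra_iff_Int)
next
  case (Union a)
  interpret algebra \<Omega> \<A> by fact
  have sub: "B \<in> \<A> \<Longrightarrow> B \<in> sigma_sets \<Omega> \<A>" for B by auto
  have "(\<lambda>n. measure (P i) ((\<Union>k. a k) - (\<Union>k<n. a k))) \<longlonglongrightarrow> 0" if i: "i \<in> I" for i
  proof -
    interpret P: finite_measure "P i" using fin i by auto
    have "(\<lambda>n. measure (P i) ((\<Union>k. a k) - (\<Union>k<n. a k))) \<longlonglongrightarrow>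
        measure (P i) (\<Inter>n. (\<Union>k. a k) - (\<Union>k<n. a k))"
    proof (rule P.finite_Lim_measure_decseq)
      have "a k \<in> sets (P i)" for k using Union(1) by (simp add: sets[OF i])
      then show "range (\<lambda>n. (\<Union>k. a k) - (\<Union>k<n. a k)) \<subseteq> sets (P i)"
        by (intro image_subsetI sets.Diff sets.countable_UN sets.finite_UN) auto
      show "decseq (\<lambda>n. (\<Union>k. a k) - (\<Union>k<n. a k))"
        by (rule decseq_SucI) auto
    qed
    also have "(\<Inter>n. (\<Union>k. a k) - (\<Union>k<n. a k)) = {}" by auto
    finally show ?thesis by simp
  qed
  then have "\<forall>\<^sub>F n in sequentially. \<forall>i\<in>I. measure (P i) ((\<Union>k. a k) - (\<Union>k<n. a k)) < e / 2"
    using Union(3) by (intro eventually_ball_finite[OF \<open>finite I\<close>] ballI order_tendstoD(2)[where y = 0]) auto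
  then obtain n where n: "\<And>i. i \<in> I \<Longrightarrow> measure (P i) ((\<Union>k. a k) - (\<Union>k<n. a k)) < e / 2"
    by (auto simp: eventually_sequentially)
  \<comment> \<open>The n finite approximations cost at most e/2 together, the tail of the union
    less than e/2. \<open>Suc n\<close> keeps the denominator positive when n = 0.\<close>
  define d where "d = e / (2 * real (Suc n))"
  have "d > 0" using Union(3) by (simp add: d_def)
  then have "\<forall>k. \<exists>B\<in>\<A>. \<forall>i\<in>I. measure (P i) (sym_diff (a k) B) < d" using Union(2) by blast
  then obtain B where B: "\<And>k. B k \<in> \<A>" "\<And>k i. i \<in> I \<Longrightarrow> measure (P i) (sym_diff (a k) (B k)) < d"
    by metis
  show ?case
  proof (intro bexI ballI)
    show "(\<Union>k<n. B k) \<in> \<A>" using B(1) by (intro finite_UN) auto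
    fix i assume i: "i \<in> I"
    interpret P: finite_measure "P i" using fin i by auto
    have meas: "a k \<in> sets (P i)" "B k \<in> sets (P i)" for k
      using Union(1) B(1) by (auto simp: sets[OF i])
    have "measure (P i) (sym_diff (\<Union>k. a k) (\<Union>k<n. B k)) \<le>
        measure (P i) (((\<Union>k. a k) - (\<Union>k<n. a k)) \<union> (\<Union>k<n. sym_diff (a k) (B k)))"
      using meas by (intro P.finite_measure_mono) auto
    also have "\<dots> \<le> measure (P i) ((\<Union>k. a k) - (\<Union>k<n. a k)) + measure (P i) (\<Union>k<n. sym_diff (a k) (B k))"
      using meas by (intro measure_Un_le) auto
    also have "measure (P i) (\<Union>k<n. sym_diff (a k) (B k)) \<le> (\<Sum>k<n. measure (P i) (sym_diff (a k) (B k)))"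
      using meas by (intro measure_UNION_le) auto
    also have "\<dots> \<le> (\<Sum>k<n. d)" using B(2)[OF i] by (intro sum_mono) (simp add: less_imp_le)
    also have "\<dots> \<le> e / 2" using Union(3) by (simp add: d_def field_simps)
    finally show "measure (P i) (sym_diff (\<Union>k. a k) (\<Union>k<n. B k)) < e" using n[OF i] by simp
  qed
qed

text \<open>An inequality is not stable under complements, so an argument on intersection-stable
  generators fails. Instead S is approximated by one set of the algebra that is good for all three
  measures simultaneously.\<close>

lemma measure_inequality_from_algebra:
  fixes M1 M2 M3 :: "'a measure"
  assumes fin: "finite_measure M1" "finite_measure M2" "finite_measure M3"
    and alg: "algebra \<Omega> \<A>"
    and sets: "sets M1 = sigma_sets \<Omega> \<A>" "sets M2 = sigma_sets \<Omega> \<A>" "sets M3 = sigma_sets \<Omega> \<A>"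
    and pos: "0 \<le> x" "0 \<le> a" "0 \<le> b"
    and le: "\<And>B. B \<in> \<A> \<Longrightarrow> x * measure M1 B \<le> a * measure M2 B + b * measure M3 B"
    and S: "S \<in> sigma_sets \<Omega> \<A>"
  shows "x * measure M1 S \<le> a * measure M2 S + b * measure M3 S"
proof (rule field_le_epsilon)
  fix e :: real assume "e > 0"
  define d where "d = e / (x + a + b + 1)"
  have d: "d > 0" "(x + a + b) * d \<le> e"
    using \<open>e > 0\<close> pos by (auto simp: d_def field_simps add_nonneg_pos)
  define P where "P i = (if i = (0::nat) then M1 else if i = 1 then M2 else M3)" for i
  have "\<exists>B\<in>\<A>. \<forall>i\<in>{0, 1, 2}. measure (P i) (sym_diff S B) < d"
    by (rule algebra_approximation[OF _ _ alg _ S d(1)]) (auto simp: P_def fin sets)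
  then obtain B where B: "B \<in> \<A>" "\<forall>i\<in>{0, 1, 2}. measure (P i) (sym_diff S B) < d" by blast
  have near: "\<bar>measure M S - measure M B\<bar> \<le> d"
    if "finite_measure M" "sets M = sigma_sets \<Omega> \<A>" "measure M (sym_diff S B) < d" for M :: "'a measure"
  proof -
    interpret finite_measure M by fact
    have m: "S \<in> sets M" "B \<in> sets M" using S B(1) that by auto
    have "measure M S \<le> measure M (B \<union> sym_diff S B)" using m by (intro finite_measure_mono) auto
    also have "\<dots> \<le> measure M B + measure M (sym_diff S B)" using m by (intro measure_Un_le) auto
    finally have 1: "measure M S \<le> measure M B + d" using that(3) by simp
    have "measure M B \<le> measure M (S \<union> sym_diff S B)" using m by (intro finite_measure_mono) auto
    also have "\<dots> \<le> measure M S + measure M (sym_diff S B)" using m by (intro measure_Un_le) auto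
    finally have 2: "measure M B \<le> measure M S + d" using that(3) by simp
    from 1 2 show ?thesis by linarith
  qed
  have n: "\<bar>measure M1 S - measure M1 B\<bar> \<le> d" "\<bar>measure M2 S - measure M2 B\<bar> \<le> d" "\<bar>measure M3 S - measure M3 B\<bar> \<le> d"
    using B(2) fin sets by (auto intro!: near simp: P_def)
  have "x * measure M1 S \<le> x * (measure M1 B + d)" using n(1) pos(1) by (intro mult_left_mono) linarith+
  also have "\<dots> \<le> a * measure M2 B + b * measure M3 B + x * d" using le[OF B(1)] by (simp add: algebra_simps)
  also have "a * measure M2 B \<le> a * (measure M2 S + d)" using n(2) pos(2) by (intro mult_left_mono) linarith+
  also have "b * measure M3 B \<le> b * (measure M3 S + d)" using n(3) pos(3) by (intro mult_left_mono) linarith+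
  finally show "x * measure M1 S \<le> a * measure M2 S + b * measure M3 S + e"
    using d(2) by (simp add: algebra_simps)
qed

section \<open>Law of the dyadic increments\<close>

text \<open>
  The term for \<open>k = 0\<close> is the value at time 0, so that the increments determine the dyadic values.
\<close>

definition dyadic_incr :: "nat \<Rightarrow> 'n::finite wiener \<Rightarrow> nat \<times> 'n \<Rightarrow> real" where
  "dyadic_incr n w = (\<lambda>(k, i)\<in>dyadic_index n.
     path_at w (dyadic n k) $ i - (if k = 0 then 0 else path_at w (dyadic n (k - 1)) $ i))"

text \<open>Index 0 carries the starting value, which is almost surely 0 under the Wiener measure;
  the other increments have variance \<open>1 / 2 ^ n\<close>, the mesh of the grid.\<close>

definition incr_law :: "nat \<Rightarrow> nat \<times> 'n \<Rightarrow> real measure" where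
  "incr_law n a = (if fst a = 0 then return borel 0 else density lborel (normal_density 0 (sqrt (1 / 2 ^ n))))"

lemma prob_space_incr_law: "prob_space (incr_law n a)"
  by (auto simp: incr_law_def intro!: prob_space_return prob_space_normal_density)

lemma sets_incr_law [measurable_cong, simp]: "sets (incr_law n a) = sets borel"
  by (simp add: incr_law_def)

lemma space_incr_law [simp]: "space (incr_law n a) = UNIV"
  by (simp add: incr_law_def)

lemma sigma_finite_incr_law: "sigma_finite_measure (incr_law n a)"
  by (intro prob_space_imp_sigma_finite prob_space_incr_law)

lemma product_sigma_finite_incr_law: "product_sigma_finite (incr_law n)"
  unfolding product_sigma_finite_def using sigma_finite_incr_law by auto

lemma measurable_dyadic_incr [measurable]:
  "dyadic_incr n \<in> borel \<rightarrow>\<^sub>M dyadic_space n"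
  unfolding dyadic_incr_def
  by (intro measurable_restrict) (auto simp: split_beta intro!: borel_measurable_diff measurable_path_at_nth)

lemma measurable_dyadic_incr_nth [measurable]: "(\<lambda>w. dyadic_incr n w a) \<in> borel_measurable borel"
proof (cases "a \<in> dyadic_index n")
  case True
  then show ?thesis
    by (intro measurable_compose[OF measurable_dyadic_incr] measurable_component_singleton)
qed (simp add: dyadic_incr_def)

lemma dyadic_incr_linear:
  "a \<in> dyadic_index n \<Longrightarrow> dyadic_incr n (v + w) a = dyadic_incr n v a + dyadic_incr n w a"
  "a \<in> dyadic_index n \<Longrightarrow> dyadic_incr n (r *\<^sub>R w) a = r * dyadic_incr n w a"
  by (auto simp: dyadic_incr_def algebra_simps)

definition cumulate :: "nat \<Rightarrow> (nat \<times> 'n::finite \<Rightarrow> real) \<Rightarrow> nat \<times> 'n \<Rightarrow> real" where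
  "cumulate n x = (\<lambda>a\<in>dyadic_index n. \<Sum>j\<le>fst a. x (j, snd a))"

lemma measurable_cumulate [measurable]:
  "cumulate n \<in> dyadic_space n \<rightarrow>\<^sub>M dyadic_space n"
  unfolding cumulate_def
  by (intro measurable_restrict borel_measurable_sum measurable_component_singleton) auto

lemma dyadic_values_eq_cumulate: "dyadic_values n w = cumulate n (dyadic_incr n w)"
proof
  fix a :: "nat \<times> 'a"
  have "(\<Sum>j\<le>k. dyadic_incr n w (j, i)) = path_at w (dyadic n k) $ i" if "k \<le> 2 ^ n" for k i
    using that
  proof (induction k)
    case (Suc k)
    then show ?case by (simp add: dyadic_incr_def)
  qed (simp add: dyadic_incr_def)
  then show "dyadic_values n w a = cumulate n (dyadic_incr n w) a"
    by (cases a) (auto simp: dyadic_values_def cumulate_def restrict_def)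
qed

lemma nn_integral_lborel_vec_prod:
  fixes G :: "'n::finite \<Rightarrow> real \<Rightarrow> ennreal"
  assumes [measurable]: "\<And>i. G i \<in> borel_measurable borel"
  shows "(\<integral>\<^sup>+x. (\<Prod>i\<in>UNIV. G i (x $ i)) \<partial>(lborel :: (real^'n) measure)) = (\<Prod>i\<in>UNIV. \<integral>\<^sup>+y. G i y \<partial>lborel)"
proof -
  define e :: "'n \<Rightarrow> real^'n" where "e i = axis i 1" for i
  have inj: "inj e" by (auto simp: inj_def e_def axis_eq_axis)
  have Basis: "Basis = range e" by (auto simp: Basis_vec_def e_def)
  have pr: "(\<Prod>b\<in>Basis. F b) = (\<Prod>i\<in>UNIV. F (e i))" for F :: "real^'n \<Rightarrow> ennreal"
    unfolding Basis by (subst prod.reindex) (auto simp: inj)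
  have inv: "inv e (e i) = i" for i using inj by simp
  have "(\<integral>\<^sup>+x. (\<Prod>i\<in>UNIV. G i (x $ i)) \<partial>(lborel :: (real^'n) measure)) =
      (\<integral>\<^sup>+x. (\<Prod>b\<in>Basis. G (inv e b) (x \<bullet> b)) \<partial>lborel)"
    unfolding pr inv by (simp add: e_def inner_axis)
  also have "\<dots> = (\<Prod>b\<in>Basis. \<integral>\<^sup>+y. G (inv e b) y \<partial>lborel)"
    by (rule nn_integral_lborel_prod) auto
  also have "\<dots> = (\<Prod>i\<in>UNIV. \<integral>\<^sup>+y. G i y \<partial>lborel)" unfolding pr inv ..
  finally show ?thesis .
qed

text \<open>All Gaussian information about \<open>wiener_measure\<close> enters here. Factorisation
  over time steps is independence, factorisation over coordinates is the product form of the vector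
  density, and the factor of index 0 comes from the almost sure starting point.\<close>

lemma wiener_nn_integral_incr:
  fixes \<mu> :: "'n::finite wiener measure" and \<phi> :: "nat \<times> 'n \<Rightarrow> real \<Rightarrow> ennreal"
  assumes \<mu>: "wiener_measure \<mu>" and [measurable]: "\<And>a. \<phi> a \<in> borel_measurable borel"
  shows "(\<integral>\<^sup>+w. (\<Prod>a\<in>dyadic_index n. \<phi> a (dyadic_incr n w a)) \<partial>\<mu>) =
    (\<Prod>a\<in>dyadic_index n. \<integral>\<^sup>+x. \<phi> a x \<partial>incr_law n a)"
proof -
  interpret prob_space \<mu> using \<mu> by (simp add: wiener_measure_def)
  have [measurable_cong]: "sets \<mu> = sets borel" using \<mu> by (simp add: wiener_measure_def)
  let ?q = "2 ^ n :: nat"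
  define \<Delta> where "\<Delta> k w = path_at w (dyadic n (Suc k)) - path_at w (dyadic n k)" for k and w :: "'n wiener"
  define \<psi> where "\<psi> k x = (\<Prod>i\<in>UNIV. \<phi> (Suc k, i) (x $ i))" for k and x :: "real^'n"
  define C where "C = (\<Prod>i\<in>UNIV. \<phi> (0, i) 0)"
  have [measurable]: "(\<lambda>x::real^'n. x $ i) \<in> borel_measurable borel" for i
    by (intro borel_measurable_continuous_onI continuous_on_component continuous_on_id)
  have \<psi> [measurable]: "\<psi> k \<in> borel_measurable borel" for k
    unfolding \<psi>_def[abs_def] by measurable
  have \<Delta> [measurable]: "\<Delta> k \<in> borel_measurable borel" for k
    unfolding \<Delta>_def[abs_def] by measurable
  have mono: "strict_mono_on {..?q} (dyadic n)"
    by (auto simp: strict_mono_on_def dyadic_def divide_strict_right_mono)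
  have "indep_vars (\<lambda>_. borel) \<Delta> {..<?q}"
    using \<mu> mono dyadic_mem[of _ n] unfolding wiener_measure_def \<Delta>_def[abs_def] by blast
  then have indep: "indep_vars (\<lambda>_. borel) (\<lambda>k w. \<psi> k (\<Delta> k w)) {..<?q}"
    by (rule indep_vars_compose2) simp
  have dist: "distributed \<mu> lborel (\<Delta> k) (\<lambda>x. ennreal (\<Prod>i\<in>UNIV. normal_density 0 (sqrt (1 / 2 ^ n)) (x $ i)))"
    if "k < ?q" for k
  proof -
    have k: "0 \<le> dyadic n k" "dyadic n k < dyadic n (Suc k)" "dyadic n (Suc k) \<le> 1"
      using dyadic_mem[of "Suc k" n] that by (auto simp: dyadic_def divide_strict_right_mono)
    have diff: "dyadic n (Suc k) - dyadic n k = 1 / 2 ^ n"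
      by (simp add: dyadic_def diff_divide_distrib[symmetric])
    have "\<forall>s t. 0 \<le> s \<longrightarrow> s < t \<longrightarrow> t \<le> 1 \<longrightarrow>
        distributed \<mu> lborel (\<lambda>w. path_at w t - path_at w s)
          (\<lambda>x. ennreal (\<Prod>i\<in>UNIV. normal_density 0 (sqrt (t - s)) (x $ i)))"
      using \<mu> unfolding wiener_measure_def by (elim conjE)
    from this[rule_format, OF k] show ?thesis by (simp only: \<Delta>_def[abs_def] diff)
  qed
  have one: "(\<integral>\<^sup>+w. \<psi> k (\<Delta> k w) \<partial>\<mu>) = (\<Prod>i\<in>UNIV. \<integral>\<^sup>+x. \<phi> (Suc k, i) x \<partial>incr_law n (Suc k, i))"
    if k: "k < ?q" for k
  proof -
    have "(\<integral>\<^sup>+w. \<psi> k (\<Delta> k w) \<partial>\<mu>) =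
        (\<integral>\<^sup>+x. ennreal (\<Prod>i\<in>UNIV. normal_density 0 (sqrt (1 / 2 ^ n)) (x $ i)) * \<psi> k x \<partial>lborel)"
      by (rule distributed_nn_integral[OF dist[OF k], symmetric]) simp
    also have "\<dots> = (\<integral>\<^sup>+x. (\<Prod>i\<in>UNIV. ennreal (normal_density 0 (sqrt (1 / 2 ^ n)) (x $ i)) * \<phi> (Suc k, i) (x $ i))
        \<partial>(lborel :: (real^'n) measure))"
      by (simp add: \<psi>_def prod.distrib prod_ennreal)
    also have "\<dots> = (\<Prod>i\<in>UNIV. \<integral>\<^sup>+y. ennreal (normal_density 0 (sqrt (1 / 2 ^ n)) y) * \<phi> (Suc k, i) y \<partial>lborel)"
      by (rule nn_integral_lborel_vec_prod) measurable
    also have "\<dots> = (\<Prod>i\<in>UNIV. \<integral>\<^sup>+x. \<phi> (Suc k, i) x \<partial>incr_law n (Suc k, i))"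
      by (simp add: incr_law_def nn_integral_density)
    finally show ?thesis .
  qed
  have split: "(\<Prod>a\<in>dyadic_index n. F a) = (\<Prod>i\<in>UNIV. F (0, i)) * (\<Prod>k<?q. \<Prod>i\<in>UNIV. F (Suc k, i))"
    for F :: "nat \<times> 'n \<Rightarrow> ennreal"
    by (subst prod.cartesian_product[symmetric, where g = "\<lambda>k i. F (k, i)", simplified])
       (simp add: prod.atMost_shift)
  have "(\<integral>\<^sup>+w. (\<Prod>a\<in>dyadic_index n. \<phi> a (dyadic_incr n w a)) \<partial>\<mu>) =
      (\<integral>\<^sup>+w. C * (\<Prod>k<?q. \<psi> k (\<Delta> k w)) \<partial>\<mu>)"
  proof (rule nn_integral_cong_AE)
    have "AE w in \<mu>. path_at w 0 = 0" using \<mu> by (simp add: wiener_measure_def)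
    then show "AE w in \<mu>. (\<Prod>a\<in>dyadic_index n. \<phi> a (dyadic_incr n w a)) = C * (\<Prod>k<?q. \<psi> k (\<Delta> k w))"
    proof eventually_elim
      case (elim w)
      have "(\<Prod>i\<in>UNIV. \<phi> (0, i) (dyadic_incr n w (0, i))) = C"
        using elim by (simp add: C_def dyadic_incr_def dyadic_def)
      moreover have "(\<Prod>k<?q. \<Prod>i\<in>UNIV. \<phi> (Suc k, i) (dyadic_incr n w (Suc k, i))) = (\<Prod>k<?q. \<psi> k (\<Delta> k w))"
        by (intro prod.cong refl) (simp_all add: \<psi>_def \<Delta>_def dyadic_incr_def)
      ultimately show ?case unfolding split by simp
    qed
  qed
  also have "\<dots> = C * (\<integral>\<^sup>+w. (\<Prod>k<?q. \<psi> k (\<Delta> k w)) \<partial>\<mu>)"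
    by (rule nn_integral_cmult) measurable
  also have "(\<integral>\<^sup>+w. (\<Prod>k<?q. \<psi> k (\<Delta> k w)) \<partial>\<mu>) = (\<Prod>k<?q. \<integral>\<^sup>+w. \<psi> k (\<Delta> k w) \<partial>\<mu>)"
    by (rule indep_vars_nn_integral[OF _ indep]) auto
  also have "\<dots> = (\<Prod>k<?q. \<Prod>i\<in>UNIV. \<integral>\<^sup>+x. \<phi> (Suc k, i) x \<partial>incr_law n (Suc k, i))"
    by (intro prod.cong one) auto
  also have "C = (\<Prod>i\<in>UNIV. \<integral>\<^sup>+x. \<phi> (0, i) x \<partial>incr_law n (0, i))"
    by (simp add: C_def incr_law_def nn_integral_return)
  finally show ?thesis unfolding split .
qed

section \<open>Rotation invariance of the Wiener measure\<close>

lemma distr_dyadic_incr_eqI: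
  fixes P :: "'n::finite wiener measure" and X :: "'n wiener \<Rightarrow> 'n wiener"
  assumes [measurable_cong]: "sets P = sets borel" and [measurable]: "X \<in> borel \<rightarrow>\<^sub>M borel"
    and N: "product_sigma_finite N" and [measurable_cong]: "\<And>a. sets (N a) = sets borel"
    and eq: "\<And>A. (\<And>a. A a \<in> sets borel) \<Longrightarrow>
      (\<integral>\<^sup>+w. (\<Prod>a\<in>dyadic_index n. indicator (A a) (dyadic_incr n (X w) a)) \<partial>P) =
      (\<Prod>a\<in>dyadic_index n. emeasure (N a) (A a))"
  shows "distr P (dyadic_space n) (\<lambda>w. dyadic_incr n (X w)) = Pi\<^sub>M (dyadic_index n) N"
proof -
  interpret product_sigma_finite N by fact
  let ?J = "dyadic_index n :: (nat \<times> 'n) set"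
  show ?thesis
  proof (rule PiM_eqI)
    show "sets (distr P (dyadic_space n) (\<lambda>w. dyadic_incr n (X w))) = sets (Pi\<^sub>M ?J N)"
      by (simp add: assms(4) cong: sets_PiM_cong)
    fix A assume A: "\<And>a. a \<in> ?J \<Longrightarrow> A a \<in> sets (N a)"
    define A' where "A' a = (if a \<in> ?J then A a else {})" for a
    have A': "A' a \<in> sets borel" for a using A by (auto simp: A'_def assms(4))
    have "Pi\<^sub>E ?J A = Pi\<^sub>E ?J A'" by (rule PiE_cong) (simp add: A'_def)
    then have m: "Pi\<^sub>E ?J A \<in> sets (dyadic_space n)" using A' by (auto intro!: sets_PiM_I_finite)
    have "emeasure (distr P (dyadic_space n) (\<lambda>w. dyadic_incr n (X w))) (Pi\<^sub>E ?J A) =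
        (\<integral>\<^sup>+w. indicator (Pi\<^sub>E ?J A) (dyadic_incr n (X w)) \<partial>P)"
      using m by (subst nn_integral_indicator[symmetric], simp) (subst nn_integral_distr, auto)
    also have "\<dots> = (\<integral>\<^sup>+w. (\<Prod>a\<in>?J. indicator (A' a) (dyadic_incr n (X w) a)) \<partial>P)"
    proof (rule nn_integral_cong)
      fix w
      have "dyadic_incr n (X w) \<in> Pi\<^sub>E ?J A \<longleftrightarrow> (\<forall>a\<in>?J. dyadic_incr n (X w) a \<in> A' a)"
        by (auto simp: A'_def PiE_def Pi_def dyadic_incr_def)
      moreover have "(\<Prod>a\<in>?J. indicator (A' a) (dyadic_incr n (X w) a) :: ennreal) =
          of_bool (\<forall>a\<in>?J. dyadic_incr n (X w) a \<in> A' a)"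
      proof (cases "\<forall>a\<in>?J. dyadic_incr n (X w) a \<in> A' a")
        case True
        then show ?thesis by (subst prod.neutral) auto
      next
        case False
        then show ?thesis by (subst prod_zero) (auto simp: indicator_def)
      qed
      ultimately show "(indicator (Pi\<^sub>E ?J A) (dyadic_incr n (X w)) :: ennreal) =
          (\<Prod>a\<in>?J. indicator (A' a) (dyadic_incr n (X w) a))"
        by (simp add: indicator_def)
    qed
    also have "\<dots> = (\<Prod>a\<in>?J. emeasure (N a) (A' a))" by (rule eq) (rule A')
    also have "\<dots> = (\<Prod>a\<in>?J. emeasure (N a) (A a))" by (intro prod.cong refl) (simp add: A'_def)
    finally show "emeasure (distr P (dyadic_space n) (\<lambda>w. dyadic_incr n (X w))) (Pi\<^sub>E ?J A) =
        (\<Prod>a\<in>?J. emeasure (N a) (A a))" .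
  qed simp
qed

text \<open>Cylinder sets speak of values, whereas product laws are available for increments;
  \<open>cumulate\<close> carries one description to the other.\<close>

lemma emeasure_cylinder:
  fixes P :: "'n::finite wiener measure"
  assumes [measurable_cong]: "sets P = sets borel"
    and B: "B \<in> sets (dyadic_space n)"
  shows "emeasure P (dyadic_values n -` B) =
    emeasure (distr P (dyadic_space n) (dyadic_incr n))
      (cumulate n -` B \<inter> space (dyadic_space n))"
proof -
  have sp: "space P = UNIV" using sets_eq_imp_space_eq[OF assms(1)] by simp
  have "dyadic_incr n w \<in> space (dyadic_space n)" for w :: "'n wiener"
    by (auto simp: dyadic_incr_def space_PiM)
  then have "dyadic_incr n -` (cumulate n -` B \<inter> space (dyadic_space n)) \<inter> space P =
      dyadic_values n -` B"
    by (auto simp: dyadic_values_eq_cumulate sp)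
  then show ?thesis
    using measurable_sets[OF measurable_cumulate B] by (subst emeasure_distr) auto
qed

text \<open>The increment laws determine the measures of all cylinder sets, and these form an
  intersection-stable generator.\<close>

lemma wiener_measures_eqI:
  fixes P Q :: "'n::finite wiener measure"
  assumes P: "sets P = sets borel" "finite_measure P" and Q: "sets Q = sets borel"
    and eq: "\<And>n. distr P (dyadic_space n) (dyadic_incr n) =
      distr Q (dyadic_space n) (dyadic_incr n)"
  shows "P = Q"
proof -
  interpret A: algebra UNIV "cylinder_sets :: 'n wiener set set" by (rule algebra_cylinder_sets)
  show ?thesis
  proof (rule measure_eqI_generator_eq[where E = cylinder_sets and \<Omega> = UNIV and A = "\<lambda>_. UNIV"])
    show "Int_stable (cylinder_sets :: 'n wiener set set)" by (auto simp: Int_stable_def)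
    show "emeasure P X = emeasure Q X" if "X \<in> cylinder_sets" for X
      using that emeasure_cylinder[OF P(1)] emeasure_cylinder[OF Q] eq by (auto simp: cylinder_sets_def)
    show "emeasure P UNIV \<noteq> \<infinity>" using finite_measure.emeasure_finite[OF P(2)] by simp
  qed (use P Q in \<open>auto simp: sets_borel_wiener\<close>)
qed

lemma distr_dyadic_incr_wiener:
  fixes \<mu> :: "'a::finite wiener measure"
  assumes "wiener_measure \<mu>"
  shows "distr \<mu> (dyadic_space n) (dyadic_incr n) = Pi\<^sub>M (dyadic_index n) (incr_law n)"
proof -
  have "distr \<mu> (dyadic_space n) (\<lambda>w. dyadic_incr n (id w)) = Pi\<^sub>M (dyadic_index n) (incr_law n)"
  proof (rule distr_dyadic_incr_eqI)
    fix A :: "nat \<times> 'a \<Rightarrow> real set" assume [measurable]: "\<And>a. A a \<in> sets borel"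
    have "(\<integral>\<^sup>+w. (\<Prod>a\<in>dyadic_index n. indicator (A a) (dyadic_incr n w a)) \<partial>\<mu>) =
        (\<Prod>a\<in>dyadic_index n. \<integral>\<^sup>+x. indicator (A a) x \<partial>incr_law n a)"
      by (rule wiener_nn_integral_incr[OF assms]) measurable
    then show "(\<integral>\<^sup>+w. (\<Prod>a\<in>dyadic_index n. indicator (A a) (dyadic_incr n (id w) a)) \<partial>\<mu>) =
        (\<Prod>a\<in>dyadic_index n. emeasure (incr_law n a) (A a))"
      by simp
  qed (use assms product_sigma_finite_incr_law in \<open>auto simp: wiener_measure_def\<close>)
  then show ?thesis by simp
qed

text \<open>After substituting u = c x + s z in the inner integral, exchanging the integrals leaves
  the convolution of two centred Gaussians with standard deviations c \<sigma> and s \<sigma>; its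
  variance is again \<sigma> squared.\<close>

lemma nn_integral_normal_rotation:
  fixes c s \<sigma> :: real
  assumes [measurable]: "\<phi> \<in> borel_measurable borel" and c: "c > 0" and s: "s > 0" and cs: "c\<^sup>2 + s\<^sup>2 = 1" and \<sigma>: "\<sigma> > 0"
  shows "(\<integral>\<^sup>+x. (\<integral>\<^sup>+z. \<phi> (c * x + s * z) \<partial>density lborel (normal_density 0 \<sigma>)) \<partial>density lborel (normal_density 0 \<sigma>)) =
    (\<integral>\<^sup>+u. \<phi> u \<partial>density lborel (normal_density 0 \<sigma>))"
proof -
  let ?n = "\<lambda>\<sigma> x. ennreal (normal_density 0 \<sigma> x)"
  have scale: "ennreal r * ?n (r * \<sigma>) (r * x) = ?n \<sigma> x" if "r > 0" for r x
    using that \<sigma> by (simp add: normal_density_def ennreal_mult[symmetric] power_mult_distrib real_sqrt_mult)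
  have 1: "(\<integral>\<^sup>+z. ?n \<sigma> z * \<phi> (c * x + s * z) \<partial>lborel) = (\<integral>\<^sup>+u. ?n (s * \<sigma>) (u - c * x) * \<phi> u \<partial>lborel)" for x
  proof -
    have "(\<integral>\<^sup>+u. ?n (s * \<sigma>) (u - c * x) * \<phi> u \<partial>lborel) =
        ennreal \<bar>s\<bar> * (\<integral>\<^sup>+z. ?n (s * \<sigma>) ((c * x + s * z) - c * x) * \<phi> (c * x + s * z) \<partial>lborel)"
      using s by (intro nn_integral_real_affine) auto
    also have "\<dots> = (\<integral>\<^sup>+z. ennreal s * (?n (s * \<sigma>) (s * z) * \<phi> (c * x + s * z)) \<partial>lborel)"
      using s by (subst nn_integral_cmult) auto
    also have "\<dots> = (\<integral>\<^sup>+z. ?n \<sigma> z * \<phi> (c * x + s * z) \<partial>lborel)"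
      using scale[OF s] by (simp add: mult.assoc[symmetric])
    finally show ?thesis by simp
  qed
  have 2: "(\<integral>\<^sup>+x. ?n \<sigma> x * ?n (s * \<sigma>) (u - c * x) \<partial>lborel) = ?n \<sigma> u" for u
  proof -
    have "(\<integral>\<^sup>+v. ?n (s * \<sigma>) (u - v) * ?n (c * \<sigma>) v \<partial>lborel) =
        ennreal \<bar>c\<bar> * (\<integral>\<^sup>+x. ?n (s * \<sigma>) (u - (0 + c * x)) * ?n (c * \<sigma>) (0 + c * x) \<partial>lborel)"
      using c by (intro nn_integral_real_affine) auto
    also have "\<dots> = (\<integral>\<^sup>+x. ennreal c * (?n (s * \<sigma>) (u - c * x) * ?n (c * \<sigma>) (c * x)) \<partial>lborel)"
      using c by (subst nn_integral_cmult) auto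
    also have "\<dots> = (\<integral>\<^sup>+x. ?n \<sigma> x * ?n (s * \<sigma>) (u - c * x) \<partial>lborel)"
    proof (rule nn_integral_cong)
      fix x
      have "ennreal c * (?n (s * \<sigma>) (u - c * x) * ?n (c * \<sigma>) (c * x)) =
          (ennreal c * ?n (c * \<sigma>) (c * x)) * ?n (s * \<sigma>) (u - c * x)"
        by (simp only: mult.assoc mult.commute[of "?n (s * \<sigma>) (u - c * x)"])
      then show "ennreal c * (?n (s * \<sigma>) (u - c * x) * ?n (c * \<sigma>) (c * x)) =
          ?n \<sigma> x * ?n (s * \<sigma>) (u - c * x)"
        by (simp only: scale[OF c])
    qed
    finally have "(\<integral>\<^sup>+x. ?n \<sigma> x * ?n (s * \<sigma>) (u - c * x) \<partial>lborel) =
        (\<integral>\<^sup>+v. ennreal (normal_density 0 (s * \<sigma>) (u - v) * normal_density 0 (c * \<sigma>) v) \<partial>lborel)"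
      by (simp add: ennreal_mult)
    also have "\<dots> = ?n (sqrt ((s * \<sigma>)\<^sup>2 + (c * \<sigma>)\<^sup>2)) u"
      using conv_normal_density_zero_mean[of "s * \<sigma>" "c * \<sigma>"] c s \<sigma> by (auto dest: fun_cong)
    also have "(s * \<sigma>)\<^sup>2 + (c * \<sigma>)\<^sup>2 = \<sigma>\<^sup>2"
    proof -
      have "(s * \<sigma>)\<^sup>2 + (c * \<sigma>)\<^sup>2 = (c\<^sup>2 + s\<^sup>2) * \<sigma>\<^sup>2" by algebra
      then show ?thesis by (simp add: cs)
    qed
    finally show ?thesis using \<sigma> by simp
  qed
  have "(\<integral>\<^sup>+x. (\<integral>\<^sup>+z. \<phi> (c * x + s * z) \<partial>density lborel (?n \<sigma>)) \<partial>density lborel (?n \<sigma>)) =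
      (\<integral>\<^sup>+x. ?n \<sigma> x * (\<integral>\<^sup>+u. ?n (s * \<sigma>) (u - c * x) * \<phi> u \<partial>lborel) \<partial>lborel)"
    by (simp add: nn_integral_density 1)
  also have "\<dots> = (\<integral>\<^sup>+x. (\<integral>\<^sup>+u. ?n \<sigma> x * ?n (s * \<sigma>) (u - c * x) * \<phi> u \<partial>lborel) \<partial>lborel)"
    by (simp add: nn_integral_cmult[symmetric] mult.assoc)
  also have "\<dots> = (\<integral>\<^sup>+u. (\<integral>\<^sup>+x. ?n \<sigma> x * ?n (s * \<sigma>) (u - c * x) * \<phi> u \<partial>lborel) \<partial>lborel)"
    by (rule lborel_pair.Fubini') measurable
  also have "\<dots> = (\<integral>\<^sup>+u. ?n \<sigma> u * \<phi> u \<partial>lborel)"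
    by (simp add: nn_integral_multc 2)
  finally show ?thesis by (simp add: nn_integral_density)
qed

lemma incr_law_rotation:
  fixes c s :: real
  assumes "\<phi> \<in> borel_measurable borel" "c > 0" "s > 0" "c\<^sup>2 + s\<^sup>2 = 1"
  shows "(\<integral>\<^sup>+x. (\<integral>\<^sup>+z. \<phi> (c * x + s * z) \<partial>incr_law n a) \<partial>incr_law n a) = (\<integral>\<^sup>+u. \<phi> u \<partial>incr_law n a)"
proof (cases "fst a = 0")
  case True
  have [measurable]: "\<phi> \<in> borel_measurable borel" by fact
  show ?thesis using True by (simp add: incr_law_def nn_integral_return)
next
  case False
  then show ?thesis
    using nn_integral_normal_rotation[OF assms, of "sqrt (1 / 2 ^ n)"] by (simp add: incr_law_def)
qed

text \<open>Increments are linear in the path, so at each dyadic level the claim splits into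
  one-dimensional Gaussian rotations, one for every index.\<close>

lemma wiener_rotation:
  fixes \<mu> :: "'n::finite wiener measure"
  assumes \<mu>: "wiener_measure \<mu>" and cs: "c > 0" "s > 0" "c\<^sup>2 + s\<^sup>2 = 1"
  shows "distr (\<mu> \<Otimes>\<^sub>M \<mu>) borel (\<lambda>(w, y). c *\<^sub>R w + s *\<^sub>R y) = \<mu>"
proof -
  have prob: "prob_space \<mu>" using \<mu> by (simp add: wiener_measure_def)
  interpret prob_space \<mu> using \<mu> by (simp add: wiener_measure_def)
  interpret pair_prob_space \<mu> \<mu> ..
  have [measurable_cong]: "sets \<mu> = sets borel" using \<mu> by (simp add: wiener_measure_def)
  let ?R = "distr (\<mu> \<Otimes>\<^sub>M \<mu>) borel (\<lambda>(w, y). c *\<^sub>R w + s *\<^sub>R y)"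
  have [measurable]: "(\<lambda>(w, y). c *\<^sub>R w + s *\<^sub>R y) \<in> \<mu> \<Otimes>\<^sub>M \<mu> \<rightarrow>\<^sub>M borel" by measurable
  interpret R: prob_space ?R by (rule prob_space_distr) simp
  show ?thesis
  proof (rule wiener_measures_eqI)
    fix n
    let ?J = "dyadic_index n :: (nat \<times> 'n) set"
    have "distr ?R (dyadic_space n) (\<lambda>w. dyadic_incr n (id w)) = Pi\<^sub>M ?J (incr_law n)"
    proof (rule distr_dyadic_incr_eqI)
      fix A :: "nat \<times> 'n \<Rightarrow> real set" assume A [measurable]: "\<And>a. A a \<in> sets borel"
      have "(\<integral>\<^sup>+w. (\<Prod>a\<in>?J. indicator (A a) (dyadic_incr n (id w) a)) \<partial>?R) =
          (\<integral>\<^sup>+z. (\<Prod>a\<in>?J. indicator (A a) (dyadic_incr n (c *\<^sub>R fst z + s *\<^sub>R snd z) a)) \<partial>(\<mu> \<Otimes>\<^sub>M \<mu>))"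
        by (subst nn_integral_distr) (auto simp: case_prod_beta)
      also have "\<dots> = (\<integral>\<^sup>+z. (\<Prod>a\<in>?J. indicator (A a) (c * dyadic_incr n (fst z) a + s * dyadic_incr n (snd z) a)) \<partial>(\<mu> \<Otimes>\<^sub>M \<mu>))"
        by (intro nn_integral_cong prod.cong refl) (simp add: dyadic_incr_linear)
      also have "\<dots> = (\<integral>\<^sup>+w. (\<integral>\<^sup>+y. (\<Prod>a\<in>?J. indicator (A a) (c * dyadic_incr n w a + s * dyadic_incr n y a)) \<partial>\<mu>) \<partial>\<mu>)"
      proof -
        have "(\<lambda>z. \<Prod>a\<in>?J. indicator (A a) (c * dyadic_incr n (fst z) a + s * dyadic_incr n (snd z) a) :: ennreal)
            \<in> borel_measurable (\<mu> \<Otimes>\<^sub>M \<mu>)" by measurable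
        from sigma_finite_measure.nn_integral_fst[OF prob_space_imp_sigma_finite[OF prob] this] show ?thesis by simp
      qed
      \<comment> \<open>The product formula is applied to the y-integral with w frozen, so its
        factors depend on w; a second application to the w-integral then handles these
        factors.\<close>
      also have "\<dots> = (\<integral>\<^sup>+w. (\<Prod>a\<in>?J. (\<integral>\<^sup>+z. indicator (A a) (c * dyadic_incr n w a + s * z) \<partial>incr_law n a)) \<partial>\<mu>)"
        by (intro nn_integral_cong wiener_nn_integral_incr[OF \<mu>]) measurable
      also have "\<dots> = (\<Prod>a\<in>?J. \<integral>\<^sup>+x. (\<integral>\<^sup>+z. indicator (A a) (c * x + s * z) \<partial>incr_law n a) \<partial>incr_law n a)"
      proof (rule wiener_nn_integral_incr[OF \<mu>])
        fix a :: "nat \<times> 'n"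
        interpret I: sigma_finite_measure "incr_law n a" by (rule sigma_finite_incr_law)
        show "(\<lambda>x. \<integral>\<^sup>+z. indicator (A a) (c * x + s * z) \<partial>incr_law n a) \<in> borel_measurable borel"
          by (rule I.borel_measurable_nn_integral) measurable
      qed
      also have "\<dots> = (\<Prod>a\<in>?J. emeasure (incr_law n a) (A a))"
        by (intro prod.cong refl) (subst incr_law_rotation, use cs in auto)
      finally show "(\<integral>\<^sup>+w. (\<Prod>a\<in>?J. indicator (A a) (dyadic_incr n (id w) a)) \<partial>?R) =
          (\<Prod>a\<in>?J. emeasure (incr_law n a) (A a))" .
    qed (auto simp: product_sigma_finite_incr_law)
    then show "distr ?R (dyadic_space n) (dyadic_incr n) = distr \<mu> (dyadic_space n) (dyadic_incr n)"
      by (simp add: distr_dyadic_incr_wiener[OF \<mu>])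
  qed (use \<mu> in \<open>auto simp: wiener_measure_def intro: R.finite_measure_axioms\<close>)
qed

section \<open>The Cameron-Martin space\<close>

lemma L2_unit_dominated:
  assumes f: "f \<in> L2_unit" and g: "g \<in> borel_measurable borel"
    and le: "\<And>s. s \<in> {0..1} \<Longrightarrow> norm (g s) \<le> norm (f s)"
  shows "g \<in> L2_unit"
proof -
  have [measurable]: "g \<in> borel_measurable borel" by fact
  have "set_integrable lborel {0..1} (\<lambda>s. (norm (g s))\<^sup>2)"
    unfolding set_integrable_def
  proof (rule Bochner_Integration.integrable_bound)
    show "integrable lborel (\<lambda>s. indicator {0..1} s *\<^sub>R (norm (f s))\<^sup>2)"
      using f by (simp add: L2_unit_def set_integrable_def)
    show "AE s in lborel. norm (indicator {0..1} s *\<^sub>R (norm (g s))\<^sup>2) \<le> norm (indicator {0..1} s *\<^sub>R (norm (f s))\<^sup>2)"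
      using le by (intro AE_I2) (auto simp: indicator_def intro!: power_mono)
  qed measurable
  then show ?thesis using g by (simp add: L2_unit_def)
qed

lemma L2_unit_bounded:
  assumes g: "g \<in> borel_measurable borel" and le: "\<And>s. norm (g s) \<le> C"
  shows "g \<in> L2_unit"
proof -
  have [measurable]: "g \<in> borel_measurable borel" by fact
  have "set_integrable lborel {0..1} (\<lambda>s. (norm (g s))\<^sup>2)"
    unfolding set_integrable_def
  proof (rule Bochner_Integration.integrable_bound)
    show "integrable lborel (\<lambda>s::real. indicator {0..1} s *\<^sub>R C\<^sup>2)"
      by simp
    show "AE s in lborel. norm (indicator {0..1} s *\<^sub>R (norm (g s))\<^sup>2) \<le> norm (indicator {0..1} s *\<^sub>R C\<^sup>2)"
      using le by (intro AE_I2) (auto simp: indicator_def intro!: power_mono)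
  qed measurable
  then show ?thesis using g by (simp add: L2_unit_def)
qed

lemma primitive_exists:
  fixes g :: "real \<Rightarrow> real^'n::finite"
  assumes g: "g \<in> L2_unit"
  obtains h where "is_primitive g (cm_path h)"
proof -
  define w0 where "w0 t = (if t \<in> {0..1} then (LBINT s:{0..t}. g s) else 0)" for t
  have int: "set_integrable lborel {0..t} g" if "t \<le> 1" for t using g that by (rule L2_unit_integrable)
  have eq: "(LBINT s:{0..t}. g s) = integral {0..t} g" if "t \<le> 1" for t
    using int[OF that] by (rule set_borel_integral_eq_integral)
  have "g integrable_on {0..1}" using int[of 1] by (auto intro: set_borel_integral_eq_integral)
  then have "continuous_on {0..1} (\<lambda>t. integral {0..t} g)" by (rule indefinite_integral_continuous_1)
  then have "continuous_on {0..1} w0"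
    by (rule continuous_on_cong[THEN iffD1, rotated -1]) (auto simp: w0_def eq)
  then have w0: "path_at (Path w0) = w0" by (intro Path_inverse) (auto simp: w0_def)
  have "is_primitive g (Path w0)" unfolding is_primitive_def w0 by (auto simp: w0_def)
  then have "is_primitive g (cm_path (Cm (Path w0)))" using g by (subst Cm_inverse) auto
  then show ?thesis by (rule that)
qed

lemma primitive_AE_deriv:
  assumes "g \<in> L2_unit" "is_primitive g (cm_path h)"
  shows "AE s in lborel. s \<in> {0..1} \<longrightarrow> cm_deriv h s = g s"
  using is_primitive_unique[OF cm_deriv assms] .

lemma cm_deriv_measurable [measurable]: "cm_deriv h \<in> borel_measurable borel"
  by (rule L2_unit_measurable[OF cm_deriv(1)])

lemma cm_inner_primitive:
  assumes g: "g \<in> L2_unit" "is_primitive g (cm_path h)"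
  shows "h \<bullet> k = (LBINT s:{0..1}. g s \<bullet> cm_deriv k s)"
proof -
  have [measurable]: "g \<in> borel_measurable borel" using g(1) by (rule L2_unit_measurable)
  show ?thesis
    unfolding inner_cameron_martin_def
  proof (rule cm_integral_cong)
    show "AE s in lborel. s \<in> {0..1} \<longrightarrow> cm_deriv h s \<bullet> cm_deriv k s = g s \<bullet> cm_deriv k s"
      using primitive_AE_deriv[OF g] by eventually_elim simp
  qed simp_all
qed

lemma cm_norm_primitive:
  assumes g: "g \<in> L2_unit" "is_primitive g (cm_path h)"
  shows "(norm h)\<^sup>2 = (LBINT s:{0..1}. (norm (g s))\<^sup>2)"
proof -
  have [measurable]: "g \<in> borel_measurable borel" using g(1) by (rule L2_unit_measurable)
  have "(norm h)\<^sup>2 = (LBINT s:{0..1}. g s \<bullet> cm_deriv h s)"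
    by (simp add: power2_norm_eq_inner cm_inner_primitive[OF g])
  also have "\<dots> = (LBINT s:{0..1}. (norm (g s))\<^sup>2)"
  proof (rule cm_integral_cong)
    show "AE s in lborel. s \<in> {0..1} \<longrightarrow> g s \<bullet> cm_deriv h s = (norm (g s))\<^sup>2"
      using primitive_AE_deriv[OF g] by eventually_elim (simp add: power2_norm_eq_inner)
  qed simp_all
  finally show ?thesis .
qed

lemma primitive_eqI:
  assumes "is_primitive g (cm_path h)" "is_primitive g' (cm_path h')"
    and "\<And>s. s \<in> {0..1} \<Longrightarrow> g s = g' s"
  shows "h = h'"
proof -
  have "path_at (cm_path h) t = path_at (cm_path h') t" if t: "t \<in> {0..1}" for t
  proof -
    have "(LBINT s:{0..t}. g s) = (LBINT s:{0..t}. g' s)"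
      unfolding set_lebesgue_integral_def
      by (rule Bochner_Integration.integral_cong) (use t assms(3) in \<open>auto simp: indicator_def\<close>)
    then show ?thesis using assms(1,2) t by (simp only: is_primitive_def)
  qed
  then have "cm_path h = cm_path h'" by (rule wiener_eqI)
  then show ?thesis by (simp add: cm_path_inject)
qed

text \<open>Inverse of \<open>cm_deriv\<close>. For a derivative in \<open>L2_unit\<close> the
  choice is forced, since a primitive fixes the path at every time.\<close>

definition cm_of :: "(real \<Rightarrow> real^'n::finite) \<Rightarrow> 'n cameron_martin" where
  "cm_of g = (SOME h. is_primitive g (cm_path h))"

lemma cm_of: "g \<in> L2_unit \<Longrightarrow> is_primitive g (cm_path (cm_of g))"
  unfolding cm_of_def by (rule someI_ex) (metis primitive_exists)

lemma cm_of_cong: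
  "g \<in> L2_unit \<Longrightarrow> g' \<in> L2_unit \<Longrightarrow> (\<And>s. s \<in> {0..1} \<Longrightarrow> g s = g' s) \<Longrightarrow> cm_of g = cm_of g'"
  using primitive_eqI[OF cm_of cm_of] by blast

lemma cm_of_add: "f \<in> L2_unit \<Longrightarrow> g \<in> L2_unit \<Longrightarrow> cm_of (\<lambda>s. f s + g s) = cm_of f + cm_of g"
  using is_primitive_add[OF _ _ cm_of cm_of, of f g]
  by (intro primitive_eqI[OF cm_of]) (auto intro: L2_unit_add)

lemma cm_of_scaleR: "g \<in> L2_unit \<Longrightarrow> cm_of (\<lambda>s. r *\<^sub>R g s) = r *\<^sub>R cm_of g"
  using is_primitive_scaleR[OF cm_of, of g r]
  by (intro primitive_eqI[OF cm_of]) (auto intro: L2_unit_scaleR)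

lemma L2_unit_diff: "f \<in> L2_unit \<Longrightarrow> g \<in> L2_unit \<Longrightarrow> (\<lambda>s. f s - g s) \<in> L2_unit"
  using L2_unit_add[OF _ L2_unit_scaleR[of g "-1"], of f] by simp

lemma cm_of_diff: "f \<in> L2_unit \<Longrightarrow> g \<in> L2_unit \<Longrightarrow> cm_of (\<lambda>s. f s - g s) = cm_of f - cm_of g"
  using cm_of_add[OF _ L2_unit_scaleR[of g "-1"], of f] cm_of_scaleR[of g "-1"] by simp

lemma cm_of_deriv: "cm_of (cm_deriv h) = h"
  by (rule primitive_eqI[OF cm_of[OF cm_deriv(1)] cm_deriv(2)]) simp

lemma L2_unit_step: "A \<in> sets borel \<Longrightarrow> (\<lambda>s. indicator A s *\<^sub>R v) \<in> L2_unit"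
  by (rule L2_unit_bounded[of _ "norm v"]) (auto simp: indicator_def)

text \<open>The reproducing kernel of the Cameron-Martin space: evaluation of the \<open>i\<close>-th component at time \<open>t\<close>.\<close>

definition cm_kernel :: "real \<Rightarrow> 'n::finite \<Rightarrow> 'n cameron_martin" where
  "cm_kernel t i = cm_of (\<lambda>s. indicator {..t} s *\<^sub>R axis i 1)"

lemma inner_cm_kernel:
  assumes t: "t \<in> {0..1}"
  shows "cm_kernel t i \<bullet> k = path_at (cm_path k) t $ i"
proof -
  have "cm_kernel t i \<bullet> k = (LBINT s:{0..1}. (indicator {..t} s *\<^sub>R axis i 1) \<bullet> cm_deriv k s)"
    unfolding cm_kernel_def by (intro cm_inner_primitive cm_of L2_unit_step) auto
  also have "\<dots> = (LBINT s:{0..t}. cm_deriv k s \<bullet> axis i 1)"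
    unfolding set_lebesgue_integral_def
    by (rule Bochner_Integration.integral_cong) (use t in \<open>auto simp: indicator_def inner_commute\<close>)
  also have "\<dots> = (LBINT s:{0..t}. cm_deriv k s) \<bullet> axis i 1"
    using L2_unit_integrable[OF cm_deriv(1), of t k] t
    unfolding set_lebesgue_integral_def set_integrable_def
    by (subst integral_inner_left[symmetric]) auto
  also have "(LBINT s:{0..t}. cm_deriv k s) = path_at (cm_path k) t"
    using cm_deriv(2)[of k] t by (simp only: is_primitive_def)
  finally show ?thesis by (simp add: inner_axis)
qed

text \<open>The value \<open>min s t\<close> is the covariance of Brownian motion, whose reproducing
  kernel space is the Cameron-Martin space.\<close>

lemma path_cm_kernel:
  assumes t: "t \<in> {0..1}" and s: "s \<in> {0..1}"
  shows "path_at (cm_path (cm_kernel t i)) s $ j = (if i = j then min s t else 0)"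
proof -
  have "path_at (cm_path (cm_kernel t i)) s = (LBINT u:{0..s}. indicator {..t} u *\<^sub>R axis i 1)"
    using cm_of[OF L2_unit_step[of "{..t}" "axis i 1"]] s by (simp add: is_primitive_def cm_kernel_def)
  also have "\<dots> = (LBINT u. indicator {0..min s t} u *\<^sub>R axis i 1)"
    unfolding set_lebesgue_integral_def
    by (rule Bochner_Integration.integral_cong) (auto simp: indicator_def)
  also have "\<dots> = min s t *\<^sub>R axis i 1"
    using t s by (subst Bochner_Integration.integral_scaleR_left) auto
  finally show ?thesis by (simp add: axis_def)
qed

lemma inner_cm_kernel_kernel:
  "t \<in> {0..1} \<Longrightarrow> s \<in> {0..1} \<Longrightarrow> cm_kernel t i \<bullet> cm_kernel s j = (if i = j then min s t else 0)"
  by (auto simp: inner_cm_kernel path_cm_kernel)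

lemma cm_path_zero: "path_at (cm_path h) 0 = 0"
proof -
  have "path_at (cm_path h) 0 = (LBINT s:{0..0}. cm_deriv h s)"
    using cm_deriv(2)[of h] by (simp add: is_primitive_def)
  also have "\<dots> = 0"
    unfolding set_lebesgue_integral_def
  proof (rule integral_eq_zero_AE)
    show "AE s in lborel. indicator {0..0} s *\<^sub>R cm_deriv h s = 0"
      using AE_lborel_singleton[of "0::real"] by eventually_elim (auto simp: indicator_def)
  qed
  finally show ?thesis .
qed

text \<open>Bessel's inequality for differences of neighbouring kernels: they represent the
  increments as inner products, are pairwise orthogonal and have squared norm
  \<open>1 / 2 ^ n\<close>. Here it is Cauchy-Schwarz for h and the combination \<open>Y\<close>,
  where \<open>Y \<bullet> h\<close> is S and \<open>Y \<bullet> Y\<close> is S divided by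
  \<open>2 ^ n\<close>. The bound does not depend on n, which makes the later density estimates
  uniform in the level.\<close>

lemma cm_energy_le:
  fixes h :: "'n::finite cameron_martin"
  shows "2 ^ n * (\<Sum>a\<in>dyadic_index n. (dyadic_incr n (cm_path h) a)\<^sup>2) \<le> (norm h)\<^sup>2"
proof -
  let ?J = "dyadic_index n :: (nat \<times> 'n) set"
  define \<delta> where "\<delta> = dyadic_incr n (cm_path h)"
  define y :: "nat \<times> 'n \<Rightarrow> 'n cameron_martin"
    where "y a = cm_kernel (dyadic n (fst a)) (snd a) - (if fst a = 0 then 0 else cm_kernel (dyadic n (fst a - 1)) (snd a))" for a
  have yk: "y a \<bullet> k = dyadic_incr n (cm_path k) a" if "a \<in> ?J" for a k
    using that dyadic_mem[of "fst a" n] dyadic_mem[of "fst a - 1" n]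
    by (auto simp: y_def dyadic_incr_def inner_diff_left inner_cm_kernel split: prod.splits)
  have mind: "min (dyadic n k) (dyadic n l) = dyadic n (min k l)" for k l
    by (simp add: dyadic_def min_def divide_right_mono field_simps)
  have yy: "y a \<bullet> y b = (if a = b then 1 / 2 ^ n else 0)" if a: "a \<in> ?J" "fst a \<noteq> 0" and b: "b \<in> ?J" "fst b \<noteq> 0" for a b
  proof -
    obtain k i l j where ab: "a = (Suc k, i)" "b = (Suc l, j)"
      using a(2) b(2) by (metis prod.collapse not0_implies_Suc)
    have mem: "dyadic n (Suc k) \<in> {0..1}" "dyadic n k \<in> {0..1}" "dyadic n (Suc l) \<in> {0..1}" "dyadic n l \<in> {0..1}"
      using a(1) b(1) unfolding ab by (auto intro!: dyadic_mem simp del: atLeastAtMost_iff)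
    have "y a \<bullet> y b = (if i = j then dyadic n (min (Suc l) (Suc k)) - dyadic n (min l (Suc k))
        - (dyadic n (min (Suc l) k) - dyadic n (min l k)) else 0)"
      by (simp add: y_def ab inner_diff_left inner_diff_right inner_cm_kernel_kernel[OF mem(1) mem(3)]
          inner_cm_kernel_kernel[OF mem(1) mem(4)] inner_cm_kernel_kernel[OF mem(2) mem(3)]
          inner_cm_kernel_kernel[OF mem(2) mem(4)] mind)
    also have "\<dots> = (if a = b then 1 / 2 ^ n else 0)"
    proof -
      consider "l = k" | "l = Suc k" | "k = Suc l" | "Suc k < l" | "Suc l < k" by linarith
      then show ?thesis by cases (auto simp: ab dyadic_def min_def field_simps)
    qed
    finally show ?thesis .
  qed
  \<comment> \<open>Paths of H start at 0, so the terms of index 0 drop out and orthogonality is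
    only required between true increments.\<close>
  have \<delta>0: "\<delta> a = 0" if "fst a = 0" for a
    using that cm_path_zero[of h] by (auto simp: \<delta>_def dyadic_incr_def dyadic_def restrict_def split: prod.splits)
  define S where "S = (\<Sum>a\<in>?J. (\<delta> a)\<^sup>2)"
  define Y where "Y = (\<Sum>a\<in>?J. \<delta> a *\<^sub>R y a)"
  have "Y \<bullet> h = S"
    unfolding Y_def S_def inner_sum_left
    by (intro sum.cong refl) (simp add: yk \<delta>_def power2_eq_square)
  moreover have "Y \<bullet> Y = S / 2 ^ n"
  proof -
    have "Y \<bullet> Y = (\<Sum>a\<in>?J. \<Sum>b\<in>?J. \<delta> a * \<delta> b * (y b \<bullet> y a))"
      by (simp add: Y_def inner_sum_left inner_sum_right mult.assoc sum_distrib_left)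
    also have "\<dots> = (\<Sum>a\<in>?J. \<Sum>b\<in>?J. if a = b then (\<delta> a)\<^sup>2 / 2 ^ n else 0)"
    proof (intro sum.cong refl)
      fix a b assume "a \<in> ?J" "b \<in> ?J"
      then show "\<delta> a * \<delta> b * (y b \<bullet> y a) = (if a = b then (\<delta> a)\<^sup>2 / 2 ^ n else 0)"
        by (cases "fst a = 0 \<or> fst b = 0") (auto simp: yy \<delta>0 power2_eq_square)
    qed
    also have "\<dots> = (\<Sum>a\<in>?J. (\<delta> a)\<^sup>2 / 2 ^ n)"
      by (intro sum.cong refl) simp
    finally show ?thesis by (simp add: S_def sum_divide_distrib)
  qed
  moreover have "(Y \<bullet> h)\<^sup>2 \<le> (Y \<bullet> Y) * (h \<bullet> h)" by (rule Cauchy_Schwarz_ineq)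
  ultimately have "S * S \<le> S * ((norm h)\<^sup>2 / 2 ^ n)"
    by (simp add: power2_eq_square flip: power2_norm_eq_inner)
  moreover have "S \<ge> 0" by (simp add: S_def sum_nonneg)
  ultimately have "S \<le> (norm h)\<^sup>2 / 2 ^ n"
    by (cases "S = 0") (simp_all add: mult_le_cancel_left_pos del: times_divide_eq_right)
  then show ?thesis by (simp add: S_def \<delta>_def field_simps)
qed

section \<open>Totality of the kernels at rational times\<close>

definition kernel_span :: "'n::finite cameron_martin set" where
  "kernel_span = closure (span ((\<lambda>(t, i). cm_kernel t i) ` ((\<rat> \<inter> {0..1}) \<times> UNIV)))"

lemma subspace_closure:
  fixes S :: "'a::real_normed_vector set"
  assumes S: "subspace S"
  shows "subspace (closure S)"
proof (rule subspaceI)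
  show "0 \<in> closure S" using subspace_0[OF S] closure_subset by blast
  fix x y :: 'a and c :: real assume "x \<in> closure S" "y \<in> closure S"
  then obtain f g where f: "\<And>n. f n \<in> S" "f \<longlonglongrightarrow> x" and g: "\<And>n. g n \<in> S" "g \<longlonglongrightarrow> y"
    unfolding closure_sequential by blast
  show "x + y \<in> closure S" unfolding closure_sequential
    by (rule exI[of _ "\<lambda>n. f n + g n"]) (simp add: tendsto_add f g subspace_add[OF S])
  show "c *\<^sub>R x \<in> closure S" unfolding closure_sequential
    by (rule exI[of _ "\<lambda>n. c *\<^sub>R f n"]) (simp add: tendsto_scaleR f subspace_scale[OF S])
qed

lemma subspace_kernel_span: "subspace (kernel_span :: 'n::finite cameron_martin set)"
  unfolding kernel_span_def by (intro subspace_closure subspace_span)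

lemma closed_kernel_span: "closed (kernel_span :: 'n::finite cameron_martin set)"
  by (simp add: kernel_span_def)

lemma cm_kernel_in_span:
  assumes t: "t \<in> {0..1}"
  shows "cm_kernel t i \<in> (kernel_span :: 'n::finite cameron_martin set)"
proof -
  have rational: "cm_kernel q j \<in> kernel_span" if "q \<in> \<rat>" "q \<in> {0..1}" for q and j :: 'n
    unfolding kernel_span_def using that
    by (intro subsetD[OF closure_subset] span_base) auto
  show ?thesis
  proof (cases "t = 0")
    case True
    then show ?thesis by (intro rational) auto
  next
    case False
    then have t0: "0 < t" "t \<le> 1" using t by auto
    show ?thesis
    proof (rule closed_approachable[THEN iffD1, OF closed_kernel_span], intro allI impI)
      fix e :: real assume "e > 0"
      \<comment> \<open>The squared distance of the kernels at q and t is t - q, hence q is sought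
        within e squared below t.\<close>
      then have "max 0 (t - e\<^sup>2) < t" using t0 by simp
      then obtain q where q: "q \<in> \<rat>" "max 0 (t - e\<^sup>2) < q" "q < t" using Rats_dense_in_real by blast
      then have mem: "q \<in> {0..1}" using t0 by auto
      have "(norm (cm_kernel q i - cm_kernel t i))\<^sup>2 = t - q"
        using q(3) by (simp add: power2_norm_eq_inner inner_diff_left inner_diff_right
            inner_cm_kernel_kernel[OF mem mem] inner_cm_kernel_kernel[OF mem t]
            inner_cm_kernel_kernel[OF t mem] inner_cm_kernel_kernel[OF t t])
      also have "\<dots> < e\<^sup>2" using q by simp
      finally have "norm (cm_kernel q i - cm_kernel t i) < e"
        using \<open>e > 0\<close> by (simp add: power_less_imp_less_base)
      then show "\<exists>y\<in>kernel_span. dist y (cm_kernel t i) < e"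
        using rational[OF q(1) mem] by (intro bexI[of _ "cm_kernel q i"]) (auto simp: dist_norm)
    qed
  qed
qed

text \<open>The squared distance in H is the integral of the squared difference of derivatives, to
  which dominated convergence applies.\<close>

lemma cm_of_tendsto:
  fixes g :: "real \<Rightarrow> real^'n::finite"
  assumes G: "\<And>k. G k \<in> L2_unit" and g: "g \<in> L2_unit" and D: "D \<in> L2_unit"
    and le: "\<And>k s. s \<in> {0..1} \<Longrightarrow> norm (G k s - g s) \<le> norm (D s)"
    and lim: "\<And>s. s \<in> {0..1} \<Longrightarrow> (\<lambda>k. G k s) \<longlonglongrightarrow> g s"
  shows "(\<lambda>k. cm_of (G k)) \<longlonglongrightarrow> cm_of g"
proof -
  have [measurable]: "G k \<in> borel_measurable borel" "g \<in> borel_measurable borel" "D \<in> borel_measurable borel" for k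
    using G g D by (auto intro: L2_unit_measurable)
  have "(\<lambda>k. LBINT s:{0..1}. (norm (G k s - g s))\<^sup>2) \<longlonglongrightarrow> integral\<^sup>L lborel (\<lambda>s::real. 0::real)"
    unfolding set_lebesgue_integral_def
  proof (rule integral_dominated_convergence)
    show "integrable lborel (\<lambda>s. indicator {0..1} s *\<^sub>R (norm (D s))\<^sup>2)"
      using D by (simp add: L2_unit_def set_integrable_def)
    show "AE s in lborel. (\<lambda>k. indicator {0..1} s *\<^sub>R (norm (G k s - g s))\<^sup>2) \<longlonglongrightarrow> 0"
    proof (rule AE_I2)
      fix s
      have "(\<lambda>k. (norm (G k s - g s))\<^sup>2) \<longlonglongrightarrow> 0" if "s \<in> {0..1}"
        using tendsto_power[OF tendsto_norm[OF tendsto_diff[OF lim[OF that] tendsto_const[of "g s"]]], of 2] by simp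
      then show "(\<lambda>k. indicator {0..1} s *\<^sub>R (norm (G k s - g s))\<^sup>2) \<longlonglongrightarrow> 0"
        by (cases "s \<in> {0..1}") (auto simp: indicator_def)
    qed
    show "AE s in lborel. norm (indicator {0..1} s *\<^sub>R (norm (G k s - g s))\<^sup>2) \<le> indicator {0..1} s *\<^sub>R (norm (D s))\<^sup>2" for k
      using le by (intro AE_I2) (auto simp: indicator_def intro!: power_mono)
  qed measurable
  moreover have "(LBINT s:{0..1}. (norm (G k s - g s))\<^sup>2) = (norm (cm_of (G k) - cm_of g))\<^sup>2" for k
    using cm_norm_primitive[OF L2_unit_diff[OF G g] cm_of[OF L2_unit_diff[OF G g]], of k]
    by (simp add: cm_of_diff[OF G g])
  ultimately have "(\<lambda>k. (norm (cm_of (G k) - cm_of g))\<^sup>2) \<longlonglongrightarrow> 0" by simp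
  then have "(\<lambda>k. sqrt ((norm (cm_of (G k) - cm_of g))\<^sup>2)) \<longlonglongrightarrow> sqrt 0" by (rule tendsto_real_sqrt)
  then have "(\<lambda>k. norm (cm_of (G k) - cm_of g)) \<longlonglongrightarrow> 0" by simp
  then show ?thesis using LIM_zero_iff tendsto_norm_zero_iff by blast
qed

lemma kernel_span_limit:
  fixes h :: "'n::finite cameron_martin"
  shows "(\<And>k. x k \<in> kernel_span) \<Longrightarrow> x \<longlonglongrightarrow> h \<Longrightarrow> h \<in> kernel_span"
  using closed_sequentially[OF closed_kernel_span] by blast

lemma cm_of_zero: "cm_of (\<lambda>_. 0) = 0"
  using cm_of_scaleR[OF L2_unit_zero, of 0] by simp

text \<open>The Borel sets A whose indicator is the derivative of an element of the closed span
  contain the half-lines, which give kernels, and are stable under complements and countable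
  disjoint unions. Closedness of the span is used for the infinite unions.\<close>

lemma cm_of_step_in_span:
  assumes "A \<in> sets borel"
  shows "cm_of (\<lambda>s. indicator A s *\<^sub>R axis i 1) \<in> (kernel_span :: 'n::finite cameron_martin set)"
proof -
  let ?u = "\<lambda>A s. indicator A s *\<^sub>R axis i (1::real) :: real^'n"
  note sub = subspace_add[OF subspace_kernel_span] subspace_diff[OF subspace_kernel_span]
    subspace_0[OF subspace_kernel_span]
  have atMost: "cm_of (?u {..t}) \<in> kernel_span" for t
  proof -
    consider "t < 0" | "t \<in> {0..1}" | "t > 1" by force
    then show ?thesis
    proof cases
      case 1
      then have "cm_of (?u {..t}) = cm_of (\<lambda>_. 0)"
        by (intro cm_of_cong L2_unit_step L2_unit_zero) auto
      then show ?thesis by (simp add: cm_of_zero sub)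
    next
      case 2
      then show ?thesis using cm_kernel_in_span[of t i] by (simp add: cm_kernel_def)
    next
      case 3
      then have "cm_of (?u {..t}) = cm_of (?u {..1})"
        by (intro cm_of_cong L2_unit_step) (auto simp: indicator_def)
      then show ?thesis using cm_kernel_in_span[of 1 i] by (simp add: cm_kernel_def)
    qed
  qed
  have borel_eq: "sets (borel :: real measure) = sigma_sets UNIV (range atMost)"
    by (subst borel_eq_atMost) simp
  have "Int_stable (range (atMost :: real \<Rightarrow> real set))" by (auto simp: Int_stable_def)
  moreover have "range (atMost :: real \<Rightarrow> real set) \<subseteq> Pow UNIV" by simp
  moreover have "A \<in> sigma_sets UNIV (range atMost)" using assms borel_eq by simp
  ultimately show ?thesis
  proof (induction rule: sigma_sets_induct_disjoint)
    case (basic A)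
    then show ?case using atMost by auto
  next
    case empty
    then show ?case by (simp add: cm_of_zero sub)
  next
    case (compl A)
    have A: "A \<in> sets borel" using compl borel_eq by simp
    \<comment> \<open>Only times in the unit interval matter, where the indicator of
      \<open>{..1}\<close> is constantly 1.\<close>
    have "cm_of (?u (UNIV - A)) = cm_of (\<lambda>s. ?u {..1} s - ?u A s)"
      using A by (intro cm_of_cong L2_unit_step L2_unit_diff) (auto simp: indicator_def)
    also have "\<dots> = cm_of (?u {..1}) - cm_of (?u A)"
      using A by (intro cm_of_diff L2_unit_step) auto
    finally show ?case using sub(2)[OF atMost compl(2)] by simp
  next
    case (union A)
    have A: "A k \<in> sets borel" for k using union(2) borel_eq by auto
    have fin: "cm_of (?u (\<Union>k<n. A k)) \<in> kernel_span" for n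
    proof (induction n)
      case (Suc n)
      have disj: "A n \<inter> (\<Union>k<n. A k) = {}"
      proof -
        have "A n \<inter> A k = {}" if "k < n" for k
          using union(1) that by (auto simp: disjoint_family_on_def)
        then show ?thesis by blast
      qed
      have "cm_of (?u (\<Union>k<Suc n. A k)) = cm_of (\<lambda>s. ?u (\<Union>k<n. A k) s + ?u (A n) s)"
        using A disj by (intro cm_of_cong L2_unit_step L2_unit_add) (auto simp: indicator_def lessThan_Suc)
      also have "\<dots> = cm_of (?u (\<Union>k<n. A k)) + cm_of (?u (A n))"
        using A by (intro cm_of_add L2_unit_step) auto
      finally show ?case using sub(1)[OF Suc union(3)] by simp
    qed (simp add: cm_of_zero sub)
    have "(\<lambda>n. cm_of (?u (\<Union>k<n. A k))) \<longlonglongrightarrow> cm_of (?u (\<Union>k. A k))"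
    proof (rule cm_of_tendsto)
      show "?u UNIV \<in> L2_unit" by (rule L2_unit_step) simp
      show "norm (?u (\<Union>k<n. A k) s - ?u (\<Union>k. A k) s) \<le> norm (?u UNIV s)" for n s
        by (auto simp: indicator_def)
      show "(\<lambda>n. ?u (\<Union>k<n. A k) s) \<longlonglongrightarrow> ?u (\<Union>k. A k) s" for s
        by (intro tendsto_scaleR LIMSEQ_indicator_UN tendsto_const)
    qed (use A in \<open>auto intro!: L2_unit_step\<close>)
    then show ?case by (rule kernel_span_limit[OF fin])
  qed
qed

text \<open>Induction on nonnegative measurable functions. Nonnegativity makes summands and
  approximants lie below the limit function, so they inherit square integrability from it.\<close>

lemma cm_of_axis_in_span:
  fixes u :: "real \<Rightarrow> real"
  assumes "u \<in> borel_measurable borel" "\<And>s. 0 \<le> u s"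
    and "(\<lambda>s. u s *\<^sub>R axis i 1) \<in> (L2_unit :: (real \<Rightarrow> real^'n::finite) set)"
  shows "cm_of (\<lambda>s. u s *\<^sub>R axis i 1) \<in> (kernel_span :: 'n cameron_martin set)"
  using assms
proof (induction rule: borel_measurable_induct_real)
  case (set A)
  then show ?case by (intro cm_of_step_in_span) auto
next
  case (mult u c)
  show ?case
  \<comment> \<open>For c = 0 the integrability of the product says nothing about u, so the
    induction hypothesis is not applicable.\<close>
  proof (cases "c = 0")
    case True
    then show ?thesis by (simp add: cm_of_zero subspace_0[OF subspace_kernel_span])
  next
    case False
    then have L: "(\<lambda>s. u s *\<^sub>R axis i 1) \<in> (L2_unit :: (real \<Rightarrow> real^'n) set)"
      using L2_unit_scaleR[OF mult.prems, of "1 / c"] by simp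
    then show ?thesis
      using subspace_scale[OF subspace_kernel_span mult.IH[OF L], of c] cm_of_scaleR[OF L, of c] by simp
  qed
next
  case (add u v)
  have "(\<lambda>s. u s *\<^sub>R axis i 1) \<in> (L2_unit :: (real \<Rightarrow> real^'n) set)"
    "(\<lambda>s. v s *\<^sub>R axis i 1) \<in> (L2_unit :: (real \<Rightarrow> real^'n) set)"
    using add.hyps add.prems by (auto intro!: L2_unit_dominated[OF add.prems])
  then show ?case
    using subspace_add[OF subspace_kernel_span, of "cm_of (\<lambda>s. v s *\<^sub>R axis i 1)" "cm_of (\<lambda>s. u s *\<^sub>R axis i 1)"]
      add.IH cm_of_add[of "\<lambda>s. v s *\<^sub>R axis i 1 :: real^'n" "\<lambda>s. u s *\<^sub>R axis i 1"]
    by (simp add: scaleR_add_left)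
next
  case (seq U)
  have le: "U k s \<le> u s" for k s
    using seq.hyps by (intro incseq_le[of "\<lambda>k. U k s"]) (auto simp: incseq_def le_fun_def)
  have L: "(\<lambda>s. U k s *\<^sub>R axis i 1) \<in> (L2_unit :: (real \<Rightarrow> real^'n) set)" for k
    using seq.hyps le by (intro L2_unit_dominated[OF seq.prems]) (auto intro: order_trans[OF _ abs_ge_self])
  have "(\<lambda>k. cm_of (\<lambda>s. U k s *\<^sub>R axis i 1)) \<longlonglongrightarrow> cm_of (\<lambda>s. u s *\<^sub>R (axis i 1 :: real^'n))"
  proof (rule cm_of_tendsto[OF L seq.prems seq.prems])
    fix k s
    have "norm (U k s *\<^sub>R (axis i 1 :: real^'n) - u s *\<^sub>R axis i 1) = \<bar>U k s - u s\<bar>"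
      by (simp flip: scaleR_diff_left)
    also have "\<dots> \<le> \<bar>u s\<bar>" using le[of k s] seq.hyps(2)[of k s] by linarith
    finally show "norm (U k s *\<^sub>R (axis i 1 :: real^'n) - u s *\<^sub>R axis i 1) \<le> norm (u s *\<^sub>R (axis i 1 :: real^'n))"
      by simp
    show "(\<lambda>k. U k s *\<^sub>R (axis i 1 :: real^'n)) \<longlonglongrightarrow> u s *\<^sub>R axis i 1"
      using seq.hyps by (intro tendsto_scaleR tendsto_const) auto
  qed
  then show ?case by (rule kernel_span_limit[OF seq.IH[OF L]])
qed

text \<open>Each derivative is the finite sum of the positive and negative parts of its components
  along the axes. Since the generating kernels have rational times, H obtains a countable dense set
  and a countable Hilbert basis.\<close>

lemma kernel_span_UNIV: "(kernel_span :: 'n::finite cameron_martin set) = UNIV"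
proof -
  have "h \<in> kernel_span" for h :: "'n cameron_martin"
  proof -
    define g where "g = cm_deriv h"
    have [measurable]: "g \<in> borel_measurable borel" and g: "g \<in> L2_unit"
      by (auto simp: g_def intro: cm_deriv)
    have [measurable]: "(\<lambda>s. g s $ i) \<in> borel_measurable borel" for i
      by (rule measurable_compose[of g borel borel]) (auto intro!: borel_measurable_continuous_onI continuous_on_component continuous_on_id)
    define p where "p i s = max 0 (g s $ i) *\<^sub>R (axis i 1 :: real^'n)" for i s
    define m where "m i s = max 0 (- (g s $ i)) *\<^sub>R (axis i 1 :: real^'n)" for i s
    have bound: "\<bar>g s $ i\<bar> \<le> norm (g s)" for i s by (rule component_le_norm_cart)
    have p: "p i \<in> L2_unit" and m: "m i \<in> L2_unit" for i
      unfolding p_def[abs_def] m_def[abs_def] using bound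
      by (auto intro!: L2_unit_dominated[OF g] simp: abs_le_iff max_def) 
    have in_span: "cm_of (p i) \<in> kernel_span" "cm_of (m i) \<in> kernel_span" for i
      using p[of i] m[of i] unfolding p_def[abs_def] m_def[abs_def]
      by (auto intro!: cm_of_axis_in_span)
    have "(\<lambda>s. \<Sum>i\<in>I. p i s - m i s) \<in> L2_unit \<and> cm_of (\<lambda>s. \<Sum>i\<in>I. p i s - m i s) \<in> kernel_span"
      if "finite I" for I
      using that
    proof (induction I rule: finite_induct)
      case empty
      then show ?case by (simp add: L2_unit_zero cm_of_zero subspace_0[OF subspace_kernel_span])
    next
      case (insert i I)
      then show ?case
        using L2_unit_add[OF L2_unit_diff[OF p m], of "\<lambda>s. \<Sum>i\<in>I. p i s - m i s" i i]
          cm_of_add[OF L2_unit_diff[OF p m], of "\<lambda>s. \<Sum>i\<in>I. p i s - m i s" i i]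
          cm_of_diff[OF p m, of i i] subspace_diff[OF subspace_kernel_span in_span, of i i]
          subspace_add[OF subspace_kernel_span, of "cm_of (p i) - cm_of (m i)" "cm_of (\<lambda>s. \<Sum>i\<in>I. p i s - m i s)"]
        by simp
    qed
    then have "cm_of (\<lambda>s. \<Sum>i\<in>UNIV. p i s - m i s) \<in> kernel_span" by simp
    moreover have "(\<Sum>i\<in>UNIV. p i s - m i s) = g s" for s
    proof -
      have "p i s - m i s = (g s $ i) *\<^sub>R axis i 1" for i
        by (auto simp: p_def m_def max_def simp flip: scaleR_diff_left)
      then show ?thesis using basis_expansion[of "g s"] by (simp add: scalar_mult_eq_scaleR)
    qed
    ultimately show ?thesis by (simp add: g_def cm_of_deriv)
  qed
  then show ?thesis by auto
qed

section \<open>Countable Hilbert bases and countable dense sets\<close>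

lemma orthonormal_extend:
  fixes Y :: "'a::real_inner set"
  assumes Y: "finite Y" "orthonormal Y"
  shows "\<exists>Y'. finite Y' \<and> orthonormal Y' \<and> Y \<subseteq> Y' \<and> z \<in> span Y'"
proof -
  define r where "r = z - (\<Sum>y\<in>Y. (z \<bullet> y) *\<^sub>R y)"
  have rY: "r \<bullet> x = 0" if x: "x \<in> Y" for x
  proof -
    have "(\<Sum>y\<in>Y. (z \<bullet> y) *\<^sub>R y) \<bullet> x = (\<Sum>y\<in>Y. if y = x then z \<bullet> x else 0)"
      unfolding inner_sum_left
      by (intro sum.cong refl) (simp add: orthonormal_inner[OF Y(2) _ x])
    also have "\<dots> = z \<bullet> x" using Y(1) x by simp
    finally show ?thesis by (simp add: r_def inner_diff_left)
  qed
  have P: "(\<Sum>y\<in>Y. (z \<bullet> y) *\<^sub>R y) \<in> span Y" by (intro span_sum span_scale span_base)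
  show ?thesis
  proof (cases "r = 0")
    case True
    then show ?thesis using Y P by (intro exI[of _ Y]) (simp add: r_def)
  next
    case False
    have "orthonormal (insert (sgn r) Y)"
      using Y(2) rY False
      by (auto simp: orthonormal_def pairwise_insert orthogonal_def sgn_div_norm inner_commute)
    moreover have "z \<in> span (insert (sgn r) Y)"
    proof -
      have "norm r *\<^sub>R sgn r \<in> span (insert (sgn r) Y)" by (intro span_scale span_base) simp
      moreover have "norm r *\<^sub>R sgn r = r" using False by (simp add: sgn_div_norm)
      moreover have "(\<Sum>y\<in>Y. (z \<bullet> y) *\<^sub>R y) \<in> span (insert (sgn r) Y)"
        using P span_mono[of Y "insert (sgn r) Y"] by auto
      ultimately show ?thesis using span_add[of r _ "\<Sum>y\<in>Y. (z \<bullet> y) *\<^sub>R y"] by (simp add: r_def)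
    qed
    ultimately show ?thesis using Y(1) by (intro exI[of _ "insert (sgn r) Y"]) auto
  qed
qed

text \<open>Gram-Schmidt along an enumeration: the finite orthonormal sets increase, and the step
  with index n brings the n-th vector into the span.\<close>

lemma countable_hilbert_basis_exists:
  fixes S :: "'a::real_inner set"
  assumes S: "countable S" "closure (span S) = UNIV"
  obtains B :: "'a set" where "countable B" "hilbert_basis B"
proof -
  obtain d :: "nat \<Rightarrow> 'a" where d: "S \<subseteq> range d"
  proof (cases "S = {}")
    case False
    then show ?thesis using that[of "from_nat_into S"] S(1) by (auto simp: range_from_nat_into)
  qed auto
  have "\<exists>Y. \<forall>n. (finite (Y n) \<and> orthonormal (Y n)) \<and> (Y n \<subseteq> Y (Suc n) \<and> d n \<in> span (Y (Suc n)))"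
  proof (rule dependent_nat_choice)
    show "\<exists>Y :: 'a set. finite Y \<and> orthonormal Y"
      by (intro exI[of _ "{}"]) (simp add: orthonormal_def)
    show "\<exists>Y'. (finite Y' \<and> orthonormal Y') \<and> Y \<subseteq> Y' \<and> d n \<in> span Y'"
      if "finite Y \<and> orthonormal Y" for Y n
      using orthonormal_extend[of Y "d n"] that by blast
  qed
  then obtain Y where Y: "\<And>n. finite (Y n)" "\<And>n. orthonormal (Y n)" "\<And>n. Y n \<subseteq> Y (Suc n)"
    "\<And>n. d n \<in> span (Y (Suc n))" by blast
  define B where "B = (\<Union>n. Y n)"
  have mono: "m \<le> n \<Longrightarrow> Y m \<subseteq> Y n" for m n using Y(3) by (rule lift_Suc_mono_le)
  have "countable B" unfolding B_def using Y(1) by (auto intro: countable_finite)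
  moreover have "hilbert_basis B"
    unfolding hilbert_basis_def
  proof
    show "orthonormal B"
      unfolding orthonormal_def pairwise_def
    proof (intro conjI ballI impI)
      fix x y assume "x \<in> B" "y \<in> B" "x \<noteq> y"
      then obtain m n where "x \<in> Y m" "y \<in> Y n" by (auto simp: B_def)
      then have "x \<in> Y (max m n)" "y \<in> Y (max m n)" using mono[of m "max m n"] mono[of n "max m n"] by auto
      then show "orthogonal x y" using Y(2)[of "max m n"] \<open>x \<noteq> y\<close> by (auto simp: orthonormal_def pairwise_def)
    next
      fix x assume "x \<in> B"
      then show "norm x = 1" using Y(2) by (auto simp: B_def orthonormal_def)
    qed
    have "S \<subseteq> span B"
    proof
      fix x assume "x \<in> S"
      then obtain n where "x = d n" using d by auto
      then show "x \<in> span B" using Y(4)[of n] span_mono[of "Y (Suc n)" B] by (auto simp: B_def)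
    qed
    then have "span S \<subseteq> span B" by (rule span_minimal) simp
    then show "closure (span B) = UNIV" using closure_mono[of "span S" "span B"] S(2) by auto
  qed
  ultimately show ?thesis by (rule that)
qed

text \<open>Rational combinations are coded by lists of pairs, so that addition is concatenation and
  rational scaling is a map over the list. The closure of these combinations is a real subspace
  because rationals approximate real factors.\<close>

lemma countable_dense_if_span_dense:
  fixes S :: "'a::real_normed_vector set"
  assumes S: "countable S" "closure (span S) = UNIV"
  obtains Q :: "'a set" where "countable Q" "closure Q = UNIV"
proof -
  define \<sigma> where "\<sigma> l = (\<Sum>(r, s)\<leftarrow>l. real_of_rat r *\<^sub>R (s::'a))" for l
  define Q where "Q = \<sigma> ` lists (UNIV \<times> S)"
  have "countable Q" unfolding Q_def using S(1) by (intro countable_image countable_lists countable_SIGMA) auto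
  have add: "x + y \<in> Q" if "x \<in> Q" "y \<in> Q" for x y
  proof -
    obtain l m where "l \<in> lists (UNIV \<times> S)" "m \<in> lists (UNIV \<times> S)" "x = \<sigma> l" "y = \<sigma> m"
      using \<open>x \<in> Q\<close> \<open>y \<in> Q\<close> by (auto simp: Q_def)
    then show ?thesis unfolding Q_def by (intro image_eqI[of _ _ "l @ m"]) (auto simp: \<sigma>_def)
  qed
  have scale: "real_of_rat r *\<^sub>R x \<in> Q" if "x \<in> Q" for r x
  proof -
    obtain l where l: "l \<in> lists (UNIV \<times> S)" "x = \<sigma> l" using \<open>x \<in> Q\<close> by (auto simp: Q_def)
    have "real_of_rat r *\<^sub>R \<sigma> l = \<sigma> (map (\<lambda>(q, s). (r * q, s)) l)" for l
      by (induction l) (auto simp: \<sigma>_def scaleR_add_right of_rat_mult)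
    then show ?thesis unfolding Q_def using l
      by (intro image_eqI[of _ _ "map (\<lambda>(q, s). (r * q, s)) l"]) auto
  qed
  have "S \<subseteq> Q"
  proof
    fix s assume "s \<in> S"
    then show "s \<in> Q" unfolding Q_def by (intro image_eqI[of _ _ "[(1, s)]"]) (auto simp: \<sigma>_def)
  qed
  have "subspace (closure Q)"
  proof (rule subspaceI)
    have "\<sigma> [] \<in> Q" unfolding Q_def by (rule imageI) simp
    then have "0 \<in> Q" by (simp add: \<sigma>_def)
    then show "0 \<in> closure Q" using closure_subset by blast
    fix x y :: 'a and c :: real assume "x \<in> closure Q" "y \<in> closure Q"
    then obtain f g where f: "\<And>n. f n \<in> Q" "f \<longlonglongrightarrow> x" and g: "\<And>n. g n \<in> Q" "g \<longlonglongrightarrow> y"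
      unfolding closure_sequential by blast
    show "x + y \<in> closure Q" unfolding closure_sequential
      by (rule exI[of _ "\<lambda>n. f n + g n"]) (simp add: tendsto_add f g add)
    have "c \<in> closure (range real_of_rat)"
      using Rats_closure_real by (simp add: Rats_def)
    then obtain r where r: "\<And>n. r n \<in> range real_of_rat" "r \<longlonglongrightarrow> c" unfolding closure_sequential by blast
    have rf: "r n *\<^sub>R f n \<in> Q" for n using r(1)[of n] scale[OF f(1)] by auto
    show "c *\<^sub>R x \<in> closure Q" unfolding closure_sequential
      by (rule exI[of _ "\<lambda>n. r n *\<^sub>R f n"]) (simp add: tendsto_scaleR f r rf)
  qed
  then have "span S \<subseteq> closure Q"
    using \<open>S \<subseteq> Q\<close> closure_subset by (intro span_minimal) auto
  then have "closure (span S) \<subseteq> closure Q" by (rule closure_minimal) simp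
  then have "closure Q = UNIV" using S(2) by auto
  with \<open>countable Q\<close> show ?thesis by (rule that)
qed

lemma countable_kernels: "countable ((\<lambda>(t, i). cm_kernel t i :: 'n::finite cameron_martin) ` ((\<rat> \<inter> {0..1}) \<times> UNIV))"
  by (intro countable_image countable_SIGMA) (auto simp: countable_rat countable_Int1)

lemma cameron_martin_basis: obtains B :: "'n::finite cameron_martin set" where "countable B" "hilbert_basis B"
  using countable_hilbert_basis_exists[OF countable_kernels kernel_span_UNIV[unfolded kernel_span_def]] by blast

lemma cameron_martin_dense: obtains Q :: "'n::finite cameron_martin set" where "countable Q" "closure Q = UNIV"
  using countable_dense_if_span_dense[OF countable_kernels kernel_span_UNIV[unfolded kernel_span_def]] by blast

section \<open>Measurability of operator-valued functions\<close>

lemma bounded_linear_hs_eval: "bounded_linear (\<lambda>T. hs_apply T h)"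
  by (rule bounded_linear_intro[where K = "norm h"]) (simp_all add: norm_hs_apply_le)

lemma measurable_hs_apply:
  assumes "S \<in> borel_measurable M"
  shows "(\<lambda>w. hs_apply (S w) h) \<in> borel_measurable M"
  by (rule measurable_compose[OF assms borel_measurable_continuous_onI[OF linear_continuous_on[OF bounded_linear_hs_eval]]])

lemma sets_Collect_countable_ball:
  assumes "countable I" and m: "\<And>i. i \<in> I \<Longrightarrow> {w \<in> space M. P i w} \<in> sets M"
  shows "{w \<in> space M. \<forall>i\<in>I. P i w} \<in> sets M"
proof (cases "I = {}")
  case False
  then have "{w \<in> space M. \<forall>i\<in>I. P i w} = (\<Inter>i\<in>I. {w \<in> space M. P i w})" by auto
  also have "\<dots> \<in> sets M" using m False by (intro sets.countable_INT' assms(1)) auto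
  finally show ?thesis .
qed simp

text \<open>The operator space carries no second countability here, so measurability of a difference
  cannot be deduced from that of S and T. The norm of the difference is instead described by
  countably many conditions: one bound on a sum of evaluations for every finite subset of a
  countable Hilbert basis of H.\<close>

lemma measurable_hs_norm_diff:
  fixes S T :: "'w \<Rightarrow> ('n::finite cameron_martin, 'x::{real_inner, second_countable_topology}) hilbert_schmidt"
  assumes S: "S \<in> borel_measurable M" and T: "T \<in> borel_measurable M"
  shows "(\<lambda>w. norm (S w - T w)) \<in> borel_measurable M"
proof -
  obtain B :: "'n cameron_martin set" where B: "countable B" "hilbert_basis B" by (rule cameron_martin_basis)
  have [measurable]: "(\<lambda>w. hs_apply (S w - T w) e) \<in> borel_measurable M" for e
    unfolding hs_apply_simps by (intro borel_measurable_diff measurable_hs_apply S T)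
  show ?thesis
    unfolding borel_measurable_iff_le
  proof
    fix c :: real
    show "{w \<in> space M. norm (S w - T w) \<le> c} \<in> sets M"
    proof (cases "c \<ge> 0")
      case True
      have iff: "norm R \<le> c \<longleftrightarrow> (\<forall>F\<in>{F. finite F \<and> F \<subseteq> B}. (\<Sum>e\<in>F. (norm (hs_apply R e))\<^sup>2) \<le> c\<^sup>2)"
        for R :: "('n cameron_martin, 'x) hilbert_schmidt"
      proof -
        have hs: "((\<lambda>e. (norm (hs_apply R e))\<^sup>2) has_sum (norm R)\<^sup>2) B"
          by (rule hs_norm_hilbert_basis[OF B(2)])
        have "norm R \<le> c \<longleftrightarrow> (norm R)\<^sup>2 \<le> c\<^sup>2" using True by (simp add: power_mono_iff)
        also have "\<dots> \<longleftrightarrow> (\<forall>F\<in>{F. finite F \<and> F \<subseteq> B}. (\<Sum>e\<in>F. (norm (hs_apply R e))\<^sup>2) \<le> c\<^sup>2)"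
        proof safe
          fix F assume F: "finite F" "F \<subseteq> B" and "(norm R)\<^sup>2 \<le> c\<^sup>2"
          have "(\<Sum>e\<in>F. (norm (hs_apply R e))\<^sup>2) \<le> (\<Sum>\<^sub>\<infinity>e\<in>B. (norm (hs_apply R e))\<^sup>2)"
            using has_sum_imp_summable[OF hs] F by (intro finite_sum_le_infsum) auto
          also have "\<dots> = (norm R)\<^sup>2" using hs by (rule infsumI)
          finally show "(\<Sum>e\<in>F. (norm (hs_apply R e))\<^sup>2) \<le> c\<^sup>2" using \<open>(norm R)\<^sup>2 \<le> c\<^sup>2\<close> by simp
        next
          assume *: "\<forall>F\<in>{F. finite F \<and> F \<subseteq> B}. (\<Sum>e\<in>F. (norm (hs_apply R e))\<^sup>2) \<le> c\<^sup>2"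
          have "(\<Sum>\<^sub>\<infinity>e\<in>B. (norm (hs_apply R e))\<^sup>2) \<le> c\<^sup>2"
            using * by (intro infsum_le_finite_sums has_sum_imp_summable[OF hs]) auto
          then show "(norm R)\<^sup>2 \<le> c\<^sup>2" using infsumI[OF hs] by simp
        qed
        finally show ?thesis .
      qed
      have "countable {F. finite F \<and> F \<subseteq> B}"
        using B(1) by (rule countable_Collect_finite_subset)
      then have "{w \<in> space M. \<forall>F\<in>{F. finite F \<and> F \<subseteq> B}. (\<Sum>e\<in>F. (norm (hs_apply (S w - T w) e))\<^sup>2) \<le> c\<^sup>2} \<in> sets M"
        by (rule sets_Collect_countable_ball) measurable
      then show ?thesis by (simp only: iff)
    next
      case False
      then have "{w \<in> space M. norm (S w - T w) \<le> c} = {}"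
        using norm_ge_zero order_trans by blast
      then show ?thesis by (simp only: sets.empty_sets)
    qed
  qed
qed

section \<open>Cameron-Martin bounds\<close>

text \<open>The one-dimensional Cameron-Martin formula, by completing the square;
  \<open>2 ^ n\<close> is the inverse variance. The point mass at index 0 admits only the trivial
  shift.\<close>

lemma incr_law_shift:
  assumes [measurable]: "\<phi> \<in> borel_measurable borel" and d: "fst a = 0 \<Longrightarrow> d = 0"
  shows "(\<integral>\<^sup>+x. \<phi> (x + d) \<partial>incr_law n a) =
    (\<integral>\<^sup>+x. ennreal (exp ((d * x - d\<^sup>2 / 2) * 2 ^ n)) * \<phi> x \<partial>incr_law n a)"
proof (cases "fst a = 0")
  case True
  then show ?thesis using d by simp
next
  case False
  let ?n = "normal_density 0 (sqrt (1 / 2 ^ n))"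
  have nd: "?n (x - d) = ?n x * exp ((d * x - d\<^sup>2 / 2) * 2 ^ n)" for x
  proof -
    have "- ((x - d)\<^sup>2 / (2 * (1 / 2 ^ n))) = - (x\<^sup>2 / (2 * (1 / 2 ^ n))) + (d * x - d\<^sup>2 / 2) * 2 ^ n"
      by (simp add: power2_eq_square field_simps)
    then show ?thesis by (simp add: normal_density_def mult_exp_exp)
  qed
  have "(\<integral>\<^sup>+x. \<phi> (x + d) \<partial>incr_law n a) = (\<integral>\<^sup>+x. ennreal (?n x) * \<phi> (x + d) \<partial>lborel)"
    using False by (simp add: incr_law_def nn_integral_density)
  also have "\<dots> = (\<integral>\<^sup>+x. ennreal (?n (x - d)) * \<phi> x \<partial>lborel)"
    by (subst nn_integral_real_affine[where c = 1 and t = d]) (simp_all add: add.commute)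
  also have "\<dots> = (\<integral>\<^sup>+x. ennreal (?n x) * (ennreal (exp ((d * x - d\<^sup>2 / 2) * 2 ^ n)) * \<phi> x) \<partial>lborel)"
    by (simp add: nd ennreal_mult mult.assoc)
  also have "\<dots> = (\<integral>\<^sup>+x. ennreal (exp ((d * x - d\<^sup>2 / 2) * 2 ^ n)) * \<phi> x \<partial>incr_law n a)"
    using False by (simp add: incr_law_def nn_integral_density)
  finally show ?thesis .
qed

text \<open>The Cameron-Martin density of the translation by h, restricted to the increments of
  level n.\<close>

definition shift_density :: "nat \<Rightarrow> 'n::finite cameron_martin \<Rightarrow> (nat \<times> 'n \<Rightarrow> real) \<Rightarrow> real" where
  "shift_density n h x = exp (\<Sum>a\<in>dyadic_index n.
     (dyadic_incr n (cm_path h) a * x a - (dyadic_incr n (cm_path h) a)\<^sup>2 / 2) * 2 ^ n)"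

lemma measurable_shift_density [measurable]:
  "shift_density n h \<in> borel_measurable (dyadic_space n)"
  unfolding shift_density_def[abs_def]
  by (intro borel_measurable_exp[THEN measurable_compose[rotated]] borel_measurable_sum borel_measurable_times
      borel_measurable_diff borel_measurable_const measurable_component_singleton)

text \<open>A translation by h moves the independent increments by deterministic amounts, so the
  density of the joint law is the product of the one-dimensional ones.\<close>

lemma distr_shifted_incr:
  fixes \<mu> :: "'n::finite wiener measure"
  assumes \<mu>: "wiener_measure \<mu>"
  shows "distr \<mu> (dyadic_space n) (\<lambda>w. dyadic_incr n (w + cm_path h)) =
    density (Pi\<^sub>M (dyadic_index n) (incr_law n)) (\<lambda>x. ennreal (shift_density n h x))"
proof -
  let ?J = "dyadic_index n :: (nat \<times> 'n) set"
  interpret prob_space \<mu> using \<mu> by (simp add: wiener_measure_def)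
  have [measurable_cong]: "sets \<mu> = sets borel" using \<mu> by (simp add: wiener_measure_def)
  interpret I: product_sigma_finite "incr_law n :: nat \<times> 'n \<Rightarrow> real measure"
    by (rule product_sigma_finite_incr_law)
  define \<delta> where "\<delta> = dyadic_incr n (cm_path h)"
  have \<delta>0: "\<delta> a = 0" if "fst a = 0" for a
    using that cm_path_zero[of h] by (auto simp: \<delta>_def dyadic_incr_def dyadic_def restrict_def split: prod.splits)
  define \<rho> where "\<rho> a x = ennreal (exp ((\<delta> a * x - (\<delta> a)\<^sup>2 / 2) * 2 ^ n))" for a x
  have \<rho> [measurable]: "\<rho> a \<in> borel_measurable borel" for a unfolding \<rho>_def[abs_def] by measurable
  \<comment> \<open>\<open>N a\<close> is the law of one shifted increment; it has total mass 1 by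
    the shift formula for the constant 1. The product of the \<open>N a\<close> is identified on
    boxes twice, with the law of the shifted increments and with the product density.\<close>
  define N where "N a = density (incr_law n a) (\<rho> a)" for a
  have shift: "(\<integral>\<^sup>+x. \<phi> (x + \<delta> a) \<partial>incr_law n a) = (\<integral>\<^sup>+x. \<rho> a x * \<phi> x \<partial>incr_law n a)"
    if "\<phi> \<in> borel_measurable borel" for \<phi> a
    unfolding \<rho>_def using that \<delta>0 by (rule incr_law_shift)
  have setsN: "sets (N a) = sets borel" for a by (simp add: N_def)
  have "prob_space (N a)" for a
  proof
    interpret A: prob_space "incr_law n a" by (rule prob_space_incr_law)
    show "emeasure (N a) (space (N a)) = 1"
      using shift[of "\<lambda>_. 1" a] A.emeasure_space_1 by (simp add: N_def emeasure_density)
  qed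
  then have N: "product_sigma_finite N"
    unfolding product_sigma_finite_def by (auto intro: prob_space_imp_sigma_finite)
  then interpret N: product_sigma_finite N .
  have "distr \<mu> (dyadic_space n) (\<lambda>w. dyadic_incr n (w + cm_path h)) = Pi\<^sub>M ?J N"
  proof (rule distr_dyadic_incr_eqI[OF _ _ N setsN])
    fix A :: "nat \<times> 'n \<Rightarrow> real set" assume [measurable]: "\<And>a. A a \<in> sets borel"
    have "(\<integral>\<^sup>+w. (\<Prod>a\<in>?J. indicator (A a) (dyadic_incr n (w + cm_path h) a)) \<partial>\<mu>) =
        (\<integral>\<^sup>+w. (\<Prod>a\<in>?J. indicator (A a) (dyadic_incr n w a + \<delta> a)) \<partial>\<mu>)"
      by (intro nn_integral_cong prod.cong refl) (simp add: dyadic_incr_linear \<delta>_def)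
    also have "\<dots> = (\<Prod>a\<in>?J. \<integral>\<^sup>+x. indicator (A a) (x + \<delta> a) \<partial>incr_law n a)"
      by (rule wiener_nn_integral_incr[OF \<mu>]) measurable
    also have "\<dots> = (\<Prod>a\<in>?J. emeasure (N a) (A a))"
      by (intro prod.cong refl, subst shift) (simp_all add: N_def emeasure_density)
    finally show "(\<integral>\<^sup>+w. (\<Prod>a\<in>?J. indicator (A a) (dyadic_incr n (w + cm_path h) a)) \<partial>\<mu>) =
        (\<Prod>a\<in>?J. emeasure (N a) (A a))" .
  qed (use \<mu> in \<open>auto simp: wiener_measure_def\<close>)
  also have "\<dots> = density (Pi\<^sub>M ?J (incr_law n)) (\<lambda>x. \<Prod>a\<in>?J. \<rho> a (x a))"
  proof (rule N.PiM_eqI[symmetric])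
    show "sets (density (Pi\<^sub>M ?J (incr_law n)) (\<lambda>x. \<Prod>a\<in>?J. \<rho> a (x a))) = sets (Pi\<^sub>M ?J N)"
      by (simp add: setsN cong: sets_PiM_cong)
    fix A assume A: "\<And>a. a \<in> ?J \<Longrightarrow> A a \<in> sets (N a)"
    then have A': "A a \<in> sets borel" if "a \<in> ?J" for a using that by (simp add: setsN)
    have "Pi\<^sub>E ?J A \<in> sets (Pi\<^sub>M ?J (incr_law n))" using A' by (intro sets_PiM_I_finite) auto
    then have "emeasure (density (Pi\<^sub>M ?J (incr_law n)) (\<lambda>x. \<Prod>a\<in>?J. \<rho> a (x a))) (Pi\<^sub>E ?J A) =
        (\<integral>\<^sup>+x. (\<Prod>a\<in>?J. \<rho> a (x a)) * indicator (Pi\<^sub>E ?J A) x \<partial>Pi\<^sub>M ?J (incr_law n))"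
      by (intro emeasure_density) auto
    also have "\<dots> = (\<integral>\<^sup>+x. (\<Prod>a\<in>?J. \<rho> a (x a) * indicator (A a) (x a)) \<partial>Pi\<^sub>M ?J (incr_law n))"
    proof (rule nn_integral_cong)
      fix x assume x: "x \<in> space (Pi\<^sub>M ?J (incr_law n))"
      have "(\<Prod>a\<in>?J. indicator (A a) (x a)) = (indicator (Pi\<^sub>E ?J A) x :: ennreal)"
      proof (cases "\<forall>a\<in>?J. x a \<in> A a")
        case True
        then have "x \<in> Pi\<^sub>E ?J A" using x by (auto simp: space_PiM PiE_def)
        then show ?thesis using True by (subst prod.neutral) auto
      next
        case False
        then have "x \<notin> Pi\<^sub>E ?J A" by auto
        then show ?thesis using False by (subst prod_zero) (auto simp: indicator_def)
      qed
      then show "(\<Prod>a\<in>?J. \<rho> a (x a)) * indicator (Pi\<^sub>E ?J A) x = (\<Prod>a\<in>?J. \<rho> a (x a) * indicator (A a) (x a))"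
        by (simp only: prod.distrib)
    qed
    also have "\<dots> = (\<Prod>a\<in>?J. \<integral>\<^sup>+y. \<rho> a y * indicator (A a) y \<partial>incr_law n a)"
      using A' by (intro I.product_nn_integral_prod) auto
    also have "\<dots> = (\<Prod>a\<in>?J. emeasure (N a) (A a))"
      using A' by (intro prod.cong refl) (simp add: N_def emeasure_density)
    finally show "emeasure (density (Pi\<^sub>M ?J (incr_law n)) (\<lambda>x. \<Prod>a\<in>?J. \<rho> a (x a))) (Pi\<^sub>E ?J A) =
        (\<Prod>a\<in>?J. emeasure (N a) (A a))" .
  qed simp
  also have "(\<lambda>x. \<Prod>a\<in>?J. \<rho> a (x a)) = (\<lambda>x. ennreal (shift_density n h x))"
    by (simp add: \<rho>_def \<delta>_def shift_density_def exp_sum prod_ennreal)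
  finally show ?thesis .
qed

text \<open>In the logarithm, raising to the power q and replacing h by q h have the same effect on
  the linear part. The quadratic parts differ by (q^2 - q)/2 times the dyadic energy of h, which
  \<open>cm_energy_le\<close> bounds independently of n.\<close>

lemma shift_density_powr_le:
  fixes h :: "'n::finite cameron_martin"
  assumes q: "q \<ge> 1" and h: "norm h \<le> R"
  shows "shift_density n h x powr q \<le> exp ((q\<^sup>2 - q) * R\<^sup>2 / 2) * shift_density n (q *\<^sub>R h) x"
proof -
  let ?J = "dyadic_index n :: (nat \<times> 'n) set"
  define \<delta> where "\<delta> = dyadic_incr n (cm_path h)"
  define S where "S = (\<Sum>a\<in>?J. (\<delta> a)\<^sup>2)"
  define Z where "Z = (\<Sum>a\<in>?J. \<delta> a * x a)"
  have sd: "shift_density n h x = exp (2 ^ n * Z - 2 ^ n * S / 2)"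
    by (simp add: shift_density_def \<delta>_def[symmetric] Z_def S_def sum_subtractf
        sum_distrib_left sum_distrib_right sum_divide_distrib algebra_simps)
  have "dyadic_incr n (cm_path (q *\<^sub>R h)) a = q * \<delta> a" if "a \<in> ?J" for a
    using that by (simp add: dyadic_incr_linear \<delta>_def)
  then have "shift_density n (q *\<^sub>R h) x = exp (\<Sum>a\<in>?J. (q * \<delta> a * x a - (q * \<delta> a)\<^sup>2 / 2) * 2 ^ n)"
    by (simp add: shift_density_def)
  also have "(\<Sum>a\<in>?J. (q * \<delta> a * x a - (q * \<delta> a)\<^sup>2 / 2) * 2 ^ n) = q * 2 ^ n * Z - q\<^sup>2 * 2 ^ n * S / 2"
    by (simp add: Z_def S_def sum_subtractf
        sum_distrib_left sum_distrib_right sum_divide_distrib algebra_simps power_mult_distrib)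
  finally have sdq: "shift_density n (q *\<^sub>R h) x = exp (q * 2 ^ n * Z - q\<^sup>2 * 2 ^ n * S / 2)" .
  have "2 ^ n * S \<le> (norm h)\<^sup>2" using cm_energy_le[of n h] by (simp add: S_def \<delta>_def)
  also have "\<dots> \<le> R\<^sup>2" using h by (intro power_mono) auto
  finally have "(q\<^sup>2 - q) * (2 ^ n * S) \<le> (q\<^sup>2 - q) * R\<^sup>2"
    using q by (intro mult_left_mono) (auto simp: power2_eq_square)
  moreover have "q * (2 ^ n * Z - 2 ^ n * S / 2) = (q\<^sup>2 - q) * (2 ^ n * S) / 2 + (q * 2 ^ n * Z - q\<^sup>2 * 2 ^ n * S / 2)"
    by (simp add: field_simps)
  ultimately have "q * (2 ^ n * Z - 2 ^ n * S / 2) \<le> (q\<^sup>2 - q) * R\<^sup>2 / 2 + (q * 2 ^ n * Z - q\<^sup>2 * 2 ^ n * S / 2)"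
    by simp
  then show ?thesis unfolding sd sdq exp_add[symmetric] by (simp add: powr_def)
qed

text \<open>Young's inequality with a weight K and without optimal constants: depending on how L
  compares with \<open>K * x powr (p - 1)\<close>, a single term on the right already
  suffices.\<close>

lemma young_powr:
  fixes x L K p :: real
  assumes p: "p > 1" and x: "x \<ge> 0" and L: "L > 0" and K: "K > 0"
  shows "x * L \<le> K * x powr p + K powr (- 1 / (p - 1)) * L powr (p / (p - 1))"
proof (cases "L \<le> K * x powr (p - 1)")
  case True
  have "x * L \<le> x * (K * x powr (p - 1))" using True x by (rule mult_left_mono)
  also have "\<dots> = K * x powr p" using x by (cases "x = 0") (auto simp: powr_diff)
  finally show ?thesis using L K by (simp add: add_increasing2)
next
  case False
  have "x = (x powr (p - 1)) powr (1 / (p - 1))" using p x by (simp add: powr_powr)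
  also have "\<dots> \<le> (L / K) powr (1 / (p - 1))"
    using False K p by (intro powr_mono2) (auto simp: field_simps)
  finally have "x * L \<le> (L / K) powr (1 / (p - 1)) * L" using L by (intro mult_right_mono) auto
  also have "\<dots> = K powr (- 1 / (p - 1)) * (L powr (1 / (p - 1)) * L powr 1)"
    using L K by (simp add: powr_divide powr_minus_divide)
  also have "L powr (1 / (p - 1)) * L powr 1 = L powr (p / (p - 1))"
    unfolding powr_add[symmetric] using p by (simp add: field_simps)
  finally show ?thesis using x K by (simp add: add_increasing)
qed

text \<open>
  Young's inequality for the density of the shifted law: the power of exponent \<open>q\<close> of the density for \<open>h\<close>
  is a bounded multiple of the density for \<open>q *\<^sub>R h\<close>, so that the bound compares three measures
  and extends from cylinder sets to all Borel sets.
\<close>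

lemma shifted_measure_bound:
  fixes \<mu> :: "'n::finite wiener measure" and h :: "'n cameron_martin"
  assumes \<mu>: "wiener_measure \<mu>" and p: "p > 1" and K: "K > 0" and h: "norm h \<le> R" and x: "x \<ge> 0"
    and A: "A \<in> sets borel"
  defines "q \<equiv> p / (p - 1)"
  shows "x * measure (distr \<mu> borel (\<lambda>w. w + cm_path h)) A \<le>
     K * x powr p * measure \<mu> A +
     K powr (- 1 / (p - 1)) * exp ((q\<^sup>2 - q) * R\<^sup>2 / 2) * measure (distr \<mu> borel (\<lambda>w. w + cm_path (q *\<^sub>R h))) A"
proof -
  interpret prob_space \<mu> using \<mu> by (simp add: wiener_measure_def)
  have [measurable_cong]: "sets \<mu> = sets borel" using \<mu> by (simp add: wiener_measure_def)
  let ?T = "\<lambda>h. distr \<mu> borel (\<lambda>w. w + cm_path h)"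
  define d where "d = K powr (- 1 / (p - 1)) * exp ((q\<^sup>2 - q) * R\<^sup>2 / 2)"
  have d0: "d \<ge> 0" by (simp add: d_def)
  have prob_T: "prob_space (?T h)" for h by (rule prob_space_distr) measurable
  then have fin: "finite_measure (?T h)" for h by (rule prob_space.finite_measure)
  have q: "q \<ge> 1" using p by (simp add: q_def field_simps)
  show ?thesis unfolding d_def[symmetric]
  proof (rule measure_inequality_from_algebra[OF fin finite_measure_axioms fin algebra_cylinder_sets])
    fix B' :: "'n wiener set" assume "B' \<in> cylinder_sets"
    then obtain n B where B': "B' = dyadic_values n -` B" and B: "B \<in> sets (dyadic_space n)"
      by (auto simp: cylinder_sets_def)
    let ?J = "dyadic_index n :: (nat \<times> 'n) set"
    let ?P = "Pi\<^sub>M ?J (incr_law n)"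
    define C where "C = cumulate n -` B \<inter> space (dyadic_space n)"
    have C: "C \<in> sets (dyadic_space n)" unfolding C_def using B by (rule measurable_sets[OF measurable_cumulate])
    have setsP [measurable_cong]: "sets ?P = sets (dyadic_space n)" by (simp cong: sets_PiM_cong)
    have [measurable]: "C \<in> sets ?P" using C setsP by simp
    have T: "emeasure (?T h) B' = (\<integral>\<^sup>+y. ennreal (shift_density n h y) * indicator C y \<partial>?P)" for h
    proof -
      have "emeasure (?T h) B' = emeasure (distr (?T h) (dyadic_space n) (dyadic_incr n)) C"
        unfolding B' C_def by (rule emeasure_cylinder) (simp_all add: B)
      also have "distr (?T h) (dyadic_space n) (dyadic_incr n) =
          distr \<mu> (dyadic_space n) (\<lambda>w. dyadic_incr n (w + cm_path h))"
        by (subst distr_distr) (auto simp: comp_def)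
      also have "\<dots> = density ?P (\<lambda>x. ennreal (shift_density n h x))" by (rule distr_shifted_incr[OF \<mu>])
      also have "emeasure \<dots> C = (\<integral>\<^sup>+y. ennreal (shift_density n h y) * indicator C y \<partial>?P)"
        by (rule emeasure_density) measurable
      finally show ?thesis .
    qed
    have M: "emeasure \<mu> B' = (\<integral>\<^sup>+y. indicator C y \<partial>?P)"
      unfolding B' by (subst emeasure_cylinder[OF _ B])
        (auto simp: distr_dyadic_incr_wiener[OF \<mu>] C_def[symmetric] \<open>sets \<mu> = sets borel\<close>)
    have "ennreal x * emeasure (?T h) B' = (\<integral>\<^sup>+y. ennreal x * (ennreal (shift_density n h y) * indicator C y) \<partial>?P)"
      unfolding T by (rule nn_integral_cmult[symmetric]) measurable
    also have "\<dots> \<le> (\<integral>\<^sup>+y. ennreal (K * x powr p) * indicator C y +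
        ennreal d * (ennreal (shift_density n (q *\<^sub>R h) y) * indicator C y) \<partial>?P)"
    proof (rule nn_integral_mono)
      fix y
      have "x * shift_density n h y \<le> K * x powr p + K powr (- 1 / (p - 1)) * shift_density n h y powr q"
        unfolding q_def by (rule young_powr[OF p x _ K]) (simp add: shift_density_def)
      also have "\<dots> \<le> K * x powr p + K powr (- 1 / (p - 1)) * (exp ((q\<^sup>2 - q) * R\<^sup>2 / 2) * shift_density n (q *\<^sub>R h) y)"
        using shift_density_powr_le[OF q h] by (intro add_left_mono mult_left_mono) auto
      finally have "x * shift_density n h y \<le> K * x powr p + d * shift_density n (q *\<^sub>R h) y"
        by (simp add: d_def mult.assoc)
      moreover have "shift_density n h y \<ge> 0" "shift_density n (q *\<^sub>R h) y \<ge> 0" by (auto simp: shift_density_def)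
      ultimately show "ennreal x * (ennreal (shift_density n h y) * indicator C y) \<le> ennreal (K * x powr p) * indicator C y +
          ennreal d * (ennreal (shift_density n (q *\<^sub>R h) y) * indicator C y)"
        using x K d0 by (auto simp: indicator_def simp flip: ennreal_mult ennreal_plus intro!: ennreal_leI)
    qed
    also have "\<dots> = ennreal (K * x powr p) * emeasure \<mu> B' + ennreal d * emeasure (?T (q *\<^sub>R h)) B'"
      unfolding T M by (subst nn_integral_add, (measurable)[2]) (simp add: nn_integral_cmult)
    finally have "ennreal x * ennreal (measure (?T h) B') \<le> ennreal (K * x powr p) * ennreal (measure \<mu> B') + ennreal d * ennreal (measure (?T (q *\<^sub>R h)) B')"
      unfolding emeasure_eq_measure finite_measure.emeasure_eq_measure[OF fin] .
    then show "x * measure (?T h) B' \<le> K * x powr p * measure \<mu> B' + d * measure (?T (q *\<^sub>R h)) B'"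
      using x K d0 by (simp flip: ennreal_mult ennreal_plus)
  qed (use x K d0 A in \<open>auto simp: \<open>sets \<mu> = sets borel\<close> sets_borel_wiener\<close>)
qed

text \<open>The additive form replaces Hoelder's inequality. It can be proved level set by level set
  from an inequality between measures, and it suffices later because K depends on \<epsilon> and R
  only and is fixed before the approximation is chosen.\<close>

lemma cameron_martin_bound:
  fixes \<mu> :: "'n::finite wiener measure"
  assumes \<mu>: "wiener_measure \<mu>" and p: "p > 1" and "\<epsilon> > 0"
  obtains K where "K \<ge> 0" "\<And>h \<phi>. norm h \<le> R \<Longrightarrow> \<phi> \<in> borel_measurable borel \<Longrightarrow> (\<And>w. 0 \<le> \<phi> w) \<Longrightarrow>
     (\<integral>\<^sup>+w. ennreal (\<phi> (w + cm_path h)) \<partial>\<mu>) \<le> ennreal \<epsilon> + ennreal K * (\<integral>\<^sup>+w. ennreal (\<phi> w powr p) \<partial>\<mu>)"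
proof -
  interpret prob_space \<mu> using \<mu> by (simp add: wiener_measure_def)
  have [measurable_cong]: "sets \<mu> = sets borel" using \<mu> by (simp add: wiener_measure_def)
  define q where "q = p / (p - 1)"
  define E where "E = exp ((q\<^sup>2 - q) * R\<^sup>2 / 2)"
  \<comment> \<open>This K solves \<open>K powr (- 1 / (p - 1)) * E = \<epsilon>\<close>, so that
    the last term of \<open>shifted_measure_bound\<close> gets the factor \<epsilon>; the law
    shifted by \<open>q *\<^sub>R h\<close> has total mass 1.\<close>
  define K where "K = (E / \<epsilon>) powr (p - 1)"
  have E: "E > 0" by (simp add: E_def)
  have K: "K > 0" using E \<open>\<epsilon> > 0\<close> by (simp add: K_def)
  have "K powr (- 1 / (p - 1)) = (E / \<epsilon>) powr (- 1)"
    unfolding K_def powr_powr using p by (simp add: field_simps)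
  also have "\<dots> = \<epsilon> / E" using E \<open>\<epsilon> > 0\<close> by (simp add: powr_minus_divide)
  finally have KE: "K powr (- 1 / (p - 1)) * E = \<epsilon>" using E by simp
  let ?T = "\<lambda>h. distr \<mu> borel (\<lambda>w. w + cm_path h)"
  have prob_T: "prob_space (?T h)" for h by (rule prob_space_distr) measurable
  then have fin: "finite_measure (?T h)" for h by (rule prob_space.finite_measure)
  show ?thesis
  proof (rule that)
    show "K \<ge> 0" using K by simp
    fix h :: "'n cameron_martin" and \<phi> :: "'n wiener \<Rightarrow> real"
    assume h: "norm h \<le> R" and [measurable]: "\<phi> \<in> borel_measurable borel" and nonneg: "\<And>w. 0 \<le> \<phi> w"
    \<comment> \<open>The number x is free for each set A. Below it is the value of a simple
      function on its level set, which turns \<open>x powr p\<close> into the p-th power of the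
      function under the integral.\<close>
    have bound: "ennreal x * emeasure (?T h) A \<le> ennreal K * (ennreal (x powr p) * emeasure \<mu> A) + ennreal \<epsilon> * emeasure (?T (q *\<^sub>R h)) A"
      if "A \<in> sets borel" "x \<ge> 0" for A x
    proof -
      have "x * measure (?T h) A \<le> K * x powr p * measure \<mu> A + \<epsilon> * measure (?T (q *\<^sub>R h)) A"
        using shifted_measure_bound[OF \<mu> p K h that(2,1), folded q_def, folded E_def] by (simp only: KE)
      then show ?thesis
        using that(2) K \<open>\<epsilon> > 0\<close>
        unfolding emeasure_eq_measure finite_measure.emeasure_eq_measure[OF fin]
        by (simp add: mult.assoc ennreal_leI flip: ennreal_mult ennreal_plus)
    qed
    have "(\<integral>\<^sup>+w. ennreal (\<phi> (w + cm_path h)) \<partial>\<mu>) = (\<integral>\<^sup>+w. ennreal (\<phi> w) \<partial>?T h)"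
      by (subst nn_integral_distr) auto
    also have "\<dots> \<le> ennreal \<epsilon> + ennreal K * (\<integral>\<^sup>+w. ennreal (\<phi> w powr p) \<partial>\<mu>)"
      unfolding nn_integral_def[of "?T h"]
    proof (rule SUP_least)
      fix g assume "g \<in> {g. simple_function (?T h) g \<and> g \<le> (\<lambda>w. ennreal (\<phi> w))}"
      then have g: "simple_function (?T h) g" "\<And>w. g w \<le> ennreal (\<phi> w)" by (auto simp: le_fun_def)
      define Y where "Y = range g"
      have Y: "finite Y" using simple_functionD(1)[OF g(1)] by (simp add: Y_def)
      have lev [measurable]: "g -` {y} \<in> sets borel" for y using simple_functionD(2)[OF g(1), of "{y}"] by simp
      have "g w < top" for w using g(2)[of w] by (rule le_less_trans) simp
      then have real: "ennreal (enn2real y) = y" if "y \<in> Y" for y using that by (auto simp: Y_def)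
      have disj: "(\<Sum>y\<in>Y. F y * indicator (g -` {y}) w) = F (g w)" for F :: "ennreal \<Rightarrow> ennreal" and w
      proof -
        have "(\<Sum>y\<in>Y. F y * indicator (g -` {y}) w) = (\<Sum>y\<in>Y. if y = g w then F (g w) else 0)"
          by (intro sum.cong refl) (auto simp: indicator_def)
        then show ?thesis using Y by (simp add: Y_def)
      qed
      have "integral\<^sup>S (?T h) g = (\<Sum>y\<in>Y. y * emeasure (?T h) (g -` {y}))"
        by (simp add: simple_integral_def Y_def)
      also have "\<dots> \<le> (\<Sum>y\<in>Y. ennreal K * (ennreal (enn2real y powr p) * emeasure \<mu> (g -` {y})) + ennreal \<epsilon> * emeasure (?T (q *\<^sub>R h)) (g -` {y}))"
      proof (rule sum_mono)
        fix y assume "y \<in> Y"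
        show "y * emeasure (?T h) (g -` {y}) \<le> ennreal K * (ennreal (enn2real y powr p) * emeasure \<mu> (g -` {y})) + ennreal \<epsilon> * emeasure (?T (q *\<^sub>R h)) (g -` {y})"
          using bound[OF lev, of "enn2real y" y] real[OF \<open>y \<in> Y\<close>] by simp
      qed
      also have "\<dots> = ennreal K * (\<Sum>y\<in>Y. ennreal (enn2real y powr p) * emeasure \<mu> (g -` {y})) +
          ennreal \<epsilon> * (\<Sum>y\<in>Y. 1 * emeasure (?T (q *\<^sub>R h)) (g -` {y}))"
        by (simp add: sum.distrib sum_distrib_left)
      also have "(\<Sum>y\<in>Y. ennreal (enn2real y powr p) * emeasure \<mu> (g -` {y})) =
          (\<integral>\<^sup>+w. (\<Sum>y\<in>Y. ennreal (enn2real y powr p) * indicator (g -` {y}) w) \<partial>\<mu>)"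
        by (subst nn_integral_sum) (simp_all add: nn_integral_cmult_indicator)
      also have "\<dots> \<le> (\<integral>\<^sup>+w. ennreal (\<phi> w powr p) \<partial>\<mu>)"
      proof (rule nn_integral_mono)
        fix w
        have "enn2real (g w) \<le> \<phi> w" using enn2real_mono[OF g(2)[of w]] nonneg[of w] by simp
        then show "(\<Sum>y\<in>Y. ennreal (enn2real y powr p) * indicator (g -` {y}) w) \<le> ennreal (\<phi> w powr p)"
          unfolding disj using p by (intro ennreal_leI powr_mono2) auto
      qed
      also have "(\<Sum>y\<in>Y. 1 * emeasure (?T (q *\<^sub>R h)) (g -` {y})) =
          (\<integral>\<^sup>+w. (\<Sum>y\<in>Y. 1 * indicator (g -` {y}) w) \<partial>?T (q *\<^sub>R h))"
        by (subst nn_integral_sum) simp_all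
      also have "\<dots> = (\<integral>\<^sup>+w. 1 \<partial>?T (q *\<^sub>R h))" unfolding disj ..
      also have "\<dots> = 1" using prob_space.emeasure_space_1[OF prob_T, of "q *\<^sub>R h"] by simp
      finally show "integral\<^sup>S (?T h) g \<le> ennreal \<epsilon> + ennreal K * (\<integral>\<^sup>+w. ennreal (\<phi> w powr p) \<partial>\<mu>)"
        by (simp add: mult_left_mono add.commute)
    qed
    finally show "(\<integral>\<^sup>+w. ennreal (\<phi> (w + cm_path h)) \<partial>\<mu>) \<le> ennreal \<epsilon> + ennreal K * (\<integral>\<^sup>+w. ennreal (\<phi> w powr p) \<partial>\<mu>)" .
  qed
qed

section \<open>Cylindrical functions along lines\<close>

lemma DERIV_mean_value:
  fixes f f' :: "real \<Rightarrow> real"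
  assumes f: "\<And>x. (f has_real_derivative f' x) (at x)"
  shows "\<exists>\<xi>. \<bar>\<xi>\<bar> \<le> \<bar>c\<bar> \<and> f c - f 0 = c * f' \<xi>"
proof -
  consider "c = 0" | "0 < c" | "c < 0" by linarith
  then show ?thesis
  proof cases
    case 1
    then show ?thesis by auto
  next
    case 2
    then obtain z where "0 < z" "z < c" "f c - f 0 = (c - 0) * f' z" using MVT2[of 0 c f f'] f by blast
    then show ?thesis by (intro exI[of _ z]) auto
  next
    case 3
    then obtain z where "c < z" "z < 0" "f 0 - f c = (0 - c) * f' z" using MVT2[of c 0 f f'] f by blast
    then show ?thesis by (intro exI[of _ z]) auto
  qed
qed

definition move :: "(nat \<Rightarrow> real^'n::finite) \<Rightarrow> nat \<times> 'n \<Rightarrow> real \<Rightarrow> nat \<Rightarrow> real^'n" where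
  "move x a r = x(fst a := x (fst a) + r *\<^sub>R axis (snd a) 1)"

text \<open>\<open>partials\<close> only differentiates at parameter 0. Moving the base point along
  the axis gives the derivative at every r.\<close>

lemma slice_has_derivative:
  assumes diff: "\<And>x. slice F x a differentiable at 0"
  shows "(slice F x a has_real_derivative partials [a] F (move x a r)) (at r)"
proof -
  have eq: "slice F x a = (\<lambda>s. slice F (move x a r) a (s - r))"
    by (auto simp: slice_def move_def fun_eq_iff algebra_simps)
  have "(slice F (move x a r) a has_real_derivative deriv (slice F (move x a r) a) 0) (at 0)"
    using diff real_differentiable_def DERIV_deriv_iff_real_differentiable by blast
  then have "(slice F (move x a r) a has_real_derivative partials [a] F (move x a r)) (at (r - r))"
    by simp
  then have "((\<lambda>s. slice F (move x a r) a (s - r)) has_real_derivative partials [a] F (move x a r) * 1) (at r)"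
    by (rule DERIV_chain2) (auto intro!: derivative_eq_intros)
  then show ?thesis unfolding eq[symmetric] by simp
qed

text \<open>Continuous partial derivatives yield directional derivatives. The coordinates in I are
  released one at a time: the mean value theorem is applied in the new coordinate, and joint
  continuity lets the intermediate point tend to the base point.\<close>

lemma line_derivative_at_0:
  fixes F :: "(nat \<Rightarrow> real^'n::finite) \<Rightarrow> real" and x y :: "nat \<Rightarrow> real^'n"
  assumes diff: "\<And>a x. a \<in> I \<Longrightarrow> slice F x a differentiable at 0"
    and cont: "\<And>a. a \<in> I \<Longrightarrow> continuous_on UNIV (partials [a] F)"
    and "finite I"
  shows "((\<lambda>r. F (\<lambda>k. x k + r *\<^sub>R (\<Sum>i\<in>UNIV. if (k, i) \<in> I then (y k $ i) *\<^sub>R axis i 1 else 0)))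
    has_real_derivative (\<Sum>a\<in>I. y (fst a) $ snd a * partials [a] F x)) (at 0)"
  using \<open>finite I\<close> diff cont
proof (induction I rule: finite_induct)
  case empty
  then show ?case by simp
next
  case (insert a I)
  define Z where "Z r k = x k + r *\<^sub>R (\<Sum>i\<in>UNIV. if (k, i) \<in> I then (y k $ i) *\<^sub>R axis i 1 else 0)" for r k
  define c where "c = y (fst a) $ snd a"
  have IH: "((\<lambda>r. F (Z r)) has_real_derivative (\<Sum>a\<in>I. y (fst a) $ snd a * partials [a] F x)) (at 0)"
    unfolding Z_def using insert by auto
  have step: "(\<lambda>k. x k + r *\<^sub>R (\<Sum>i\<in>UNIV. if (k, i) \<in> insert a I then (y k $ i) *\<^sub>R axis i 1 else 0)) = move (Z r) a (r * c)" for r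
  proof
    fix k
    obtain l j where a: "a = (l, j)" by (cases a)
    have "(\<Sum>i\<in>UNIV. if (k, i) \<in> insert a I then (y k $ i) *\<^sub>R axis i 1 else 0) =
        (\<Sum>i\<in>UNIV. (if (k, i) \<in> I then (y k $ i) *\<^sub>R axis i 1 else 0) + (if k = l \<and> i = j then (y k $ i) *\<^sub>R axis i 1 else (0 :: real^'n)))"
      using insert(2) by (intro sum.cong refl) (auto simp: a)
    also have "\<dots> = (\<Sum>i\<in>UNIV. if (k, i) \<in> I then (y k $ i) *\<^sub>R axis i 1 else 0) + (if k = l then (y k $ j) *\<^sub>R axis j 1 else 0)"
      by (simp add: sum.distrib)
    finally show "x k + r *\<^sub>R (\<Sum>i\<in>UNIV. if (k, i) \<in> insert a I then (y k $ i) *\<^sub>R axis i 1 else 0) = move (Z r) a (r * c) k"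
      by (auto simp: move_def Z_def a c_def scaleR_add_right)
  qed
  have "\<exists>\<xi>. \<bar>\<xi>\<bar> \<le> \<bar>r * c\<bar> \<and> slice F (Z r) a (r * c) - slice F (Z r) a 0 = (r * c) * partials [a] F (move (Z r) a \<xi>)" for r
    using insert.prems(1)[of a] by (intro DERIV_mean_value slice_has_derivative) auto
  then obtain \<xi> where \<xi>: "\<And>r. \<bar>\<xi> r\<bar> \<le> \<bar>r * c\<bar>"
    "\<And>r. slice F (Z r) a (r * c) - slice F (Z r) a 0 = (r * c) * partials [a] F (move (Z r) a (\<xi> r))"
    by metis
  have FM: "F (move (Z r) a (r * c)) = F (Z r) + r * (c * partials [a] F (move (Z r) a (\<xi> r)))" for r
    using \<xi>(2)[of r] by (simp add: slice_def move_def algebra_simps)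
  have Z0: "Z 0 = x" by (auto simp: Z_def)
  have "(\<xi> \<longlongrightarrow> 0) (at 0)"
  proof (rule Lim_null_comparison)
    show "\<forall>\<^sub>F r in at 0. norm (\<xi> r) \<le> \<bar>r * c\<bar>" using \<xi>(1) by simp
    have "((\<lambda>r. \<bar>r * c\<bar>) \<longlongrightarrow> \<bar>0 * c\<bar>) (at 0)" by (intro tendsto_intros)
    then show "((\<lambda>r. \<bar>r * c\<bar>) \<longlongrightarrow> 0) (at 0)" by simp
  qed
  then have lim: "((\<lambda>r. (r, \<xi> r)) \<longlongrightarrow> (0, 0)) (at 0)" by (intro tendsto_Pair tendsto_ident_at)
  have "continuous_on UNIV (\<lambda>p :: real \<times> real. move (Z (fst p)) a (snd p))"
  proof (rule continuous_on_coordinatewise_then_product)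
    fix k
    show "continuous_on UNIV (\<lambda>p :: real \<times> real. move (Z (fst p)) a (snd p) k)"
      by (cases "k = fst a") (auto simp: move_def Z_def intro!: continuous_intros)
  qed
  then have "continuous_on UNIV (\<lambda>p :: real \<times> real. partials [a] F (move (Z (fst p)) a (snd p)))"
    using insert.prems(2)[of a] continuous_on_compose2[of UNIV "partials [a] F" UNIV] by auto
  then have "isCont (\<lambda>p :: real \<times> real. partials [a] F (move (Z (fst p)) a (snd p))) (0, 0)"
    by (simp add: continuous_on_eq_continuous_at)
  from isCont_tendsto_compose[OF this lim]
  have "((\<lambda>r. partials [a] F (move (Z r) a (\<xi> r))) \<longlongrightarrow> partials [a] F x) (at 0)"
    by (simp add: Z0 move_def)
  then have "((\<lambda>r. c * partials [a] F (move (Z r) a (\<xi> r))) \<longlongrightarrow> c * partials [a] F x) (at 0)"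
    by (intro tendsto_mult tendsto_const)
  then have "((\<lambda>r. r * (c * partials [a] F (move (Z r) a (\<xi> r)))) has_real_derivative c * partials [a] F x) (at 0)"
    \<comment> \<open>Away from 0 the difference quotient is exactly c times the partial derivative
      at the intermediate point, whose limit is known.\<close>
    unfolding DERIV_def by (rule Lim_transform_eventually) (simp add: eventually_at_filter)
  from DERIV_add[OF IH this]
  show ?case unfolding step FM using insert by (simp add: c_def add.commute)
qed

lemma schwartz_line_derivative:
  fixes F :: "(nat \<Rightarrow> real^'n::finite) \<Rightarrow> real"
  assumes F: "schwartz q F"
  shows "((\<lambda>r. F (\<lambda>k. x k + r *\<^sub>R y k)) has_real_derivative
     (\<Sum>a\<in>{..<q}\<times>UNIV. y (fst a) $ snd a * partials [a] F (\<lambda>k. x k + r *\<^sub>R y k))) (at r)"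
proof -
  have cont: "continuous_on UNIV (partials [a] F)" if "a \<in> {..<q} \<times> UNIV" for a
    using F that unfolding schwartz_def by (metis empty_set empty_subsetI insert_subset list.simps(15))
  have diff: "slice F x a differentiable at 0" if "a \<in> {..<q} \<times> UNIV" for a x
  proof -
    have "\<forall>as. set as \<subseteq> {..<q} \<times> UNIV \<longrightarrow> (\<forall>x. \<forall>a\<in>{..<q} \<times> UNIV. slice (partials as F) x a differentiable at 0)"
      using F by (simp add: schwartz_def)
    from this[rule_format, of "[]" a x] that show ?thesis by simp
  qed
  let ?x = "\<lambda>k. x k + r *\<^sub>R y k"
  have "F (\<lambda>k. ?x k + s *\<^sub>R (\<Sum>i\<in>UNIV. if (k, i) \<in> {..<q} \<times> UNIV then (y k $ i) *\<^sub>R axis i 1 else 0)) =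
      F (\<lambda>k. x k + (r + s) *\<^sub>R y k)" for s
  proof -
    \<comment> \<open>F depends on the first q terms only. Moving just these coordinates, as
      \<open>line_derivative_at_0\<close> does, therefore gives the same values as moving the entire
      sequence along y.\<close>
    have ext: "(\<forall>k<q. u k = v k) \<longrightarrow> F u = F v" for u v using F by (simp add: schwartz_def)
    have "(\<Sum>i\<in>UNIV. (y k $ i) *\<^sub>R axis i 1) = y k" for k
      using basis_expansion[of "y k"] by (simp add: scalar_mult_eq_scaleR)
    then show ?thesis by (intro ext[rule_format]) (auto simp: scaleR_add_left)
  qed
  with line_derivative_at_0[of "{..<q} \<times> UNIV" F ?x y, OF diff cont]
  have "((\<lambda>s. F (\<lambda>k. x k + (r + s) *\<^sub>R y k)) has_real_derivative
     (\<Sum>a\<in>{..<q}\<times>UNIV. y (fst a) $ snd a * partials [a] F ?x)) (at 0)" by simp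
  then show ?thesis
    using DERIV_at_within_shift[of "\<lambda>r. F (\<lambda>k. x k + r *\<^sub>R y k)" _ r 0 UNIV] by (simp add: add.commute)
qed

lemma cyl_line:
  fixes \<phi> :: "'n::finite wiener \<Rightarrow> real"
  assumes "\<phi> \<in> cyl"
  shows "((\<lambda>r. \<phi> (w + r *\<^sub>R cm_path h)) has_real_derivative directional \<phi> h (w + r *\<^sub>R cm_path h)) (at r)"
    and "continuous_on UNIV (\<lambda>r. directional \<phi> h (w + r *\<^sub>R cm_path h))"
proof -
  obtain F t q where \<phi>: "\<phi> = (\<lambda>w. F (\<lambda>k. path_at w (t k)))" and F: "schwartz q F"
    using assms by (auto simp: cyl_def)
  define y where "y k = path_at (cm_path h) (t k)" for k
  define D where "D w = (\<Sum>a\<in>{..<q}\<times>UNIV. y (fst a) $ snd a * partials [a] F (\<lambda>k. path_at w (t k)))" for w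
  have d: "((\<lambda>r. \<phi> (w + r *\<^sub>R cm_path h)) has_real_derivative D (w + r *\<^sub>R cm_path h)) (at r)" for w r
    using schwartz_line_derivative[OF F, of "\<lambda>k. path_at w (t k)" y r] by (simp add: \<phi> D_def y_def)
  have dir: "directional \<phi> h w = D w" for w
    unfolding directional_def using DERIV_imp_deriv[OF d[of w 0]] by simp
  show "((\<lambda>r. \<phi> (w + r *\<^sub>R cm_path h)) has_real_derivative directional \<phi> h (w + r *\<^sub>R cm_path h)) (at r)"
    unfolding dir by (rule d)
  have cont: "continuous_on UNIV (partials [a] F)" if "a \<in> {..<q} \<times> UNIV" for a
    using F that unfolding schwartz_def by (metis empty_set empty_subsetI insert_subset list.simps(15))
  have "continuous_on UNIV (\<lambda>r. (\<lambda>k. path_at (w + r *\<^sub>R cm_path h) (t k)))"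
    by (rule continuous_on_coordinatewise_then_product) (auto intro!: continuous_intros)
  then have "continuous_on UNIV (\<lambda>r. partials [a] F (\<lambda>k. path_at (w + r *\<^sub>R cm_path h) (t k)))"
    if "a \<in> {..<q} \<times> UNIV" for a
    using continuous_on_compose2[OF cont[OF that]] by auto
  then show "continuous_on UNIV (\<lambda>r. directional \<phi> h (w + r *\<^sub>R cm_path h))"
    unfolding dir D_def by (intro continuous_on_sum continuous_on_mult continuous_on_const) auto
qed

text \<open>The values involve finitely many basis vectors, so the fundamental theorem of calculus
  is applied to each real coefficient.\<close>

lemma cyl_gradient_line:
  fixes f :: "'n::finite wiener \<Rightarrow> 'x::{real_inner, complete_space, second_countable_topology}"
  assumes "cyl_gradient E f G"
  shows "continuous_on UNIV (\<lambda>\<sigma>. hs_apply (G (v + \<sigma> *\<^sub>R cm_path k)) k)"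
    and "(LBINT \<sigma>:{0..1}. hs_apply (G (v + \<sigma> *\<^sub>R cm_path k)) k) = f (v + cm_path k) - f v"
proof -
  obtain N :: nat and \<phi> e where \<phi>: "\<And>j. j < N \<Longrightarrow> \<phi> j \<in> cyl"
    and f: "\<And>w. f w = (\<Sum>j<N. \<phi> j w *\<^sub>R e j)"
    and G: "\<And>w h. hs_apply (G w) h = (\<Sum>j<N. directional (\<phi> j) h w *\<^sub>R e j)"
    using assms unfolding cyl_gradient_def by blast
  let ?d = "\<lambda>j \<sigma>. directional (\<phi> j) k (v + \<sigma> *\<^sub>R cm_path k)"
  have cont: "continuous_on UNIV (?d j)" if "j < N" for j using cyl_line(2)[OF \<phi>[OF that]] .
  then show "continuous_on UNIV (\<lambda>\<sigma>. hs_apply (G (v + \<sigma> *\<^sub>R cm_path k)) k)"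
    unfolding G by (intro continuous_on_sum continuous_on_scaleR continuous_on_const) auto
  have int: "set_integrable lborel {0..1} (?d j)" if "j < N" for j
    using cont[OF that] by (intro borel_integrable_atLeastAtMost') (rule continuous_on_subset, auto)
  have ftc: "(LBINT \<sigma>:{0..1}. ?d j \<sigma>) = \<phi> j (v + cm_path k) - \<phi> j v" if "j < N" for j
  proof -
    have "(LBINT \<sigma>. ?d j \<sigma> * indicator {0..1} \<sigma>) = \<phi> j (v + 1 *\<^sub>R cm_path k) - \<phi> j (v + 0 *\<^sub>R cm_path k)"
      using cont[OF that] cyl_line(1)[OF \<phi>[OF that]]
      by (intro integral_FTC_Icc_real) (auto simp: continuous_on_eq_continuous_at)
    then show ?thesis by (simp add: set_lebesgue_integral_def mult.commute)
  qed
  have "(LBINT \<sigma>:{0..1}. hs_apply (G (v + \<sigma> *\<^sub>R cm_path k)) k) =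
      (LBINT \<sigma>. \<Sum>j<N. (indicator {0..1} \<sigma> *\<^sub>R ?d j \<sigma>) *\<^sub>R e j)"
    unfolding G set_lebesgue_integral_def by (simp add: scaleR_sum_right)
  also have "\<dots> = (\<Sum>j<N. LBINT \<sigma>. (indicator {0..1} \<sigma> *\<^sub>R ?d j \<sigma>) *\<^sub>R e j)"
    using int by (intro Bochner_Integration.integral_sum integrable_scaleR_left) (auto simp: set_integrable_def)
  also have "\<dots> = (\<Sum>j<N. (\<phi> j (v + cm_path k) - \<phi> j v) *\<^sub>R e j)"
    using int ftc by (intro sum.cong refl, subst Bochner_Integration.integral_scaleR_left)
      (auto simp: set_integrable_def set_lebesgue_integral_def)
  finally show "(LBINT \<sigma>:{0..1}. hs_apply (G (v + \<sigma> *\<^sub>R cm_path k)) k) = f (v + cm_path k) - f v"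
    by (simp add: f scaleR_diff_left sum_subtractf)
qed

section \<open>The weak derivative along lines\<close>

lemma wiener_measureD:
  assumes "wiener_measure \<mu>"
  shows "prob_space \<mu>" "sets \<mu> = sets borel" "space \<mu> = UNIV"
  using assms sets_eq_imp_space_eq[of \<mu> borel] by (auto simp: wiener_measure_def)

text \<open>Rotation invariance and Fubini split a null set for v into one null set for w and, for
  each remaining w, a null set for y.\<close>

lemma wiener_rotation_AE:
  fixes \<mu> :: "'n::finite wiener measure"
  assumes \<mu>: "wiener_measure \<mu>" and cs: "c > 0" "s > 0" "c\<^sup>2 + s\<^sup>2 = 1" and P: "AE v in \<mu>. P v"
  shows "AE w in \<mu>. AE y in \<mu>. P (c *\<^sub>R w + s *\<^sub>R y)"
proof -
  interpret prob_space \<mu> using \<mu> by (rule wiener_measureD)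
  interpret pair_prob_space \<mu> \<mu> ..
  have [measurable_cong]: "sets \<mu> = sets borel" using \<mu> by (rule wiener_measureD)
  have "AE v in distr (\<mu> \<Otimes>\<^sub>M \<mu>) borel (\<lambda>(w, y). c *\<^sub>R w + s *\<^sub>R y). P v"
    unfolding wiener_rotation[OF \<mu> cs] by (rule P)
  then have "AE z in \<mu> \<Otimes>\<^sub>M \<mu>. P ((\<lambda>(w, y). c *\<^sub>R w + s *\<^sub>R y) z)"
    by (rule AE_distrD[rotated]) measurable
  then show ?thesis by (auto dest!: AE_pair)
qed

lemma wiener_rotation_nn_integral:
  fixes \<mu> :: "'n::finite wiener measure"
  assumes \<mu>: "wiener_measure \<mu>" and cs: "c > 0" "s > 0" "c\<^sup>2 + s\<^sup>2 = 1" and u [measurable]: "u \<in> borel_measurable borel"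
  shows "(\<integral>\<^sup>+w. (\<integral>\<^sup>+y. u (c *\<^sub>R w + s *\<^sub>R y) \<partial>\<mu>) \<partial>\<mu>) = (\<integral>\<^sup>+v. u v \<partial>\<mu>)"
proof -
  interpret prob_space \<mu> using \<mu> by (rule wiener_measureD)
  have [measurable_cong]: "sets \<mu> = sets borel" using \<mu> by (rule wiener_measureD)
  have m: "(\<lambda>z. u (c *\<^sub>R fst z + s *\<^sub>R snd z)) \<in> borel_measurable (\<mu> \<Otimes>\<^sub>M \<mu>)" by measurable
  have "(\<integral>\<^sup>+v. u v \<partial>\<mu>) = (\<integral>\<^sup>+v. u v \<partial>distr (\<mu> \<Otimes>\<^sub>M \<mu>) borel (\<lambda>(w, y). c *\<^sub>R w + s *\<^sub>R y))"
    by (simp only: wiener_rotation[OF \<mu> cs])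
  also have "\<dots> = (\<integral>\<^sup>+z. u (c *\<^sub>R fst z + s *\<^sub>R snd z) \<partial>(\<mu> \<Otimes>\<^sub>M \<mu>))"
    by (subst nn_integral_distr) (auto simp: case_prod_beta)
  also have "\<dots> = (\<integral>\<^sup>+w. (\<integral>\<^sup>+y. u (c *\<^sub>R w + s *\<^sub>R y) \<partial>\<mu>) \<partial>\<mu>)"
    using nn_integral_fst[OF m] by simp
  finally show ?thesis ..
qed

lemma powr_add_le:
  fixes x y p :: real
  assumes "x \<ge> 0" "y \<ge> 0" "p \<ge> 0"
  shows "(x + y) powr p \<le> 2 powr p * (x powr p + y powr p)"
proof -
  have "(x + y) powr p \<le> (2 * max x y) powr p" using assms by (intro powr_mono2) auto
  also have "\<dots> = 2 powr p * max x y powr p" using assms by (simp add: powr_mult)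
  also have "max x y powr p \<le> x powr p + y powr p" by (auto simp: max_def)
  finally show ?thesis by simp
qed

text \<open>Measurability of the norm of the difference is a hypothesis because for operator values
  it comes from \<open>measurable_hs_norm_diff\<close>.\<close>

lemma Lp_diff_integrable:
  fixes a b :: "'w \<Rightarrow> 'y::real_normed_vector"
  assumes p: "p > 0" and a: "a \<in> Lp M p" and b: "b \<in> Lp M p"
    and m: "(\<lambda>w. norm (a w - b w)) \<in> borel_measurable M"
  shows "integrable M (\<lambda>w. norm (a w - b w) powr p)"
proof (rule Bochner_Integration.integrable_bound)
  show "integrable M (\<lambda>w. 2 powr p * (norm (a w) powr p + norm (b w) powr p))"
    using a b by (auto simp: Lp_def)
  show "AE w in M. norm (norm (a w - b w) powr p) \<le> norm (2 powr p * (norm (a w) powr p + norm (b w) powr p))"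
  proof (rule AE_I2)
    fix w
    have "norm (a w - b w) powr p \<le> (norm (a w) + norm (b w)) powr p"
      using p by (intro powr_mono2 norm_triangle_ineq4) auto
    also have "\<dots> \<le> 2 powr p * (norm (a w) powr p + norm (b w) powr p)"
      using p by (intro powr_add_le) auto
    finally show "norm (norm (a w - b w) powr p) \<le> norm (2 powr p * (norm (a w) powr p + norm (b w) powr p))"
      by simp
  qed
qed (use m in measurable)

lemma Lp_norm_tendsto_nn_integral:
  fixes a :: "nat \<Rightarrow> 'w \<Rightarrow> 'y::real_normed_vector"
  assumes p: "p > 0" and int: "\<And>j. integrable M (\<lambda>w. norm (a j w) powr p)"
    and lim: "(\<lambda>j. Lp_norm M p (a j)) \<longlonglongrightarrow> 0"
  shows "(\<lambda>j. \<integral>\<^sup>+w. ennreal (norm (a j w) powr p) \<partial>M) \<longlonglongrightarrow> 0"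
proof -
  have "(\<lambda>j. Lp_norm M p (a j) powr p) \<longlonglongrightarrow> 0"
    using p lim by (intro tendsto_zero_powrI[where b = p]) (auto simp: Lp_norm_def)
  moreover have "Lp_norm M p (a j) powr p = (\<integral>w. norm (a j w) powr p \<partial>M)" for j
    using p by (simp add: Lp_norm_def powr_powr)
  ultimately have "(\<lambda>j. ennreal (\<integral>w. norm (a j w) powr p \<partial>M)) \<longlonglongrightarrow> ennreal 0"
    by (intro tendsto_ennrealI) simp
  moreover have "(\<integral>\<^sup>+w. ennreal (norm (a j w) powr p) \<partial>M) = ennreal (\<integral>w. norm (a j w) powr p \<partial>M)" for j
    using int by (intro nn_integral_eq_integral) auto
  ultimately show ?thesis by simp
qed

text \<open>The decisive point is the quantifier order: the exceptional set of w is chosen before h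
  and k, and only the exceptional set of y may depend on them. For a good w the proof shows that the
  defect \<open>D\<close> of the line formula has arbitrarily small mean norm over y.\<close>

lemma weak_derivative_line:
  fixes \<mu> :: "'n::finite wiener measure"
    and E :: "'x::{real_inner, banach, second_countable_topology} set"
  assumes \<mu>: "wiener_measure \<mu>" and p: "1 < p" and wd: "has_weak_derivative \<mu> p E f g"
    and reg: "AE w in \<mu>. \<forall>h k. continuous_on UNIV (\<lambda>\<sigma>::real. g (w + cm_path h + \<sigma> *\<^sub>R cm_path k))"
    and cs: "c > 0" "s > 0" "c\<^sup>2 + s\<^sup>2 = 1"
  shows "AE w in \<mu>. \<forall>h k. AE y in \<mu>.
     f (c *\<^sub>R w + s *\<^sub>R y + cm_path h + cm_path k) - f (c *\<^sub>R w + s *\<^sub>R y + cm_path h) =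
     (LBINT \<sigma>:{0..1}. hs_apply (g (c *\<^sub>R w + s *\<^sub>R y + cm_path h + \<sigma> *\<^sub>R cm_path k)) k)"
proof -
  interpret prob_space \<mu> using \<mu> by (rule wiener_measureD)
  have sets\<mu> [measurable_cong]: "sets \<mu> = sets borel" using \<mu> by (rule wiener_measureD)
  have meas_eq: "borel_measurable \<mu> = borel_measurable borel" by (intro measurable_cong_sets sets\<mu> refl)
  obtain F G where FG: "\<And>j::nat. cyl_gradient E (F j) (G j)" "\<And>j. F j \<in> Lp \<mu> p" "\<And>j. G j \<in> Lp \<mu> p"
    and lim: "(\<lambda>j. Lp_norm \<mu> p (\<lambda>w. F j w - f w) + Lp_norm \<mu> p (\<lambda>w. G j w - g w)) \<longlonglongrightarrow> 0"
    and fg: "f \<in> Lp \<mu> p" "g \<in> Lp \<mu> p"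
    using wd unfolding has_weak_derivative_def by blast
  have f [measurable]: "f \<in> borel_measurable borel" and g: "g \<in> borel_measurable borel"
    and F [measurable]: "F j \<in> borel_measurable borel" and G: "G j \<in> borel_measurable borel" for j
    using fg FG(2,3)[of j] by (auto simp: Lp_def meas_eq)
  have mF [measurable]: "(\<lambda>v. norm (F j v - f v)) \<in> borel_measurable borel" for j by measurable
  have mG [measurable]: "(\<lambda>v. norm (G j v - g v)) \<in> borel_measurable borel" for j
    by (rule measurable_hs_norm_diff[OF G g])
  have nn: "0 \<le> Lp_norm \<mu> p a" for a :: "'n wiener \<Rightarrow> 'b::real_normed_vector" by (simp add: Lp_norm_def)
  have "(\<lambda>j. Lp_norm \<mu> p (\<lambda>w. F j w - f w)) \<longlonglongrightarrow> 0" "(\<lambda>j. Lp_norm \<mu> p (\<lambda>w. G j w - g w)) \<longlonglongrightarrow> 0"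
    by (rule Lim_null_comparison[OF _ lim]; simp add: nn)+
  then have limF: "(\<lambda>j. \<integral>\<^sup>+w. ennreal (norm (F j w - f w) powr p) \<partial>\<mu>) \<longlonglongrightarrow> 0"
    and limG: "(\<lambda>j. \<integral>\<^sup>+w. ennreal (norm (G j w - g w) powr p) \<partial>\<mu>) \<longlonglongrightarrow> 0"
    using p FG fg by (auto intro!: Lp_norm_tendsto_nn_integral Lp_diff_integrable)
  \<comment> \<open>Both approximation errors are put into one function, so that the same index j
    controls values and gradients.\<close>
  define u where "u j v = ennreal (norm (F j v - f v) powr p) + ennreal (norm (G j v - g v) powr p)" for j v
  have u [measurable]: "u j \<in> borel_measurable borel" for j unfolding u_def[abs_def] by measurable
  have "(\<integral>\<^sup>+w. u j w \<partial>\<mu>) = (\<integral>\<^sup>+w. ennreal (norm (F j w - f w) powr p) \<partial>\<mu>) + (\<integral>\<^sup>+w. ennreal (norm (G j w - g w) powr p) \<partial>\<mu>)" for j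
    unfolding u_def by (rule nn_integral_add) measurable
  then have limu: "(\<lambda>j. \<integral>\<^sup>+w. u j w \<partial>\<mu>) \<longlonglongrightarrow> 0" using tendsto_add[OF limF limG] by simp
  define A where "A j w = (\<integral>\<^sup>+y. u j (c *\<^sub>R w + s *\<^sub>R y) \<partial>\<mu>)" for j w
  have A [measurable]: "A j \<in> borel_measurable borel" for j unfolding A_def[abs_def] by measurable
  \<comment> \<open>The infimum over j replaces the choice of an almost surely convergent
    subsequence: its integral is 0, so almost every w has, for each tolerance, some j with
    \<open>A j w\<close> below it. This choice does not involve h or k.\<close>
  have "(\<integral>\<^sup>+w. (INF j. A j w) \<partial>\<mu>) \<le> (\<integral>\<^sup>+w. u j w \<partial>\<mu>)" for j
  proof -
    have "(\<integral>\<^sup>+w. (INF j. A j w) \<partial>\<mu>) \<le> (\<integral>\<^sup>+w. A j w \<partial>\<mu>)" by (intro nn_integral_mono INF_lower) simp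
    also have "\<dots> = (\<integral>\<^sup>+w. u j w \<partial>\<mu>)" unfolding A_def by (rule wiener_rotation_nn_integral[OF \<mu> cs u])
    finally show ?thesis .
  qed
  then have "(\<integral>\<^sup>+w. (INF j. A j w) \<partial>\<mu>) \<le> 0" by (intro tendsto_lowerbound[OF limu]) auto
  then have "AE w in \<mu>. (INF j. A j w) = 0" by (simp add: nn_integral_0_iff_AE)
  moreover have "AE w in \<mu>. AE y in \<mu>. \<forall>h k. continuous_on UNIV (\<lambda>\<sigma>::real. g (c *\<^sub>R w + s *\<^sub>R y + cm_path h + \<sigma> *\<^sub>R cm_path k))"
    by (rule wiener_rotation_AE[OF \<mu> cs reg])
  ultimately show ?thesis
  proof eventually_elim
    case (elim w)
    show ?case
    proof (intro allI)
      fix h k :: "'n cameron_martin"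
      let ?v = "\<lambda>y. c *\<^sub>R w + s *\<^sub>R y"
      define gk where "gk v = hs_apply (g v) k" for v
      have [measurable]: "gk \<in> borel_measurable borel" unfolding gk_def[abs_def] by (rule measurable_hs_apply[OF g])
      define D where "D y = f (?v y + cm_path h + cm_path k) - f (?v y + cm_path h) -
        (LBINT \<sigma>:{0..1}. gk (?v y + cm_path h + \<sigma> *\<^sub>R cm_path k))" for y
      have [measurable]: "D \<in> borel_measurable borel"
      proof -
        have "(\<lambda>y. LBINT \<sigma>. indicator {0..1} \<sigma> *\<^sub>R gk (?v y + cm_path h + \<sigma> *\<^sub>R cm_path k)) \<in> borel_measurable borel"
          by (rule lborel.borel_measurable_lebesgue_integral) measurable
        then show ?thesis
          unfolding D_def[abs_def] set_lebesgue_integral_def by (intro borel_measurable_diff) measurable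
      qed
      \<comment> \<open>In the variable y a shift of v by l becomes a shift by l/s. All shifts used
        below have norm at most \<open>norm h + norm k\<close>.\<close>
      define R where "R = (norm h + norm k) / s"
      have bound: "(\<integral>\<^sup>+y. ennreal (norm (D y)) \<partial>\<mu>) \<le> ennreal e" if e: "e > 0" for e
      proof -
        \<comment> \<open>Two errors of values and one error of gradients, the latter with factor
          \<open>norm k\<close>, are each estimated by \<open>2 * \<epsilon>\<close>; their total is
          e.\<close>
        define \<epsilon> where "\<epsilon> = e / (2 * (2 + norm k))"
        have "N > 0 \<Longrightarrow> e / (2 * N) > 0 \<and> N * (2 * (e / (2 * N))) = e" for N using e by simp
        then have \<epsilon>: "\<epsilon> > 0" "(2 + norm k) * (2 * \<epsilon>) = e"
          unfolding \<epsilon>_def using norm_ge_zero[of k] by (meson add_pos_nonneg zero_less_numeral)+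
        obtain K where K: "K \<ge> 0" "\<And>h \<phi>. norm h \<le> R \<Longrightarrow> \<phi> \<in> borel_measurable borel \<Longrightarrow> (\<And>w. 0 \<le> \<phi> w) \<Longrightarrow>
          (\<integral>\<^sup>+w. ennreal (\<phi> (w + cm_path h)) \<partial>\<mu>) \<le> ennreal \<epsilon> + ennreal K * (\<integral>\<^sup>+w. ennreal (\<phi> w powr p) \<partial>\<mu>)"
          using cameron_martin_bound[OF \<mu> p \<epsilon>(1), of R] by blast
        \<comment> \<open>K is already fixed by R and \<epsilon>, so j may be chosen to make
          \<open>K * A j w\<close> small; \<open>K + 1\<close> avoids dividing by 0.\<close>
        have "(INF j. A j w) < ennreal (\<epsilon> / (K + 1))" using elim(1) \<epsilon>(1) K(1) by simp
        then obtain j where j: "A j w < ennreal (\<epsilon> / (K + 1))" by (auto simp: INF_less_iff)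
        have KA: "ennreal K * A j w \<le> ennreal \<epsilon>"
        proof -
          have "ennreal K * A j w \<le> ennreal K * ennreal (\<epsilon> / (K + 1))" using j by (intro mult_left_mono) auto
          also have "\<dots> \<le> ennreal \<epsilon>" using K(1) \<epsilon>(1) by (simp add: ennreal_mult[symmetric] field_simps)
          finally show ?thesis .
        qed
        have main: "(\<integral>\<^sup>+y. ennreal (\<phi> (?v y + cm_path l)) \<partial>\<mu>) \<le> ennreal (2 * \<epsilon>)"
          if l: "norm l \<le> norm h + norm k" and [measurable]: "\<phi> \<in> borel_measurable borel"
            and nonneg: "\<And>v. 0 \<le> \<phi> v" and le: "\<And>v. ennreal (\<phi> v powr p) \<le> u j v" for l \<phi>
        proof -
          have "?v y + cm_path l = ?v (y + cm_path (l /\<^sub>R s))" for y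
            using cs by (simp add: scaleR_add_right)
          then have "(\<integral>\<^sup>+y. ennreal (\<phi> (?v y + cm_path l)) \<partial>\<mu>) = (\<integral>\<^sup>+y. ennreal (\<phi> (?v (y + cm_path (l /\<^sub>R s)))) \<partial>\<mu>)"
            by (simp only:)
          also have "\<dots> \<le> ennreal \<epsilon> + ennreal K * (\<integral>\<^sup>+y. ennreal (\<phi> (?v y) powr p) \<partial>\<mu>)"
            using l cs nonneg by (intro K(2)) (auto simp: R_def field_simps)
          also have "(\<integral>\<^sup>+y. ennreal (\<phi> (?v y) powr p) \<partial>\<mu>) \<le> A j w"
            unfolding A_def using le by (rule nn_integral_mono)
          finally have "(\<integral>\<^sup>+y. ennreal (\<phi> (?v y + cm_path l)) \<partial>\<mu>) \<le> ennreal \<epsilon> + ennreal K * A j w"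
            by (meson add_left_mono mult_left_mono order_trans zero_le)
          also have "\<dots> \<le> ennreal \<epsilon> + ennreal \<epsilon>" using KA by (rule add_left_mono)
          also have "\<dots> = ennreal (2 * \<epsilon>)" using \<epsilon>(1) by (simp flip: ennreal_plus)
          finally show ?thesis .
        qed
        let ?nF = "\<lambda>v. norm (F j v - f v)" and ?nG = "\<lambda>v. norm (G j v - g v)"
        let ?T = "\<lambda>y. \<integral>\<^sup>+\<sigma>. indicator {0..1} \<sigma> * (ennreal (norm k) * ennreal (?nG (?v y + cm_path h + \<sigma> *\<^sub>R cm_path k))) \<partial>lborel"
        have leF: "ennreal (?nF v powr p) \<le> u j v" and leG: "ennreal (?nG v powr p) \<le> u j v" for v
          by (auto simp: u_def)
        have "(\<integral>\<^sup>+y. ennreal (norm (D y)) \<partial>\<mu>) \<le>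
          (\<integral>\<^sup>+y. (ennreal (?nF (?v y + cm_path (h + k))) + ennreal (?nF (?v y + cm_path h))) + ?T y \<partial>\<mu>)"
        proof (rule nn_integral_mono_AE)
          show "AE y in \<mu>. ennreal (norm (D y)) \<le>
            (ennreal (?nF (?v y + cm_path (h + k))) + ennreal (?nF (?v y + cm_path h))) + ?T y"
            using elim(2)
          proof eventually_elim
            case (elim y)
            define b where "b \<sigma> = ?v y + cm_path h + \<sigma> *\<^sub>R cm_path k" for \<sigma> :: real
            define Gk where "Gk \<sigma> = hs_apply (G j (b \<sigma>)) k" for \<sigma>
            have "continuous_on UNIV (\<lambda>\<sigma>. gk (b \<sigma>))"
              unfolding gk_def b_def
              by (rule continuous_on_compose2[OF linear_continuous_on[OF bounded_linear_hs_eval], of UNIV]) (use elim in auto)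
            then have ig: "set_integrable lborel {0..1} (\<lambda>\<sigma>. gk (b \<sigma>))"
              unfolding set_integrable_def by (intro borel_integrable_compact) (auto intro: continuous_on_subset)
            have "continuous_on UNIV Gk"
              unfolding Gk_def[abs_def] b_def by (rule cyl_gradient_line(1)[OF FG(1)])
            then have iG: "set_integrable lborel {0..1} Gk"
              unfolding set_integrable_def by (intro borel_integrable_compact) (auto intro: continuous_on_subset)
            have line: "(LBINT \<sigma>:{0..1}. Gk \<sigma>) = F j (?v y + cm_path h + cm_path k) - F j (?v y + cm_path h)"
              unfolding Gk_def b_def by (rule cyl_gradient_line(2)[OF FG(1)])
            have "ennreal (norm (LBINT \<sigma>:{0..1}. Gk \<sigma> - gk (b \<sigma>))) \<le> (\<integral>\<^sup>+\<sigma>. ennreal (norm (indicator {0..1} \<sigma> *\<^sub>R (Gk \<sigma> - gk (b \<sigma>)))) \<partial>lborel)"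
              using set_integral_diff(1)[OF iG ig] unfolding set_lebesgue_integral_def set_integrable_def
              by (rule integral_norm_bound_ennreal)
            also have "\<dots> \<le> ?T y"
            proof (rule nn_integral_mono)
              fix \<sigma>
              have "norm (Gk \<sigma> - gk (b \<sigma>)) \<le> ?nG (b \<sigma>) * norm k"
                using norm_hs_apply_le[of "G j (b \<sigma>) - g (b \<sigma>)" k] by (simp add: Gk_def gk_def)
              then show "ennreal (norm (indicator {0..1} \<sigma> *\<^sub>R (Gk \<sigma> - gk (b \<sigma>)))) \<le>
                  indicator {0..1} \<sigma> * (ennreal (norm k) * ennreal (?nG (?v y + cm_path h + \<sigma> *\<^sub>R cm_path k)))"
                by (auto simp: indicator_def b_def mult.commute simp flip: ennreal_mult intro!: ennreal_leI)
            qed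
            finally have T: "ennreal (norm (LBINT \<sigma>:{0..1}. Gk \<sigma> - gk (b \<sigma>))) \<le> ?T y" .
            \<comment> \<open>The cylindrical function satisfies the line formula exactly. Inserting
              it expresses the defect of f and g through approximation errors alone, evaluated at
              shifted points.\<close>
            have D_eq: "D y = - (F j (?v y + cm_path (h + k)) - f (?v y + cm_path (h + k))) +
                (F j (?v y + cm_path h) - f (?v y + cm_path h)) + (LBINT \<sigma>:{0..1}. Gk \<sigma> - gk (b \<sigma>))"
              unfolding set_integral_diff(2)[OF iG ig] line by (simp add: D_def b_def add.assoc)
            have tri: "norm (- a + b + d) \<le> norm a + norm b + norm d" for a b d :: 'x by norm
            have "norm (D y) \<le> ?nF (?v y + cm_path (h + k)) + ?nF (?v y + cm_path h) + norm (LBINT \<sigma>:{0..1}. Gk \<sigma> - gk (b \<sigma>))"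
              unfolding D_eq by (rule tri)
            then have "ennreal (norm (D y)) \<le> ennreal (?nF (?v y + cm_path (h + k))) + ennreal (?nF (?v y + cm_path h)) + ennreal (norm (LBINT \<sigma>:{0..1}. Gk \<sigma> - gk (b \<sigma>)))"
              by (simp flip: ennreal_plus add: ennreal_leI)
            also have "\<dots> \<le> ennreal (?nF (?v y + cm_path (h + k))) + ennreal (?nF (?v y + cm_path h)) + ?T y"
              using T by (rule add_left_mono)
            finally show ?case .
          qed
        qed
        also have "\<dots> = ((\<integral>\<^sup>+y. ennreal (?nF (?v y + cm_path (h + k))) \<partial>\<mu>) + (\<integral>\<^sup>+y. ennreal (?nF (?v y + cm_path h)) \<partial>\<mu>)) +
            (\<integral>\<^sup>+y. ?T y \<partial>\<mu>)"
        proof -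
          have [measurable]: "?T \<in> borel_measurable \<mu>" by measurable
          show ?thesis by (subst nn_integral_add; (measurable)?; subst nn_integral_add; (measurable)?)
        qed
        also have "(\<integral>\<^sup>+y. ?T y \<partial>\<mu>) = (\<integral>\<^sup>+\<sigma>. (\<integral>\<^sup>+y. indicator {0..1} \<sigma> * (ennreal (norm k) * ennreal (?nG (?v y + cm_path h + \<sigma> *\<^sub>R cm_path k))) \<partial>\<mu>) \<partial>lborel)"
        proof -
          interpret pair_sigma_finite lborel \<mu> ..
          show ?thesis by (rule Fubini') measurable
        qed
        also have "\<dots> \<le> (\<integral>\<^sup>+\<sigma>. indicator {0..1::real} \<sigma> * (ennreal (norm k) * ennreal (2 * \<epsilon>)) \<partial>lborel)"
        proof (rule nn_integral_mono)
          fix \<sigma> :: real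
          have "(\<integral>\<^sup>+y. indicator {0..1} \<sigma> * (ennreal (norm k) * ennreal (?nG (?v y + cm_path h + \<sigma> *\<^sub>R cm_path k))) \<partial>\<mu>) =
              indicator {0..1} \<sigma> * (ennreal (norm k) * (\<integral>\<^sup>+y. ennreal (?nG (?v y + cm_path (h + \<sigma> *\<^sub>R k))) \<partial>\<mu>))"
            by (subst nn_integral_cmult, measurable, subst nn_integral_cmult, measurable) (simp add: add.assoc)
          also have "\<dots> \<le> indicator {0..1} \<sigma> * (ennreal (norm k) * ennreal (2 * \<epsilon>))"
          proof (cases "\<sigma> \<in> {0..1}")
            case True
            have "norm (h + \<sigma> *\<^sub>R k) \<le> norm h + \<bar>\<sigma>\<bar> * norm k" using norm_triangle_ineq[of h "\<sigma> *\<^sub>R k"] by simp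
            also have "\<dots> \<le> norm h + norm k" using True by (simp add: mult_left_le_one_le)
            finally show ?thesis by (intro mult_left_mono main leG) auto
          qed simp
          finally show "(\<integral>\<^sup>+y. indicator {0..1} \<sigma> * (ennreal (norm k) * ennreal (?nG (?v y + cm_path h + \<sigma> *\<^sub>R cm_path k))) \<partial>\<mu>) \<le>
              indicator {0..1} \<sigma> * (ennreal (norm k) * ennreal (2 * \<epsilon>))" .
        qed
        also have "\<dots> = ennreal (norm k) * ennreal (2 * \<epsilon>)"
          by (subst nn_integral_multc) auto
        also have "(\<integral>\<^sup>+y. ennreal (?nF (?v y + cm_path (h + k))) \<partial>\<mu>) \<le> ennreal (2 * \<epsilon>)"
          by (rule main[OF norm_triangle_ineq _ _ leF]) auto
        also have "(\<integral>\<^sup>+y. ennreal (?nF (?v y + cm_path h)) \<partial>\<mu>) \<le> ennreal (2 * \<epsilon>)"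
          by (rule main[OF _ _ _ leF]) auto
        finally have "(\<integral>\<^sup>+y. ennreal (norm (D y)) \<partial>\<mu>) \<le> ennreal (2 * \<epsilon>) + ennreal (2 * \<epsilon>) + ennreal (norm k) * ennreal (2 * \<epsilon>)"
          by (simp add: add_mono)
        also have "\<dots> = ennreal e" using \<epsilon> by (simp add: algebra_simps flip: ennreal_plus ennreal_mult)
        finally show ?thesis .
      qed
      have "(\<integral>\<^sup>+y. ennreal (norm (D y)) \<partial>\<mu>) \<le> 0"
        by (rule ennreal_le_epsilon) (simp add: bound)
      then have "AE y in \<mu>. ennreal (norm (D y)) = 0" by (simp add: nn_integral_0_iff_AE)
      then show "AE y in \<mu>. f (?v y + cm_path h + cm_path k) - f (?v y + cm_path h) =
          (LBINT \<sigma>:{0..1}. hs_apply (g (?v y + cm_path h + \<sigma> *\<^sub>R cm_path k)) k)"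
        by eventually_elim (simp add: D_def gk_def)
    qed
  qed
qed

section \<open>Convergence along rotations\<close>

text \<open>This replaces continuity of f. A merely measurable function need not follow a convergent
  sequence of paths, but because the rotated path has the same law as w, every Borel event
  stabilises in probability.\<close>

lemma rotation_limit_sets:
  fixes \<mu> :: "'n::finite wiener measure" and c s :: "nat \<Rightarrow> real"
  assumes \<mu>: "wiener_measure \<mu>" and cs: "\<And>k. c k > 0" "\<And>k. s k > 0" "\<And>k. (c k)\<^sup>2 + (s k)\<^sup>2 = 1"
    and lim: "c \<longlonglongrightarrow> 1" "s \<longlonglongrightarrow> 0" and A: "A \<in> sets borel"
  shows "(\<lambda>k. measure (\<mu> \<Otimes>\<^sub>M \<mu>) {z \<in> space (\<mu> \<Otimes>\<^sub>M \<mu>). (c k *\<^sub>R fst z + s k *\<^sub>R snd z \<in> A) \<noteq> (fst z \<in> A)}) \<longlonglongrightarrow> 0"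
proof -
  interpret prob_space \<mu> using \<mu> by (rule wiener_measureD)
  interpret Q: pair_prob_space \<mu> \<mu> ..
  have sets\<mu> [measurable_cong]: "sets \<mu> = sets borel" using \<mu> by (rule wiener_measureD)
  let ?P = "\<mu> \<Otimes>\<^sub>M \<mu>"
  define V where "V k z = c k *\<^sub>R fst z + s k *\<^sub>R snd z" for k and z :: "'n wiener \<times> 'n wiener"
  have V [measurable]: "V k \<in> ?P \<rightarrow>\<^sub>M borel" for k unfolding V_def[abs_def] by measurable
  have law: "distr ?P borel (V k) = \<mu>" for k
    using wiener_rotation[OF \<mu> cs, of k] by (simp add: V_def[abs_def] case_prod_beta')
  have mV: "measure ?P {z \<in> space ?P. V k z \<in> B} = measure \<mu> B" if "B \<in> sets borel" for k B
  proof -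
    have "measure \<mu> B = measure (distr ?P borel (V k)) B" by (simp only: law)
    also have "\<dots> = measure ?P (V k -` B \<inter> space ?P)" using that by (intro measure_distr) auto
    also have "V k -` B \<inter> space ?P = {z \<in> space ?P. V k z \<in> B}" by auto
    finally show ?thesis ..
  qed
  have lawfst: "distr ?P borel fst = \<mu>"
  proof -
    have "distr ?P borel fst = distr ?P \<mu> fst" by (intro distr_cong) (simp_all add: sets\<mu>)
    also have "\<dots> = \<mu>" by (rule distr_pair_fst)
    finally show ?thesis .
  qed
  have mfst: "measure ?P {z \<in> space ?P. fst z \<in> B} = measure \<mu> B" if "B \<in> sets borel" for B
  proof -
    have "measure \<mu> B = measure (distr ?P borel fst) B" by (simp only: lawfst)
    also have "\<dots> = measure ?P (fst -` B \<inter> space ?P)" using that by (intro measure_distr) auto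
    also have "fst -` B \<inter> space ?P = {z \<in> space ?P. fst z \<in> B}" by auto
    finally show ?thesis ..
  qed
  have Vlim: "(\<lambda>k. V k z) \<longlonglongrightarrow> fst z" for z
  proof -
    have "(\<lambda>k. c k *\<^sub>R fst z + s k *\<^sub>R snd z) \<longlonglongrightarrow> 1 *\<^sub>R fst z + 0 *\<^sub>R snd z"
      by (intro tendsto_intros lim)
    then show ?thesis by (simp add: V_def)
  qed
  define D where "D A k = {z \<in> space ?P. (V k z \<in> A) \<noteq> (fst z \<in> A)}" for A k
  have D [measurable]: "D A k \<in> sets ?P" if [measurable]: "A \<in> sets borel" for A k
    unfolding D_def by measurable
  have borel_eq: "sets (borel :: 'n wiener measure) = sigma_sets UNIV (Collect closed)"
    by (subst borel_eq_closed) simp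
  have "A \<in> sigma_sets UNIV (Collect closed)" using A borel_eq by simp
  then have "(\<lambda>k. measure ?P (D A k)) \<longlonglongrightarrow> 0"
  proof (induction rule: sigma_sets.induct)
    case (Basic A)
    then have "closed A" by simp
    then have [measurable]: "A \<in> sets borel" by (rule borel_closed)
    \<comment> \<open>\<open>V k\<close> and \<open>fst\<close> have the same law, so the two one-sided differences have the same measure,
      and for closed \<open>A\<close> one of them vanishes in the limit pointwise.\<close>
    define L where "L k = {z \<in> space ?P. V k z \<in> A \<and> fst z \<notin> A}" for k
    define B where "B k = {z \<in> space ?P. V k z \<in> A \<and> fst z \<in> A}" for k
    define R where "R k = {z \<in> space ?P. V k z \<notin> A \<and> fst z \<in> A}" for k
    have [measurable]: "L k \<in> sets ?P" "B k \<in> sets ?P" "R k \<in> sets ?P" for k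
      unfolding L_def B_def R_def by measurable
    have sums: "measure ?P {z \<in> space ?P. V k z \<in> A} = measure ?P (L k) + measure ?P (B k)"
      "measure ?P {z \<in> space ?P. fst z \<in> A} = measure ?P (R k) + measure ?P (B k)"
      "measure ?P (D A k) = measure ?P (L k) + measure ?P (R k)" for k
    proof -
      have "{z \<in> space ?P. V k z \<in> A} = L k \<union> B k" "{z \<in> space ?P. fst z \<in> A} = R k \<union> B k" "D A k = L k \<union> R k"
        "L k \<inter> B k = {}" "R k \<inter> B k = {}" "L k \<inter> R k = {}"
        by (auto simp: L_def B_def R_def D_def)
      then show "measure ?P {z \<in> space ?P. V k z \<in> A} = measure ?P (L k) + measure ?P (B k)"
        "measure ?P {z \<in> space ?P. fst z \<in> A} = measure ?P (R k) + measure ?P (B k)"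
        "measure ?P (D A k) = measure ?P (L k) + measure ?P (R k)"
        by (simp_all add: Q.P.finite_measure_Union)
    qed
    have RL: "measure ?P (R k) = measure ?P (L k)" for k
      using sums(1,2)[of k] mV[of A k] mfst[of A] by simp
    have eq: "measure ?P (D A k) = 2 * measure ?P (L k)" for k by (simp add: sums(3) RL)
    have "(\<lambda>k. LINT z|?P. indicator (L k) z) \<longlonglongrightarrow> (LINT z|?P. (0::real))"
    proof (rule integral_dominated_convergence[where w = "\<lambda>_. 1"])
      show "AE z in ?P. (\<lambda>k. indicator (L k) z :: real) \<longlonglongrightarrow> 0"
      proof (rule AE_I2)
        fix z
        have "\<forall>\<^sub>F k in sequentially. z \<notin> L k"
        proof (cases "fst z \<in> A")
          case False
          then have "\<forall>\<^sub>F k in sequentially. V k z \<in> - A"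
            using topological_tendstoD[OF Vlim[of z], of "- A"] \<open>closed A\<close> by auto
          then show ?thesis by eventually_elim (auto simp: L_def)
        qed (auto simp: L_def)
        then show "(\<lambda>k. indicator (L k) z :: real) \<longlonglongrightarrow> 0"
          by (intro tendsto_eventually) (auto elim!: eventually_mono)
      qed
    qed (auto simp: indicator_def)
    then have "(\<lambda>k. measure ?P (L k)) \<longlonglongrightarrow> 0" by simp
    then show ?case unfolding eq by (rule tendsto_mult_right_zero)
  next
    case Empty
    then show ?case by (simp add: D_def)
  next
    case (Compl A)
    have "D (UNIV - A) k = D A k" for k by (auto simp: D_def)
    then show ?case using Compl by simp
  next
    case (Union A)
    have A [measurable]: "A i \<in> sets borel" for i using Union(1) borel_eq by auto
    \<comment> \<open>The event that the rotated path lies in the tail \<open>T N\<close> has the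
      same probability as the event that w does. The tail can thus be neglected uniformly in
      k.\<close>
    define T where "T N = (\<Union>i. A i) - (\<Union>i<N. A i)" for N
    have T [measurable]: "T N \<in> sets borel" for N unfolding T_def by measurable
    have "(\<lambda>N. measure \<mu> (T N)) \<longlonglongrightarrow> measure \<mu> (\<Inter>N. T N)"
    proof (rule finite_Lim_measure_decseq)
      show "range T \<subseteq> sets \<mu>" using T by (auto simp: sets\<mu>)
      show "decseq T" by (rule decseq_SucI) (auto simp: T_def)
    qed
    also have "(\<Inter>N. T N) = {}" by (auto simp: T_def)
    finally have Tlim: "(\<lambda>N. measure \<mu> (T N)) \<longlonglongrightarrow> 0" by simp
    show ?case
    proof (rule LIMSEQ_I)
      fix e :: real assume "e > 0"
      then have "\<forall>\<^sub>F N in sequentially. measure \<mu> (T N) < e / 4"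
        by (intro order_tendstoD(2)[OF Tlim]) auto
      then obtain N where N: "measure \<mu> (T N) < e / 4" by (auto simp: eventually_sequentially)
      have "(\<lambda>k. \<Sum>i<N. measure ?P (D (A i) k)) \<longlonglongrightarrow> (\<Sum>i<N. 0)"
        using Union(2) by (intro tendsto_sum) auto
      then have "\<forall>\<^sub>F k in sequentially. (\<Sum>i<N. measure ?P (D (A i) k)) < e / 4"
        using \<open>e > 0\<close> by (intro order_tendstoD(2)[where y = 0]) auto
      then obtain K where K: "\<And>k. k \<ge> K \<Longrightarrow> (\<Sum>i<N. measure ?P (D (A i) k)) < e / 4"
        by (auto simp: eventually_sequentially)
      have "measure ?P (D (\<Union>i. A i) k) < e" if "k \<ge> K" for k
      proof -
        let ?TV = "{z \<in> space ?P. V k z \<in> T N}" and ?TF = "{z \<in> space ?P. fst z \<in> T N}"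
        have m: "?TV \<in> sets ?P" "?TF \<in> sets ?P" "(\<Union>i<N. D (A i) k) \<in> sets ?P" by measurable
        have "measure ?P (D (\<Union>i. A i) k) \<le> measure ?P ((\<Union>i<N. D (A i) k) \<union> (?TV \<union> ?TF))"
          using m by (intro Q.P.finite_measure_mono) (auto simp: D_def T_def)
        also have "\<dots> \<le> measure ?P (\<Union>i<N. D (A i) k) + measure ?P (?TV \<union> ?TF)"
          using m by (intro measure_Un_le) auto
        also have "measure ?P (?TV \<union> ?TF) \<le> measure ?P ?TV + measure ?P ?TF"
          using m by (intro measure_Un_le)
        also have "measure ?P (\<Union>i<N. D (A i) k) \<le> (\<Sum>i<N. measure ?P (D (A i) k))"
          by (intro measure_UNION_le) auto
        finally show ?thesis using N K[OF that] mV[OF T, of k N] mfst[OF T, of N] \<open>e > 0\<close> by simp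
      qed
      then show "\<exists>K. \<forall>k\<ge>K. norm (measure ?P (D (\<Union>i. A i) k) - 0) < e" by auto
    qed
  qed
  then show ?thesis by (simp add: D_def V_def)
qed

text \<open>Convergence in probability is upgraded by Borel-Cantelli along a diagonal subsequence
  that serves all of the countably many events.\<close>

lemma good_rotations:
  fixes \<mu> :: "'n::finite wiener measure" and \<S> :: "'n wiener set set"
  assumes \<mu>: "wiener_measure \<mu>" and S: "countable \<S>" "\<S> \<subseteq> sets borel"
  shows "\<exists>c s. (\<forall>k. 0 < c k \<and> 0 < s k \<and> (c k)\<^sup>2 + (s k)\<^sup>2 = 1) \<and> c \<longlonglongrightarrow> 1 \<and>
    (AE w in \<mu>. AE y in \<mu>. \<forall>A\<in>\<S>. \<forall>\<^sub>F k in sequentially. c k *\<^sub>R w + s k *\<^sub>R y \<in> A \<longleftrightarrow> w \<in> A)"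
proof -
  interpret prob_space \<mu> using \<mu> by (rule wiener_measureD)
  interpret Q: pair_prob_space \<mu> \<mu> ..
  have [measurable_cong]: "sets \<mu> = sets borel" using \<mu> by (rule wiener_measureD)
  let ?P = "\<mu> \<Otimes>\<^sub>M \<mu>"
  \<comment> \<open>The summand 2 keeps \<open>s0\<close> strictly below 1, hence \<open>c0\<close>
    strictly positive.\<close>
  define s0 where "s0 k = 1 / real (k + 2)" for k
  define c0 where "c0 k = sqrt (1 - (s0 k)\<^sup>2)" for k
  have s0: "0 < s0 k" "s0 k < 1" for k by (auto simp: s0_def)
  have "(s0 k)\<^sup>2 < 1" for k using s0[of k] by (simp add: abs_square_less_1)
  then have c0: "c0 k > 0" "(c0 k)\<^sup>2 + (s0 k)\<^sup>2 = 1" for k by (auto simp: c0_def less_imp_le)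
  have slim: "s0 \<longlonglongrightarrow> 0"
    unfolding s0_def by (rule LIMSEQ_ignore_initial_segment[OF lim_1_over_n])
  have "(\<lambda>k. sqrt (1 - (s0 k)\<^sup>2)) \<longlonglongrightarrow> sqrt (1 - 0\<^sup>2)" by (intro tendsto_intros slim)
  then have clim: "c0 \<longlonglongrightarrow> 1" by (simp add: c0_def[abs_def])
  obtain A :: "nat \<Rightarrow> 'n wiener set" where A: "\<S> \<subseteq> range A" "range A \<subseteq> sets borel"
  proof (cases "\<S> = {}")
    case True
    then show ?thesis using that[of "\<lambda>_. {}"] by auto
  next
    case False
    then show ?thesis using that[of "from_nat_into \<S>"] S by (auto simp: range_from_nat_into)
  qed
  have [measurable]: "A i \<in> sets borel" for i using A(2) by auto
  define D where "D i k = {z \<in> space ?P. (c0 k *\<^sub>R fst z + s0 k *\<^sub>R snd z \<in> A i) \<noteq> (fst z \<in> A i)}" for i k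
  have Dm [measurable]: "D i k \<in> sets ?P" for i k unfolding D_def by measurable
  have Dlim: "(\<lambda>k. measure ?P (D i k)) \<longlonglongrightarrow> 0" for i
    unfolding D_def by (rule rotation_limit_sets[OF \<mu> c0(1) s0(1) c0(2) clim slim]) simp
  \<comment> \<open>The k-th rotation treats the events with index at most k with error below
    \<open>(1 / 2) ^ k\<close>. Each event is thus included from some k on, with summable
    errors.\<close>
  have "\<exists>n\<ge>k. \<forall>i\<in>{..k}. measure ?P (D i n) < (1 / 2) ^ k" for k
  proof -
    have "\<forall>\<^sub>F n in sequentially. \<forall>i\<in>{..k}. measure ?P (D i n) < (1 / 2) ^ k"
      by (intro eventually_ball_finite ballI order_tendstoD(2)[OF Dlim]) auto
    then obtain N where "\<And>n. n \<ge> N \<Longrightarrow> \<forall>i\<in>{..k}. measure ?P (D i n) < (1 / 2) ^ k"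
      by (auto simp: eventually_sequentially)
    then show ?thesis by (intro exI[of _ "max k N"]) auto
  qed
  then obtain r where r: "\<And>k. r k \<ge> k" "\<And>k i. i \<le> k \<Longrightarrow> measure ?P (D i (r k)) < (1 / 2) ^ k"
    by (metis atMost_iff)
  have rlim: "filterlim r at_top sequentially"
    by (rule filterlim_at_top_mono[OF filterlim_ident]) (simp add: r(1))
  have "AE z in ?P. \<forall>\<^sub>F k in sequentially. z \<in> space ?P - D i (r k)" for i
  proof (rule borel_cantelli_AE1)
    show "summable (\<lambda>k. measure ?P (D i (r k)))"
    proof (rule summable_comparison_test_ev)
      show "\<forall>\<^sub>F k in sequentially. norm (measure ?P (D i (r k))) \<le> (1 / 2) ^ k"
        using eventually_ge_at_top[of i] by eventually_elim (use r(2) in \<open>auto simp: less_imp_le\<close>)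
    qed (simp add: summable_geometric)
  qed (simp_all add: Q.P.emeasure_eq_measure)
  then have "AE z in ?P. \<forall>i. \<forall>\<^sub>F k in sequentially. z \<in> space ?P - D i (r k)"
    by (simp add: AE_all_countable)
  then have "AE z in ?P. \<forall>i. \<forall>\<^sub>F k in sequentially. (c0 (r k) *\<^sub>R fst z + s0 (r k) *\<^sub>R snd z \<in> A i) \<longleftrightarrow> (fst z \<in> A i)"
    by eventually_elim (auto simp: D_def elim!: eventually_mono)
  then have "AE w in \<mu>. AE y in \<mu>. \<forall>i. \<forall>\<^sub>F k in sequentially. (c0 (r k) *\<^sub>R w + s0 (r k) *\<^sub>R y \<in> A i) \<longleftrightarrow> (w \<in> A i)"
    by (auto dest!: Q.AE_pair)
  then have "AE w in \<mu>. AE y in \<mu>. \<forall>B\<in>\<S>. \<forall>\<^sub>F k in sequentially. c0 (r k) *\<^sub>R w + s0 (r k) *\<^sub>R y \<in> B \<longleftrightarrow> w \<in> B"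
  proof eventually_elim
    case (elim w)
    then show ?case by eventually_elim (use A(1) in blast)
  qed
  then show ?thesis
    using c0 s0 filterlim_compose[OF clim rlim]
    by (intro exI[of _ "\<lambda>k. c0 (r k)"] exI[of _ "\<lambda>k. s0 (r k)"]) auto
qed

section \<open>Uniform continuity on balls, tested on a dense set\<close>

lemma uniformly_continuous_imp_bounded_cball:
  fixes F :: "'h::real_normed_vector \<Rightarrow> 'y::real_normed_vector"
  assumes uc: "uniformly_continuous_on (cball 0 m) F"
  obtains K :: nat where "\<And>a. a \<in> cball 0 m \<Longrightarrow> norm (F a) \<le> real K"
proof -
  obtain d where d: "d > 0" "\<And>a b. a \<in> cball 0 m \<Longrightarrow> b \<in> cball 0 m \<Longrightarrow> dist a b < d \<Longrightarrow> dist (F a) (F b) < 1"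
    using uc unfolding uniformly_continuous_on_def by (metis zero_less_one)
  obtain N :: nat where N: "m / d < real N" using reals_Archimedean2 by blast
  obtain K :: nat where K: "norm (F 0) + real (Suc N) \<le> real K" using real_arch_simple by blast
  have "norm (F a) \<le> real K" if a: "a \<in> cball 0 m" for a
  proof -
    \<comment> \<open>Balls of H need not be compact, so boundedness comes from chaining: the
      segment from 0 to a is cut into \<open>Suc N\<close> pieces shorter than d, with N independent
      of a, and each piece raises the norm by less than 1.\<close>
    let ?x = "\<lambda>i. (real i / real (Suc N)) *\<^sub>R a"
    have na: "norm a \<le> m" using a by simp
    have x: "?x i \<in> cball 0 m" if "i \<le> Suc N" for i
    proof -
      have "real i / real (Suc N) \<le> 1" using that by (simp add: divide_le_eq)
      then have "real i / real (Suc N) * norm a \<le> 1 * norm a" by (intro mult_right_mono) auto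
      then show ?thesis using na by simp
    qed
    have "norm (F (?x i)) \<le> norm (F 0) + real i" if "i \<le> Suc N" for i
      using that
    proof (induction i)
      case (Suc i)
      have "?x (Suc i) - ?x i = (1 / real (Suc N)) *\<^sub>R a"
        by (simp add: scaleR_diff_left[symmetric] diff_divide_distrib[symmetric])
      then have "dist (?x (Suc i)) (?x i) = norm a / real (Suc N)"
        by (simp add: dist_norm)
      also have "\<dots> \<le> m / real (Suc N)" using na by (intro divide_right_mono) auto
      also have "\<dots> < d" using N d(1) by (simp add: field_simps)
      finally have "dist (F (?x (Suc i))) (F (?x i)) < 1" using Suc.prems by (intro d(2) x) auto
      then have "norm (F (?x (Suc i)) - F (?x i)) < 1" by (simp add: dist_norm)
      moreover have "norm (F (?x i)) \<le> norm (F 0) + real i" using Suc by simp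
      moreover have "norm (F (?x (Suc i))) \<le> norm (F (?x (Suc i)) - F (?x i)) + norm (F (?x i))"
        using norm_triangle_ineq[of "F (?x (Suc i)) - F (?x i)" "F (?x i)"] by simp
      ultimately show ?case by simp
    qed simp
    from this[of "Suc N"] show ?thesis using K by simp
  qed
  then show ?thesis by (rule that)
qed

lemma dense_sequence:
  fixes Q :: "'h::metric_space set"
  assumes "closure Q = UNIV" "a \<in> U" "open U"
  obtains q where "\<And>i. q i \<in> Q \<inter> U" "q \<longlonglongrightarrow> a"
proof -
  have "a \<in> closure (Q \<inter> U)"
    using open_Int_closure_subset[OF assms(3), of Q] assms(1,2) by (auto simp: Int_commute)
  then show ?thesis unfolding closure_sequential using that by blast
qed

text \<open>One entry of a modulus of continuity, with countably many scales in total. On a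
  countable set D it is a countable list of conditions. The strict inequality for the arguments is
  open and the weak one for the values is closed, so the property passes from a dense subset to an
  open set for continuous functions.\<close>

definition equicontinuous_at_scale :: "'h::metric_space set \<Rightarrow> ('h \<Rightarrow> 'y::real_normed_vector) \<Rightarrow> nat \<Rightarrow> nat \<Rightarrow> bool" where
  "equicontinuous_at_scale D \<Gamma> j l \<longleftrightarrow>
     (\<forall>a\<in>D. \<forall>b\<in>D. dist a b < 1 / real (Suc j) \<longrightarrow> norm (\<Gamma> a - \<Gamma> b) \<le> 1 / real (Suc l))"

lemma equicontinuous_at_scale_dense:
  fixes Q :: "'h::metric_space set"
  assumes Q: "closure Q = UNIV" and U: "open U" and cont: "continuous_on UNIV \<Gamma>"
    and eq: "equicontinuous_at_scale (Q \<inter> U) \<Gamma> j l"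
  shows "equicontinuous_at_scale U \<Gamma> j l"
  unfolding equicontinuous_at_scale_def
proof (intro ballI impI)
  fix a b assume a: "a \<in> U" and b: "b \<in> U" and ab: "dist a b < 1 / real (Suc j)"
  obtain p where p: "\<And>i. p i \<in> Q \<inter> U" "p \<longlonglongrightarrow> a" using dense_sequence[OF Q a U] by blast
  obtain q where q: "\<And>i. q i \<in> Q \<inter> U" "q \<longlonglongrightarrow> b" using dense_sequence[OF Q b U] by blast
  have "(\<lambda>i. dist (p i) (q i)) \<longlonglongrightarrow> dist a b" by (intro tendsto_dist p q)
  then have "\<forall>\<^sub>F i in sequentially. dist (p i) (q i) < 1 / real (Suc j)" using ab by (rule order_tendstoD)
  then have ev: "\<forall>\<^sub>F i in sequentially. norm (\<Gamma> (p i) - \<Gamma> (q i)) \<le> 1 / real (Suc l)"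
    by eventually_elim (use eq p(1) q(1) in \<open>auto simp: equicontinuous_at_scale_def\<close>)
  have "(\<lambda>i. norm (\<Gamma> (p i) - \<Gamma> (q i))) \<longlonglongrightarrow> norm (\<Gamma> a - \<Gamma> b)"
    by (intro tendsto_norm tendsto_diff continuous_on_tendsto_compose[OF cont] p q) auto
  then show "norm (\<Gamma> a - \<Gamma> b) \<le> 1 / real (Suc l)" using ev by (rule tendsto_upperbound) simp
qed

lemma norm_le_dense:
  fixes Q :: "'h::metric_space set"
  assumes Q: "closure Q = UNIV" and U: "open U" and cont: "continuous_on UNIV \<Gamma>"
    and le: "\<And>a. a \<in> Q \<inter> U \<Longrightarrow> norm (\<Gamma> a) \<le> K" and a: "a \<in> U"
  shows "norm (\<Gamma> a) \<le> K"
proof -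
  obtain p where p: "\<And>i. p i \<in> Q \<inter> U" "p \<longlonglongrightarrow> a" using dense_sequence[OF Q a U] by blast
  have "(\<lambda>i. norm (\<Gamma> (p i))) \<longlonglongrightarrow> norm (\<Gamma> a)"
    by (intro tendsto_norm continuous_on_tendsto_compose[OF cont] p) auto
  then show ?thesis using le[OF p(1)] by (intro LIMSEQ_le_const2) auto
qed

section \<open>Construction of the H-derivative\<close>

definition H_regular :: "('n::finite wiener \<Rightarrow> 'y::real_normed_vector) \<Rightarrow> 'n wiener \<Rightarrow> bool" where
  "H_regular g w \<longleftrightarrow> (\<forall>m::nat. 1 \<le> m \<longrightarrow> uniformly_continuous_on (cball 0 (real m)) (\<lambda>h. g (w + cm_path h)))"

lemma H_regular_continuous:
  assumes "H_regular g w"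
  shows "continuous_on UNIV (\<lambda>h. g (w + cm_path h))"
proof -
  have "isCont (\<lambda>h. g (w + cm_path h)) h" for h
  proof -
    obtain m :: nat where "norm h < real m" using reals_Archimedean2 by blast
    then have m: "1 \<le> m" "h \<in> ball 0 (real m)" using norm_ge_zero[of h] by (auto simp del: norm_ge_zero intro: Suc_leI)
    have "continuous_on (cball 0 (real m)) (\<lambda>h. g (w + cm_path h))"
      using assms m(1) by (auto simp: H_regular_def intro: uniformly_continuous_imp_continuous)
    then have "continuous_on (ball 0 (real m)) (\<lambda>h. g (w + cm_path h))"
      by (rule continuous_on_subset) (rule ball_subset_cball)
    then show ?thesis using m(2) by (simp add: continuous_on_eq_continuous_at)
  qed
  then show ?thesis by (simp add: continuous_on_eq_continuous_at)
qed

lemma continuous_cm_line: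
  assumes "continuous_on UNIV (\<lambda>h. g (w + cm_path h))"
  shows "continuous_on UNIV (\<lambda>\<sigma>::real. g (w + cm_path h + \<sigma> *\<^sub>R cm_path k))"
proof -
  have "continuous_on UNIV (\<lambda>\<sigma>::real. h + \<sigma> *\<^sub>R k)" by (intro continuous_intros)
  from continuous_on_compose2[OF assms this] show ?thesis by (simp add: add.assoc)
qed

lemma continuous_hs_apply_line:
  assumes "continuous_on UNIV (\<lambda>\<sigma>::real. g (w + cm_path h + \<sigma> *\<^sub>R cm_path k))"
  shows "continuous_on UNIV (\<lambda>\<sigma>. hs_apply (g (w + cm_path h + \<sigma> *\<^sub>R cm_path k)) l)"
  by (rule continuous_on_compose2[OF linear_continuous_on[OF bounded_linear_hs_eval] assms]) auto

lemma set_integrable_continuous: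
  fixes u :: "real \<Rightarrow> 'x::{banach, second_countable_topology}"
  assumes "continuous_on UNIV u"
  shows "set_integrable lborel {0..1} u"
  unfolding set_integrable_def
  by (intro borel_integrable_compact) (auto intro: continuous_on_subset[OF assms])

lemma set_integral_const_unit:
  fixes a :: "'x::{banach, second_countable_topology}"
  shows "(LBINT \<sigma>:{0..1::real}. a) = a"
  unfolding set_lebesgue_integral_def by (subst Bochner_Integration.integral_scaleR_left) auto

text \<open>The remainder of the linear approximation is the mean of
  \<open>\<Gamma> (h + \<sigma> *\<^sub>R k) - \<Gamma> h\<close> along the segment, applied to k,
  and continuity of \<Gamma> at h makes this o(k).\<close>

lemma has_derivative_line_integral:
  fixes \<phi> :: "'n::finite cameron_martin \<Rightarrow> 'x::{real_inner, banach, second_countable_topology}"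
  assumes cont: "continuous_on UNIV \<Gamma>"
    and line: "\<And>h k. \<phi> (h + k) - \<phi> h = (LBINT \<sigma>:{0..1}. hs_apply (\<Gamma> (h + \<sigma> *\<^sub>R k)) k)"
  shows "(\<phi> has_derivative hs_apply (\<Gamma> h)) (at h)"
  unfolding has_derivative_at_alt
proof (intro conjI allI impI bounded_linear_hs_apply)
  fix e :: real assume "e > 0"
  then obtain d where d: "d > 0" "\<And>z. dist z h < d \<Longrightarrow> dist (\<Gamma> z) (\<Gamma> h) < e"
    using cont unfolding continuous_on_iff by (metis UNIV_I)
  have "norm (\<phi> y - \<phi> h - hs_apply (\<Gamma> h) (y - h)) \<le> e * norm (y - h)" if y: "norm (y - h) < d" for y
  proof -
    define k where "k = y - h"
    have "continuous_on UNIV (\<lambda>\<sigma>::real. \<Gamma> (h + \<sigma> *\<^sub>R k))"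
      by (rule continuous_on_compose2[OF cont]) (auto intro!: continuous_intros)
    then have c: "continuous_on UNIV (\<lambda>\<sigma>::real. hs_apply (\<Gamma> (h + \<sigma> *\<^sub>R k)) k)"
      by (rule continuous_on_compose2[OF linear_continuous_on[OF bounded_linear_hs_eval], of UNIV]) auto
    have i1: "set_integrable lborel {0..1} (\<lambda>\<sigma>::real. hs_apply (\<Gamma> (h + \<sigma> *\<^sub>R k)) k)"
      using c by (rule set_integrable_continuous)
    have i2: "set_integrable lborel {0..1} (\<lambda>\<sigma>::real. hs_apply (\<Gamma> h) k)"
      by (rule set_integrable_continuous) (rule continuous_on_const)
    have c0: "(LBINT \<sigma>:{0..1::real}. hs_apply (\<Gamma> h) k) = hs_apply (\<Gamma> h) k"
      by (rule set_integral_const_unit)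
    have "\<phi> y - \<phi> h - hs_apply (\<Gamma> h) (y - h) = (LBINT \<sigma>:{0..1}. hs_apply (\<Gamma> (h + \<sigma> *\<^sub>R k)) k - hs_apply (\<Gamma> h) k)"
      unfolding set_integral_diff(2)[OF i1 i2] c0 using line[of h k] by (simp add: k_def)
    also have "norm \<dots> \<le> (LBINT \<sigma>:{0..1::real}. e * norm k)"
      unfolding set_lebesgue_integral_def
    proof (rule Bochner_Integration.integral_norm_bound_integral)
      show "integrable lborel (\<lambda>\<sigma>::real. indicator {0..1} \<sigma> *\<^sub>R (hs_apply (\<Gamma> (h + \<sigma> *\<^sub>R k)) k - hs_apply (\<Gamma> h) k))"
        using set_integral_diff(1)[OF i1 i2] by (simp add: set_integrable_def)
      show "integrable lborel (\<lambda>\<sigma>::real. indicator {0..1} \<sigma> *\<^sub>R (e * norm k))"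
        by simp
      fix \<sigma> :: real
      show "norm (indicator {0..1} \<sigma> *\<^sub>R (hs_apply (\<Gamma> (h + \<sigma> *\<^sub>R k)) k - hs_apply (\<Gamma> h) k)) \<le> indicator {0..1} \<sigma> *\<^sub>R (e * norm k)"
      proof (cases "\<sigma> \<in> {0..1}")
        case True
        have "dist (h + \<sigma> *\<^sub>R k) h = \<bar>\<sigma>\<bar> * norm k" by (simp add: dist_norm)
        also have "\<dots> \<le> norm k" using True by (simp add: mult_left_le_one_le)
        also have "\<dots> < d" using y by (simp add: k_def)
        finally have "norm (\<Gamma> (h + \<sigma> *\<^sub>R k) - \<Gamma> h) \<le> e"
          using d(2)[of "h + \<sigma> *\<^sub>R k"] by (simp add: dist_norm)
        then have "norm (\<Gamma> (h + \<sigma> *\<^sub>R k) - \<Gamma> h) * norm k \<le> e * norm k" by (intro mult_right_mono) auto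
        then show ?thesis
          using norm_hs_apply_le[of "\<Gamma> (h + \<sigma> *\<^sub>R k) - \<Gamma> h" k] True by simp
      qed simp
    qed
    also have "\<dots> = e * norm k" by (rule set_integral_const_unit)
    finally show ?thesis by (simp add: k_def)
  qed
  then show "\<exists>d>0. \<forall>y. norm (y - h) < d \<longrightarrow> norm (\<phi> y - \<phi> h - hs_apply (\<Gamma> h) (y - h)) \<le> e * norm (y - h)"
    using d(1) by blast
qed

text \<open>Used with the gradient translated to the rotated paths as \<Gamma> and the gradient
  translated to w as \<open>\<Gamma>\<^sub>0\<close>. The assumptions \<open>ev_eval\<close>,
  \<open>ev_equi\<close> and \<open>ev_bdd\<close> are what stabilisation of countably many events
  can provide: convergence of evaluations on Q, and properties of the limit field on Q that the
  approximating fields eventually share.\<close>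

locale field_convergence =
  fixes Q :: "'n::finite cameron_martin set"
    and \<Gamma> :: "nat \<Rightarrow> 'n cameron_martin \<Rightarrow> ('n cameron_martin, 'x::real_inner) hilbert_schmidt"
    and \<Gamma>\<^sub>0 :: "'n cameron_martin \<Rightarrow> ('n cameron_martin, 'x) hilbert_schmidt"
  assumes dense: "closure Q = UNIV"
    and cont: "\<And>n. continuous_on UNIV (\<Gamma> n)"
    and uc: "\<And>m::nat. uniformly_continuous_on (ball 0 (real m)) \<Gamma>\<^sub>0"
    and bdd: "\<And>m::nat. \<exists>K::nat. \<forall>a\<in>ball 0 (real m). norm (\<Gamma>\<^sub>0 a) \<le> real K"
    and ev_eval: "\<And>a b. a \<in> Q \<Longrightarrow> b \<in> Q \<Longrightarrow> (\<lambda>n. hs_apply (\<Gamma> n a) b) \<longlonglongrightarrow> hs_apply (\<Gamma>\<^sub>0 a) b"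
    and ev_equi: "\<And>m j l::nat. equicontinuous_at_scale (Q \<inter> ball 0 (real m)) \<Gamma>\<^sub>0 j l \<Longrightarrow>
      \<forall>\<^sub>F n in sequentially. equicontinuous_at_scale (Q \<inter> ball 0 (real m)) (\<Gamma> n) j l"
    and ev_bdd: "\<And>m K::nat. \<forall>a\<in>Q \<inter> ball 0 (real m). norm (\<Gamma>\<^sub>0 a) \<le> real K \<Longrightarrow>
      \<forall>\<^sub>F n in sequentially. \<forall>a\<in>Q \<inter> ball 0 (real m). norm (\<Gamma> n a) \<le> real K"
begin

lemma eventually_bounded:
  "\<exists>K::nat. (\<forall>a\<in>ball 0 (real m). norm (\<Gamma>\<^sub>0 a) \<le> real K) \<and>
    (\<forall>\<^sub>F n in sequentially. \<forall>a\<in>ball 0 (real m). norm (\<Gamma> n a) \<le> real K)"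
proof -
  obtain K :: nat where K: "\<forall>a\<in>ball 0 (real m). norm (\<Gamma>\<^sub>0 a) \<le> real K" using bdd by blast
  then have "\<forall>\<^sub>F n in sequentially. \<forall>a\<in>Q \<inter> ball 0 (real m). norm (\<Gamma> n a) \<le> real K"
    by (intro ev_bdd) auto
  then have "\<forall>\<^sub>F n in sequentially. \<forall>a\<in>ball 0 (real m). norm (\<Gamma> n a) \<le> real K"
    by eventually_elim (use norm_le_dense[OF dense open_ball cont] in blast)
  then show ?thesis using K by blast
qed

lemma eventually_equicontinuous:
  obtains j :: nat where "equicontinuous_at_scale (ball 0 (real m)) \<Gamma>\<^sub>0 j l"
    "\<forall>\<^sub>F n in sequentially. equicontinuous_at_scale (ball 0 (real m)) (\<Gamma> n) j l"
proof -
  have "0 < 1 / real (Suc l)" by simp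
  then obtain d where d: "d > 0" "\<And>a b. a \<in> ball 0 (real m) \<Longrightarrow> b \<in> ball 0 (real m) \<Longrightarrow> dist a b < d \<Longrightarrow> dist (\<Gamma>\<^sub>0 a) (\<Gamma>\<^sub>0 b) < 1 / real (Suc l)"
    using uc[of m] unfolding uniformly_continuous_on_def by metis
  obtain j where j: "1 / real (Suc j) < d" using reals_Archimedean[OF d(1)] by (auto simp: inverse_eq_divide)
  have 0: "equicontinuous_at_scale (ball 0 (real m)) \<Gamma>\<^sub>0 j l"
    unfolding equicontinuous_at_scale_def
  proof (intro ballI impI)
    fix a b :: "'n cameron_martin" assume "a \<in> ball 0 (real m)" "b \<in> ball 0 (real m)" "dist a b < 1 / real (Suc j)"
    then have "dist (\<Gamma>\<^sub>0 a) (\<Gamma>\<^sub>0 b) < 1 / real (Suc l)" using j by (intro d(2)) auto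
    then show "norm (\<Gamma>\<^sub>0 a - \<Gamma>\<^sub>0 b) \<le> 1 / real (Suc l)" by (simp add: dist_norm)
  qed
  then have "equicontinuous_at_scale (Q \<inter> ball 0 (real m)) \<Gamma>\<^sub>0 j l"
    by (simp add: equicontinuous_at_scale_def)
  from ev_equi[OF this] have "\<forall>\<^sub>F n in sequentially. equicontinuous_at_scale (ball 0 (real m)) (\<Gamma> n) j l"
    by eventually_elim (rule equicontinuous_at_scale_dense[OF dense open_ball cont])
  with 0 show ?thesis by (rule that)
qed

text \<open>Arguments and directions may vary with n because the rotation multiplies shifts by c_n.
  Both are moved into Q: the argument by equicontinuity, the direction by the uniform bound K. The
  five error terms are the two moves for the n-th field, the convergence on Q, and the two moves
  back for the limit field.\<close>

lemma eval_tendsto: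
  assumes a: "A \<longlonglongrightarrow> a" and b: "B \<longlonglongrightarrow> b"
  shows "(\<lambda>n. hs_apply (\<Gamma> n (A n)) (B n)) \<longlonglongrightarrow> hs_apply (\<Gamma>\<^sub>0 a) b"
proof (rule tendstoI)
  fix e :: real assume "e > 0"
  define \<epsilon> where "\<epsilon> = e / 5"
  have \<epsilon>: "\<epsilon> > 0" "e = \<epsilon> + \<epsilon> + \<epsilon> + \<epsilon> + \<epsilon>" using \<open>e > 0\<close> by (auto simp: \<epsilon>_def)
  obtain m :: nat where m: "norm a < real m" using reals_Archimedean2 by blast
  let ?U = "ball 0 (real m) :: 'n cameron_martin set"
  obtain K :: nat where K0: "\<forall>a\<in>?U. norm (\<Gamma>\<^sub>0 a) \<le> real K"
    and K2: "\<forall>\<^sub>F n in sequentially. \<forall>a\<in>?U. norm (\<Gamma> n a) \<le> real K"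
    using eventually_bounded[of m] by (elim exE conjE)
  \<comment> \<open>The directions \<open>B n\<close> converge to b, so their norms are eventually
    below \<open>norm b + 1\<close>; the modulus must beat this factor.\<close>
  have "\<epsilon> / (norm b + 1) > 0" using \<epsilon>(1) norm_ge_zero[of b] by (intro divide_pos_pos) linarith+
  then obtain l where l: "1 / real (Suc l) < \<epsilon> / (norm b + 1)"
    using reals_Archimedean by (auto simp: inverse_eq_divide)
  have l': "1 / real (Suc l) * x < \<epsilon>" if "0 \<le> x" "x \<le> norm b + 1" for x
  proof -
    have "1 / real (Suc l) * x \<le> 1 / real (Suc l) * (norm b + 1)" using that by (intro mult_left_mono) auto
    also have "\<dots> < \<epsilon>" using l norm_ge_zero[of b] by (simp add: pos_less_divide_eq del: norm_ge_zero of_nat_Suc)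
    finally show ?thesis .
  qed
  obtain j :: nat where j: "equicontinuous_at_scale ?U \<Gamma>\<^sub>0 j l"
    "\<forall>\<^sub>F n in sequentially. equicontinuous_at_scale ?U (\<Gamma> n) j l" by (rule eventually_equicontinuous[where m = m and l = l])
  \<comment> \<open>The second bound forces \<open>a'\<close> into the same open ball as a, where
    equicontinuity and the bound K are available.\<close>
  have "a \<in> closure Q" "0 < min (1 / real (Suc j)) (real m - norm a)" using m by (simp_all add: dense)
  then obtain a' where a'Q: "a' \<in> Q" and near: "dist a' a < min (1 / real (Suc j)) (real m - norm a)"
    unfolding closure_approachable by blast
  have a': "a' \<in> Q" "a' \<in> ?U" "dist a a' < 1 / real (Suc j)"
    using a'Q near norm_triangle_ineq[of a "a' - a"] by (simp_all add: dist_commute dist_norm norm_minus_commute[of a a'] del: of_nat_Suc)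
  define \<eta> where "\<eta> = \<epsilon> / (real K + 1)"
  have \<eta>: "\<eta> > 0" using \<epsilon>(1) by (simp add: \<eta>_def)
  have K\<eta>: "real K * x < \<epsilon>" if "0 \<le> x" "x < \<eta>" for x
  proof -
    have "real K * x \<le> (real K + 1) * x" using that by (intro mult_right_mono) auto
    also have "\<dots> < (real K + 1) * \<eta>" using that by (intro mult_strict_left_mono) auto
    finally show ?thesis by (simp add: \<eta>_def)
  qed
  have "b \<in> closure Q" by (simp add: dense)
  then obtain b' where b': "b' \<in> Q" "dist b' b < \<eta>" using \<eta> unfolding closure_approachable by blast
  have 1: "\<forall>\<^sub>F n in sequentially. dist (A n) a' < 1 / real (Suc j)"
    using a'(3) by (intro order_tendstoD(2)[OF tendsto_dist[OF a tendsto_const]])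
  have 2: "\<forall>\<^sub>F n in sequentially. A n \<in> ?U" using m by (intro topological_tendstoD[OF a]) auto
  have 3: "\<forall>\<^sub>F n in sequentially. norm (B n) < norm b + 1"
    by (intro order_tendstoD(2)[OF tendsto_norm[OF b]]) simp
  have 4: "\<forall>\<^sub>F n in sequentially. norm (B n - b') < \<eta>"
    using b'(2) by (intro order_tendstoD(2)[OF tendsto_norm[OF tendsto_diff[OF b tendsto_const]]])
      (simp add: dist_norm norm_minus_commute)
  have 5: "\<forall>\<^sub>F n in sequentially. dist (hs_apply (\<Gamma> n a') b') (hs_apply (\<Gamma>\<^sub>0 a') b') < \<epsilon>"
    using ev_eval[OF a'(1) b'(1)] \<epsilon>(1) by (rule tendstoD)
  have lin: "hs_apply T (x - y) = hs_apply T x - hs_apply T y" for T :: "('n cameron_martin, 'x) hilbert_schmidt" and x y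
    using linear_diff[OF bounded_linear.linear[OF bounded_linear_hs_apply[of T]]] .
  show "\<forall>\<^sub>F n in sequentially. dist (hs_apply (\<Gamma> n (A n)) (B n)) (hs_apply (\<Gamma>\<^sub>0 a) b) < e"
    using K2 j(2) 1 2 3 4 5
  proof eventually_elim
    case (elim n)
    have "norm (\<Gamma> n (A n) - \<Gamma> n a') \<le> 1 / real (Suc l)"
      using elim(2,3,4) a'(2) unfolding equicontinuous_at_scale_def by blast
    then have "norm (hs_apply (\<Gamma> n (A n) - \<Gamma> n a') (B n)) \<le> 1 / real (Suc l) * norm (B n)"
      by (intro order_trans[OF norm_hs_apply_le] mult_right_mono) auto
    also have "\<dots> < \<epsilon>" using elim(5) by (intro l') auto
    finally have t1: "norm (hs_apply (\<Gamma> n (A n)) (B n) - hs_apply (\<Gamma> n a') (B n)) < \<epsilon>" by simp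
    have "norm (hs_apply (\<Gamma> n a') (B n - b')) \<le> real K * norm (B n - b')"
      using elim(1) a'(2) by (intro order_trans[OF norm_hs_apply_le] mult_right_mono) auto
    also have "\<dots> < \<epsilon>" using elim(6) by (intro K\<eta>) auto
    finally have t2: "norm (hs_apply (\<Gamma> n a') (B n) - hs_apply (\<Gamma> n a') b') < \<epsilon>" by (simp only: lin)
    have t3: "norm (hs_apply (\<Gamma> n a') b' - hs_apply (\<Gamma>\<^sub>0 a') b') < \<epsilon>" using elim(7) by (simp only: dist_norm)
    have "norm (hs_apply (\<Gamma>\<^sub>0 a') (b' - b)) \<le> real K * norm (b' - b)"
      using bspec[OF K0 a'(2)] by (intro order_trans[OF norm_hs_apply_le] mult_right_mono) auto
    also have "\<dots> < \<epsilon>" using b'(2) by (intro K\<eta>) (auto simp: dist_norm)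
    finally have t4: "norm (hs_apply (\<Gamma>\<^sub>0 a') b' - hs_apply (\<Gamma>\<^sub>0 a') b) < \<epsilon>" by (simp only: lin)
    have "norm (\<Gamma>\<^sub>0 a' - \<Gamma>\<^sub>0 a) \<le> 1 / real (Suc l)"
      using j(1) a'(2,3) m unfolding equicontinuous_at_scale_def by (simp add: dist_commute del: of_nat_Suc)
    then have "norm (hs_apply (\<Gamma>\<^sub>0 a' - \<Gamma>\<^sub>0 a) b) \<le> 1 / real (Suc l) * norm b"
      by (intro order_trans[OF norm_hs_apply_le] mult_right_mono) auto
    also have "\<dots> < \<epsilon>" by (intro l') auto
    finally have t5: "norm (hs_apply (\<Gamma>\<^sub>0 a') b - hs_apply (\<Gamma>\<^sub>0 a) b) < \<epsilon>" by simp
    have tri: "norm (x1 - x6) \<le> norm (x1 - x2) + norm (x2 - x3) + norm (x3 - x4) + norm (x4 - x5) + norm (x5 - x6)"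
      for x1 x2 x3 x4 x5 x6 :: 'x by norm
    show ?case
      unfolding dist_norm \<epsilon>(2)
      using tri[of "hs_apply (\<Gamma> n (A n)) (B n)" "hs_apply (\<Gamma>\<^sub>0 a) b" "hs_apply (\<Gamma> n a') (B n)"
        "hs_apply (\<Gamma> n a') b'" "hs_apply (\<Gamma>\<^sub>0 a') b'" "hs_apply (\<Gamma>\<^sub>0 a') b"] t1 t2 t3 t4 t5
      by linarith
  qed
qed

end

text \<open>A dense set meets open balls densely, which is why open balls replace the closed ones.
  The closed ball of radius \<open>Suc m\<close> contains the open one of radius m and covers m = 0
  as well.\<close>

lemma H_regular_ball:
  fixes g :: "'n::finite wiener \<Rightarrow> 'y::real_normed_vector" and m :: nat
  assumes "H_regular g w"
  shows "uniformly_continuous_on (ball 0 (real m)) (\<lambda>h. g (w + cm_path h))"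
    and "\<exists>K::nat. \<forall>a\<in>ball 0 (real m). norm (g (w + cm_path a)) \<le> real K"
proof -
  have uc: "uniformly_continuous_on (cball 0 (real (Suc m))) (\<lambda>h. g (w + cm_path h))"
    using assms by (simp add: H_regular_def del: of_nat_Suc)
  have sub: "ball 0 (real m) \<subseteq> (cball 0 (real (Suc m)) :: 'n cameron_martin set)" by auto
  show "uniformly_continuous_on (ball 0 (real m)) (\<lambda>h. g (w + cm_path h))"
    using uc sub unfolding uniformly_continuous_on_def by (meson subsetD)
  obtain K :: nat where "\<And>a. a \<in> cball 0 (real (Suc m)) \<Longrightarrow> norm (g (w + cm_path a)) \<le> real K"
    using uniformly_continuous_imp_bounded_cball[OF uc] by blast
  then show "\<exists>K::nat. \<forall>a\<in>ball 0 (real m). norm (g (w + cm_path a)) \<le> real K" using sub by blast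
qed

text \<open>Reads convergence of a function off its preimages of basic open sets. For a countable
  basis these are countably many events, to which \<open>good_rotations\<close> applies.\<close>

lemma tendsto_preimages:
  fixes u :: "'w \<Rightarrow> 'x::topological_space"
  assumes B: "topological_basis B" and ev: "\<And>V. V \<in> B \<Longrightarrow> \<forall>\<^sub>F n in sequentially. u (x n) \<in> V \<longleftrightarrow> u y \<in> V"
  shows "(\<lambda>n. u (x n)) \<longlonglongrightarrow> u y"
proof (rule topological_tendstoI)
  fix S assume "open S" "u y \<in> S"
  then obtain V where V: "V \<in> B" "u y \<in> V" "V \<subseteq> S" using topological_basisE[OF B] by metis
  from ev[OF V(1)] show "\<forall>\<^sub>F n in sequentially. u (x n) \<in> S" by eventually_elim (use V in auto)
qed

theorem weak_derivative_imp_H_derivative: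
  fixes \<mu> :: "'n::finite wiener measure"
    and E :: "'x::{real_inner, banach, second_countable_topology} set"
  assumes \<mu>: "wiener_measure \<mu>" and p: "1 < p" and wd: "has_weak_derivative \<mu> p E f g"
    and reg: "AE w in \<mu>. H_regular g w"
  shows "\<exists>f'. (AE w in \<mu>. f' w = f w) \<and> has_H_derivative \<mu> f' g"
proof -
  interpret prob_space \<mu> using \<mu> by (rule wiener_measureD)
  have sets\<mu> [measurable_cong]: "sets \<mu> = sets borel" using \<mu> by (rule wiener_measureD)
  have meas_eq: "borel_measurable \<mu> = borel_measurable borel" by (intro measurable_cong_sets sets\<mu> refl)
  have f [measurable]: "f \<in> borel_measurable borel" and g: "g \<in> borel_measurable borel"
    using wd by (auto simp: has_weak_derivative_def Lp_def meas_eq)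
  have gshift: "(\<lambda>v. g (v + cm_path a)) \<in> borel_measurable borel" for a
    by (rule measurable_compose[OF _ g]) measurable
  have geval: "(\<lambda>v. hs_apply (g (v + cm_path a)) b) \<in> borel_measurable borel" for a b
    by (rule measurable_hs_apply[OF gshift])
  have gnorm: "(\<lambda>v. norm (g (v + cm_path a))) \<in> borel_measurable borel" for a
    using measurable_hs_norm_diff[OF gshift[of a], of "\<lambda>_. 0"] by simp
  have gdiff: "(\<lambda>v. norm (g (v + cm_path a) - g (v + cm_path b))) \<in> borel_measurable borel" for a b
    by (rule measurable_hs_norm_diff[OF gshift gshift])
  obtain Q :: "'n cameron_martin set" where Q: "countable Q" "closure Q = UNIV" by (rule cameron_martin_dense)
  obtain B :: "'x set set" where B: "countable B" "topological_basis B"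
    using ex_countable_basis by blast
  have Bopen: "V \<in> B \<Longrightarrow> V \<in> sets borel" for V using topological_basis_open[OF B(2)] by auto
  \<comment> \<open>The four families give, in turn, the convergence of f, the convergence of the
    evaluated gradient at shifts and directions in Q, the moduli of continuity, and the bounds on
    balls.\<close>
  define S1 where "S1 = (\<lambda>V. f -` V) ` B"
  define S2 where "S2 = (\<lambda>(a, b, V). {v. hs_apply (g (v + cm_path a)) b \<in> V}) ` (Q \<times> Q \<times> B)"
  define S3 where "S3 = range (\<lambda>(m::nat, j, l). {v. equicontinuous_at_scale (Q \<inter> ball 0 (real m)) (\<lambda>h. g (v + cm_path h)) j l})"
  define S4 where "S4 = range (\<lambda>(m::nat, K::nat). {v. \<forall>a\<in>Q \<inter> ball 0 (real m). norm (g (v + cm_path a)) \<le> real K})"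
  define \<S> where "\<S> = S1 \<union> S2 \<union> S3 \<union> S4"
  have \<S>_countable: "countable \<S>"
    unfolding \<S>_def S1_def S2_def S3_def S4_def
    by (intro countable_Un countable_image countable_SIGMA Q B countableI_type)
  have \<S>_sets: "\<S> \<subseteq> sets borel"
  proof -
    have "S1 \<subseteq> sets borel" using measurable_sets[OF f Bopen] by (auto simp: S1_def)
    moreover have "S2 \<subseteq> sets borel"
      using measurable_sets[OF geval Bopen] by (auto simp: S2_def vimage_def)
    moreover have "S3 \<subseteq> sets borel"
    proof -
      have QU: "countable (Q \<inter> U)" for U using Q(1) by (rule countable_Int1)
      have "{v \<in> space borel. \<forall>a\<in>Q \<inter> ball 0 (real m). \<forall>b\<in>Q \<inter> ball 0 (real m). dist a b < 1 / real (Suc j) \<longrightarrow>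
          norm (g (v + cm_path a) - g (v + cm_path b)) \<le> 1 / real (Suc l)} \<in> sets borel" for m j l :: nat
        using gdiff by (intro sets_Collect_countable_ball QU sets.sets_Collect_imp sets.sets_Collect_const borel_measurable_le) auto
      then show ?thesis by (auto simp: S3_def equicontinuous_at_scale_def simp del: of_nat_Suc)
    qed
    moreover have "S4 \<subseteq> sets borel"
    proof -
      have QU: "countable (Q \<inter> U)" for U using Q(1) by (rule countable_Int1)
      have "{v \<in> space borel. \<forall>a\<in>Q \<inter> ball 0 (real m). norm (g (v + cm_path a)) \<le> real K} \<in> sets borel" for m K :: nat
        using gnorm by (intro sets_Collect_countable_ball QU borel_measurable_le) auto
      then show ?thesis by (auto simp: S4_def)
    qed
    ultimately show ?thesis by (simp add: \<S>_def)
  qed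
  obtain c s where all: "\<forall>k. 0 < c k \<and> 0 < s k \<and> (c k)\<^sup>2 + (s k)\<^sup>2 = 1" and clim: "c \<longlonglongrightarrow> 1"
    and ae\<S>: "AE w in \<mu>. AE y in \<mu>. \<forall>A\<in>\<S>. \<forall>\<^sub>F k in sequentially. c k *\<^sub>R w + s k *\<^sub>R y \<in> A \<longleftrightarrow> w \<in> A"
    using good_rotations[OF \<mu> \<S>_countable \<S>_sets] by (elim exE conjE)
  have cs: "c k > 0" "s k > 0" "(c k)\<^sup>2 + (s k)\<^sup>2 = 1" for k using all by auto
  \<comment> \<open>Both \<open>lim\<close> and the integral are total, so \<open>f'\<close> is
    defined and measurable without reference to an exceptional set. For a good w the limit exists at
    \<open>w + cm_path h\<close> for almost every y and has the same value for these y.\<close>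
  define f' where "f' w = (\<integral>y. lim (\<lambda>n. f (c n *\<^sub>R w + s n *\<^sub>R y)) \<partial>\<mu>)" for w
  have f' [measurable]: "f' \<in> borel_measurable borel"
    unfolding f'_def[abs_def] by (rule borel_measurable_lebesgue_integral) measurable
  have reg_line: "AE w in \<mu>. \<forall>h k. continuous_on UNIV (\<lambda>\<sigma>::real. g (w + cm_path h + \<sigma> *\<^sub>R cm_path k))"
    using reg by eventually_elim (intro allI continuous_cm_line H_regular_continuous)
  \<comment> \<open>The countable quantifier over n may be moved inside the almost sure statement
    for w; those over h and k are already there by \<open>weak_derivative_line\<close>.\<close>
  have "AE w in \<mu>. \<forall>n. \<forall>h k. AE y in \<mu>.
     f (c n *\<^sub>R w + s n *\<^sub>R y + cm_path h + cm_path k) - f (c n *\<^sub>R w + s n *\<^sub>R y + cm_path h) =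
     (LBINT \<sigma>:{0..1}. hs_apply (g (c n *\<^sub>R w + s n *\<^sub>R y + cm_path h + \<sigma> *\<^sub>R cm_path k)) k)"
    unfolding AE_all_countable by (intro allI weak_derivative_line[OF \<mu> p wd reg_line] cs)
  moreover have "AE w in \<mu>. \<forall>n. AE y in \<mu>. H_regular g (c n *\<^sub>R w + s n *\<^sub>R y)"
    unfolding AE_all_countable by (intro allI wiener_rotation_AE[OF \<mu> cs reg])
  ultimately have key: "AE w in \<mu>. f' w = f w \<and> continuous_on UNIV (\<lambda>h. g (w + cm_path h)) \<and>
      (\<forall>h k. f' (w + cm_path (h + k)) - f' (w + cm_path h) = (LBINT \<sigma>:{0..1}. hs_apply (g (w + cm_path (h + \<sigma> *\<^sub>R k))) k))"
    using ae\<S> reg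
  proof eventually_elim
    case (elim w)
    let ?v = "\<lambda>n y. c n *\<^sub>R w + s n *\<^sub>R y"
    define J where "J h k = (LBINT \<sigma>:{0..1}. hs_apply (g (w + cm_path h + \<sigma> *\<^sub>R cm_path k)) k)" for h k
    have cont: "continuous_on UNIV (\<lambda>h. g (w + cm_path h))" using elim(4) by (rule H_regular_continuous)
    have good: "AE y in \<mu>. (\<forall>A\<in>\<S>. \<forall>\<^sub>F n in sequentially. ?v n y \<in> A \<longleftrightarrow> w \<in> A) \<and> (\<forall>n. H_regular g (?v n y))"
      using elim(2,3) by (simp add: AE_all_countable)
    \<comment> \<open>For a good y the limits hold for all h and k simultaneously, being
      consequences of countably many events. The line formula \<open>lines\<close> below is
      available only for fixed h and k and almost every y. The shifts carry the factor c_n because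
      the rotation of w + h is the rotation of w shifted by c_n h.\<close>
    have Jlim: "(\<lambda>n. f (?v n y)) \<longlonglongrightarrow> f w \<and>
       (\<forall>h k. (\<lambda>n. LBINT \<sigma>:{0..1}. hs_apply (g (?v n y + cm_path (c n *\<^sub>R h) + \<sigma> *\<^sub>R cm_path (c n *\<^sub>R k))) (c n *\<^sub>R k)) \<longlonglongrightarrow> J h k)"
      if y: "(\<forall>A\<in>\<S>. \<forall>\<^sub>F n in sequentially. ?v n y \<in> A \<longleftrightarrow> w \<in> A) \<and> (\<forall>n. H_regular g (?v n y))" for y
    proof (intro conjI allI)
      show "(\<lambda>n. f (?v n y)) \<longlonglongrightarrow> f w"
      proof (rule tendsto_preimages[OF B(2)])
        fix V assume "V \<in> B"
        then have "f -` V \<in> \<S>" by (auto simp: \<S>_def S1_def)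
        with y show "\<forall>\<^sub>F n in sequentially. f (?v n y) \<in> V \<longleftrightarrow> f w \<in> V" by auto
      qed
      interpret FC: field_convergence Q "\<lambda>n h. g (?v n y + cm_path h)" "\<lambda>h. g (w + cm_path h)"
      proof
        show "closure Q = UNIV" by fact
        show "continuous_on UNIV (\<lambda>h. g (?v n y + cm_path h))" for n using y by (intro H_regular_continuous) auto
        show "uniformly_continuous_on (ball 0 (real m)) (\<lambda>h. g (w + cm_path h))" for m :: nat
          using elim(4) by (rule H_regular_ball)
        show "\<exists>K::nat. \<forall>a\<in>ball 0 (real m). norm (g (w + cm_path a)) \<le> real K" for m :: nat
          using elim(4) by (rule H_regular_ball)
        show "(\<lambda>n. hs_apply (g (?v n y + cm_path a)) b) \<longlonglongrightarrow> hs_apply (g (w + cm_path a)) b"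
          if "a \<in> Q" "b \<in> Q" for a b
        proof (rule tendsto_preimages[OF B(2), where u = "\<lambda>v. hs_apply (g (v + cm_path a)) b"])
          fix V assume "V \<in> B"
          then have "{v. hs_apply (g (v + cm_path a)) b \<in> V} \<in> \<S>" using that by (auto simp: \<S>_def S2_def)
          with y have "\<forall>\<^sub>F n in sequentially. ?v n y \<in> {v. hs_apply (g (v + cm_path a)) b \<in> V} \<longleftrightarrow> w \<in> {v. hs_apply (g (v + cm_path a)) b \<in> V}"
            by blast
          then show "\<forall>\<^sub>F n in sequentially. hs_apply (g (?v n y + cm_path a)) b \<in> V \<longleftrightarrow> hs_apply (g (w + cm_path a)) b \<in> V"
            by simp
        qed
        show "\<forall>\<^sub>F n in sequentially. equicontinuous_at_scale (Q \<inter> ball 0 (real m)) (\<lambda>h. g (?v n y + cm_path h)) j l"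
          if "equicontinuous_at_scale (Q \<inter> ball 0 (real m)) (\<lambda>h. g (w + cm_path h)) j l" for m j l :: nat
        proof -
          let ?A = "{v. equicontinuous_at_scale (Q \<inter> ball 0 (real m)) (\<lambda>h. g (v + cm_path h)) j l}"
          have "?A \<in> \<S>" unfolding \<S>_def S3_def by (intro UnI1 UnI2 image_eqI[of _ _ "(m, j, l)"]) auto
          with y have "\<forall>\<^sub>F n in sequentially. ?v n y \<in> ?A \<longleftrightarrow> w \<in> ?A" by blast
          then show ?thesis by eventually_elim (use that in auto)
        qed
        show "\<forall>\<^sub>F n in sequentially. \<forall>a\<in>Q \<inter> ball 0 (real m). norm (g (?v n y + cm_path a)) \<le> real K"
          if "\<forall>a\<in>Q \<inter> ball 0 (real m). norm (g (w + cm_path a)) \<le> real K" for m K :: nat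
        proof -
          let ?A = "{v. \<forall>a\<in>Q \<inter> ball 0 (real m). norm (g (v + cm_path a)) \<le> real K}"
          have "?A \<in> \<S>" unfolding \<S>_def S4_def by (intro UnI2 image_eqI[of _ _ "(m, K)"]) auto
          with y have "\<forall>\<^sub>F n in sequentially. ?v n y \<in> ?A \<longleftrightarrow> w \<in> ?A" by blast
          then show ?thesis by eventually_elim (use that in auto)
        qed
      qed
      fix h k :: "'n cameron_martin"
      obtain m :: nat where m: "norm h + norm k < real m" using reals_Archimedean2 by blast
      obtain K :: nat where K: "\<forall>\<^sub>F n in sequentially. \<forall>a\<in>ball 0 (real m). norm (g (?v n y + cm_path a)) \<le> real K"
        using FC.eventually_bounded[of m] by (elim exE conjE)
      then obtain N where N: "\<And>n a. n \<ge> N \<Longrightarrow> a \<in> ball 0 (real m) \<Longrightarrow> norm (g (?v n y + cm_path a)) \<le> real K"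
        unfolding eventually_sequentially by blast
      \<comment> \<open>Since c_n is at most 1, the scaled segments stay in the ball of radius m and
        the scaled direction is no longer than k; this yields the dominating function.\<close>
      have c1: "c n \<le> 1" for n
      proof -
        have "(c n)\<^sup>2 \<le> 1" using cs(3)[of n] zero_le_power2[of "s n"] by linarith
        then have "\<bar>c n\<bar> \<le> 1" by (simp only: abs_square_le_1)
        then show ?thesis by linarith
      qed
      define F where "F n \<sigma> = hs_apply (g (?v n y + cm_path (c n *\<^sub>R (h + \<sigma> *\<^sub>R k)))) (c n *\<^sub>R k)" for n and \<sigma> :: real
      have eqF: "hs_apply (g (?v n y + cm_path (c n *\<^sub>R h) + \<sigma> *\<^sub>R cm_path (c n *\<^sub>R k))) (c n *\<^sub>R k) = F n \<sigma>" for n \<sigma>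
        by (simp add: F_def scaleR_add_right add.assoc mult.commute)
      have eqJ: "J h k = (LBINT \<sigma>:{0..1}. hs_apply (g (w + cm_path (h + \<sigma> *\<^sub>R k))) k)"
        by (simp add: J_def add.assoc)
      have Fcont: "continuous_on UNIV (F n)" for n
      proof -
        have "continuous_on UNIV (\<lambda>\<sigma>. hs_apply (g (?v n y + cm_path (c n *\<^sub>R h) + \<sigma> *\<^sub>R cm_path (c n *\<^sub>R k))) (c n *\<^sub>R k))"
          using y by (intro continuous_hs_apply_line continuous_cm_line H_regular_continuous) auto
        then show ?thesis by (simp only: eqF)
      qed
      show "(\<lambda>n. LBINT \<sigma>:{0..1}. hs_apply (g (?v n y + cm_path (c n *\<^sub>R h) + \<sigma> *\<^sub>R cm_path (c n *\<^sub>R k))) (c n *\<^sub>R k)) \<longlonglongrightarrow> J h k"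
        unfolding eqF eqJ
      \<comment> \<open>The bound K holds only from the index N on, so dominated convergence is
        applied to the shifted sequence.\<close>
      proof (rule LIMSEQ_offset[where k = N])
        show "(\<lambda>n. LBINT \<sigma>:{0..1}. F (n + N) \<sigma>) \<longlonglongrightarrow> (LBINT \<sigma>:{0..1}. hs_apply (g (w + cm_path (h + \<sigma> *\<^sub>R k))) k)"
          unfolding set_lebesgue_integral_def
        proof (rule integral_dominated_convergence[where w = "\<lambda>\<sigma>. indicator {0..1} \<sigma> *\<^sub>R (real K * norm k)"])
          show "AE \<sigma> in lborel. (\<lambda>n. indicator {0..1} \<sigma> *\<^sub>R F (n + N) \<sigma>) \<longlonglongrightarrow> indicator {0..1} \<sigma> *\<^sub>R hs_apply (g (w + cm_path (h + \<sigma> *\<^sub>R k))) k"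
          proof (intro AE_I2 tendsto_scaleR tendsto_const)
            fix \<sigma> :: real
            have "(\<lambda>n. c n *\<^sub>R x) \<longlonglongrightarrow> x" for x :: "'n cameron_martin"
              using tendsto_scaleR[OF clim tendsto_const[of x]] by simp
            then have "(\<lambda>n. F n \<sigma>) \<longlonglongrightarrow> hs_apply (g (w + cm_path (h + \<sigma> *\<^sub>R k))) k"
              unfolding F_def by (intro FC.eval_tendsto) auto
            then show "(\<lambda>n. F (n + N) \<sigma>) \<longlonglongrightarrow> hs_apply (g (w + cm_path (h + \<sigma> *\<^sub>R k))) k"
              by (rule LIMSEQ_ignore_initial_segment)
          qed
          show "AE \<sigma> in lborel. norm (indicator {0..1} \<sigma> *\<^sub>R F (n + N) \<sigma>) \<le> indicator {0..1} \<sigma> *\<^sub>R (real K * norm k)" for n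
          proof (rule AE_I2)
            fix \<sigma> :: real
            show "norm (indicator {0..1} \<sigma> *\<^sub>R F (n + N) \<sigma>) \<le> indicator {0..1} \<sigma> *\<^sub>R (real K * norm k)"
            proof (cases "\<sigma> \<in> {0..1}")
              case True
              let ?c = "c (n + N)"
              have "norm (h + \<sigma> *\<^sub>R k) \<le> norm h + \<bar>\<sigma>\<bar> * norm k" using norm_triangle_ineq[of h "\<sigma> *\<^sub>R k"] by simp
              also have "\<dots> \<le> norm h + norm k" using True by (simp add: mult_left_le_one_le)
              finally have "norm (h + \<sigma> *\<^sub>R k) < real m" using m by simp
              moreover have "?c * norm (h + \<sigma> *\<^sub>R k) \<le> norm (h + \<sigma> *\<^sub>R k)"
                using c1[of "n + N"] cs(1)[of "n + N"] by (intro mult_left_le_one_le) auto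
              ultimately have "?c *\<^sub>R (h + \<sigma> *\<^sub>R k) \<in> ball 0 (real m)" using cs(1)[of "n + N"] by simp
              then have "norm (g (?v (n + N) y + cm_path (?c *\<^sub>R (h + \<sigma> *\<^sub>R k)))) \<le> real K" by (intro N) auto
              moreover have "norm (?c *\<^sub>R k) \<le> norm k"
                using c1[of "n + N"] cs(1)[of "n + N"] by (simp add: mult_left_le_one_le)
              ultimately have "norm (F (n + N) \<sigma>) \<le> real K * norm k"
                unfolding F_def by (intro order_trans[OF norm_hs_apply_le] mult_mono) auto
              then show ?thesis using True by simp
            qed simp
          qed
          show "(\<lambda>\<sigma>. indicator {0..1} \<sigma> *\<^sub>R hs_apply (g (w + cm_path (h + \<sigma> *\<^sub>R k))) k) \<in> borel_measurable lborel"
            using set_integrable_continuous[OF continuous_hs_apply_line[OF continuous_cm_line[OF cont], of h k k]]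
            by (simp add: set_integrable_def add.assoc integrable_iff_bounded)
          show "(\<lambda>\<sigma>. indicator {0..1} \<sigma> *\<^sub>R F (n + N) \<sigma>) \<in> borel_measurable lborel" for n
            using set_integrable_continuous[OF Fcont] by (simp add: set_integrable_def integrable_iff_bounded)
        qed simp
      qed
    qed
    have lines: "AE y in \<mu>. \<forall>n. f (?v n y + c n *\<^sub>R cm_path (h + k)) - f (?v n y + c n *\<^sub>R cm_path h) =
       (LBINT \<sigma>:{0..1}. hs_apply (g (?v n y + cm_path (c n *\<^sub>R h) + \<sigma> *\<^sub>R cm_path (c n *\<^sub>R k))) (c n *\<^sub>R k))" for h k
    proof -
      have "AE y in \<mu>. \<forall>n. f (?v n y + cm_path (c n *\<^sub>R h) + cm_path (c n *\<^sub>R k)) - f (?v n y + cm_path (c n *\<^sub>R h)) =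
         (LBINT \<sigma>:{0..1}. hs_apply (g (?v n y + cm_path (c n *\<^sub>R h) + \<sigma> *\<^sub>R cm_path (c n *\<^sub>R k))) (c n *\<^sub>R k))"
        unfolding AE_all_countable using elim(1) by blast
      then show ?thesis by (simp add: scaleR_add_right add.assoc)
    qed
    have flim: "AE y in \<mu>. (\<lambda>n. f (?v n y + c n *\<^sub>R cm_path h)) \<longlonglongrightarrow> f w + J 0 h" for h
      using good lines[of 0 h]
    proof eventually_elim
      case (elim y)
      have "(\<lambda>n. f (?v n y) + (f (?v n y + c n *\<^sub>R cm_path h) - f (?v n y))) \<longlonglongrightarrow> f w + J 0 h"
        using conjunct1[OF Jlim[OF elim(1)]] conjunct2[OF Jlim[OF elim(1)], rule_format, of 0 h] elim(2)
        by (intro tendsto_add) simp_all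
      then show ?case by simp
    qed
    have f'h: "f' (w + cm_path h) = f w + J 0 h" for h
    proof -
      have "f' (w + cm_path h) = (\<integral>y. (f w + J 0 h) \<partial>\<mu>)"
        unfolding f'_def
      proof (rule integral_cong_AE)
        show "(\<lambda>y. lim (\<lambda>n. f (c n *\<^sub>R (w + cm_path h) + s n *\<^sub>R y))) \<in> borel_measurable \<mu>" by measurable
        show "AE y in \<mu>. lim (\<lambda>n. f (c n *\<^sub>R (w + cm_path h) + s n *\<^sub>R y)) = f w + J 0 h"
          using flim[of h]
        proof eventually_elim
          case (elim y)
          have "c n *\<^sub>R (w + cm_path h) + s n *\<^sub>R y = ?v n y + c n *\<^sub>R cm_path h" for n
            by (simp add: scaleR_add_right)
          then show ?case using limI[OF elim] by (simp only:)
        qed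
      qed simp
      then show ?thesis using prob_space by simp
    qed
    have "J 0 (h + k) - J 0 h = J h k" for h k
    proof -
      \<comment> \<open>The identity is free of y. It is obtained by comparing two limits for almost
        every y, and an almost sure statement without y on a probability space is a plain truth, so
        it holds for every h and k without an exceptional set.\<close>
      have "AE y in \<mu>. J 0 (h + k) - J 0 h = J h k"
        using good flim[of "h + k"] flim[of h] lines[of h k]
      proof eventually_elim
        case (elim y)
        have "(\<lambda>n. f (?v n y + c n *\<^sub>R cm_path (h + k)) - f (?v n y + c n *\<^sub>R cm_path h)) \<longlonglongrightarrow> (f w + J 0 (h + k)) - (f w + J 0 h)"
          by (intro tendsto_diff elim)
        moreover have "(\<lambda>n. f (?v n y + c n *\<^sub>R cm_path (h + k)) - f (?v n y + c n *\<^sub>R cm_path h)) \<longlonglongrightarrow> J h k"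
          using conjunct2[OF Jlim[OF elim(1)], rule_format, of h k] elim(4) by simp
        ultimately have "(f w + J 0 (h + k)) - (f w + J 0 h) = J h k" by (rule LIMSEQ_unique)
        then show ?case by simp
      qed
      then show ?thesis by simp
    qed
    moreover have "f' w = f w"
    proof -
      have "J 0 0 = 0"
        using linear_0[OF bounded_linear.linear[OF bounded_linear_hs_apply]]
        by (simp add: J_def set_lebesgue_integral_def)
      then show ?thesis using f'h[of 0] by simp
    qed
    ultimately show ?case
      using cont f'h by (simp add: J_def add.assoc del: cm_path_simps(2)) (simp add: add.assoc)
  qed
  have "has_H_derivative \<mu> f' g"
    unfolding has_H_derivative_def H_continuous_def meas_eq
  proof (intro conjI f' g)
    show "AE w in \<mu>. continuous_on UNIV (\<lambda>h. g (w + cm_path h))"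
      using key by eventually_elim blast
    show "AE w in \<mu>. \<forall>h. ((\<lambda>k. f' (w + cm_path k)) has_derivative hs_apply (g (w + cm_path h))) (at h)"
      using key
    proof eventually_elim
      case (elim w)
      then show ?case
        using has_derivative_line_integral[of "\<lambda>h. g (w + cm_path h)" "\<lambda>h. f' (w + cm_path h)"] by blast
    qed
  qed
  moreover have "AE w in \<mu>. f' w = f w" using key by eventually_elim blast
  ultimately show ?thesis by blast
qed

section \<open>Spaces outside the class of Banach types\<close>

text \<open>
  The sort \<open>{real_inner, complete_space}\<close> is not a subsort of \<open>banach\<close>, which the Bochner integral
  requires.  The theorem is therefore proved for an isometric copy of the space that has the instance.
\<close>

typedef 'x hilbert_copy = "UNIV :: 'x set"
  morphisms uncopy Copy
  by simp

setup_lifting type_definition_hilbert_copy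

instantiation hilbert_copy :: (real_vector) real_vector
begin

lift_definition zero_hilbert_copy :: "'a hilbert_copy" is 0 .
lift_definition plus_hilbert_copy :: "'a hilbert_copy \<Rightarrow> 'a hilbert_copy \<Rightarrow> 'a hilbert_copy" is "(+)" .
lift_definition minus_hilbert_copy :: "'a hilbert_copy \<Rightarrow> 'a hilbert_copy \<Rightarrow> 'a hilbert_copy" is "(-)" .
lift_definition uminus_hilbert_copy :: "'a hilbert_copy \<Rightarrow> 'a hilbert_copy" is uminus .
lift_definition scaleR_hilbert_copy :: "real \<Rightarrow> 'a hilbert_copy \<Rightarrow> 'a hilbert_copy" is "(*\<^sub>R)" .

instance
  by standard (transfer; simp add: algebra_simps)+

end

instantiation hilbert_copy :: (real_inner) real_inner
begin

lift_definition inner_hilbert_copy :: "'a hilbert_copy \<Rightarrow> 'a hilbert_copy \<Rightarrow> real" is "(\<bullet>)" .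
lift_definition norm_hilbert_copy :: "'a hilbert_copy \<Rightarrow> real" is norm .
definition sgn_hilbert_copy :: "'a hilbert_copy \<Rightarrow> 'a hilbert_copy"
  where "sgn_hilbert_copy x = x /\<^sub>R norm x"
definition dist_hilbert_copy :: "'a hilbert_copy \<Rightarrow> 'a hilbert_copy \<Rightarrow> real"
  where "dist_hilbert_copy x y = norm (x - y)"
definition uniformity_hilbert_copy :: "('a hilbert_copy \<times> 'a hilbert_copy) filter"
  where "uniformity_hilbert_copy = (INF e\<in>{0 <..}. principal {(x, y). dist x y < e})"
definition open_hilbert_copy :: "'a hilbert_copy set \<Rightarrow> bool"
  where "open_hilbert_copy U \<longleftrightarrow> (\<forall>x\<in>U. \<forall>\<^sub>F (x', y) in uniformity. x' = x \<longrightarrow> y \<in> U)"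

instance
proof
  fix r :: real and x y z :: "'a hilbert_copy"
  show "x \<bullet> y = y \<bullet> x" by transfer (rule inner_commute)
  show "(x + y) \<bullet> z = x \<bullet> z + y \<bullet> z" by transfer (rule inner_add_left)
  show "(r *\<^sub>R x) \<bullet> y = r * (x \<bullet> y)" by transfer (rule inner_scaleR_left)
  show "0 \<le> x \<bullet> x" by transfer (rule inner_ge_zero)
  show "x \<bullet> x = 0 \<longleftrightarrow> x = 0" by transfer (rule inner_eq_zero_iff)
  show "norm x = sqrt (x \<bullet> x)" by transfer (rule norm_eq_sqrt_inner)
qed (simp_all add: sgn_hilbert_copy_def dist_hilbert_copy_def uniformity_hilbert_copy_def open_hilbert_copy_def)

end

lemma bounded_linear_Copy: "bounded_linear Copy"
  by (rule bounded_linear_intro[where K = 1]; transfer; simp)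

lemma bounded_linear_uncopy: "bounded_linear uncopy"
  by (rule bounded_linear_intro[where K = 1]; transfer; simp)

lemma norm_Copy [simp]: "norm (Copy x) = norm x"
  by transfer simp

lemma dist_uncopy: "dist (uncopy x) (uncopy y) = dist x y"
  unfolding dist_norm by transfer simp

lemma Copy_simps:
  fixes x y :: "'a::real_inner" and u :: "'i \<Rightarrow> 'a"
  shows "Copy (x - y) = Copy x - Copy y" "Copy (r *\<^sub>R x) = r *\<^sub>R Copy x" "Copy (sum u A) = (\<Sum>i\<in>A. Copy (u i))"
  using linear_diff[OF bounded_linear.linear[OF bounded_linear_Copy]]
    linear_scale[OF bounded_linear.linear[OF bounded_linear_Copy]]
    linear_sum[OF bounded_linear.linear[OF bounded_linear_Copy]] by auto

instance hilbert_copy :: ("{real_inner, complete_space}") complete_space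
proof
  fix X :: "nat \<Rightarrow> 'a hilbert_copy" assume "Cauchy X"
  then have "Cauchy (\<lambda>n. uncopy (X n))" by (simp add: Cauchy_def dist_uncopy)
  then obtain L where "(\<lambda>n. uncopy (X n)) \<longlonglongrightarrow> L" using Cauchy_convergent convergentD by blast
  then have "(\<lambda>n. Copy (uncopy (X n))) \<longlonglongrightarrow> Copy L" by (rule bounded_linear.tendsto[OF bounded_linear_Copy])
  then show "convergent X" by (simp add: uncopy_inverse convergentI)
qed

instance hilbert_copy :: ("{real_inner, complete_space}") banach ..

instance hilbert_copy :: ("{real_inner, second_countable_topology}") second_countable_topology
proof
  obtain D :: "'a set" where D: "countable D" "\<And>U. open U \<Longrightarrow> U \<noteq> {} \<Longrightarrow> \<exists>d\<in>D. d \<in> U"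
    using countable_dense_setE by metis
  have "x \<in> closure (Copy ` D)" for x
    unfolding closure_approachable
  proof (intro allI impI)
    fix e :: real assume "e > 0"
    then obtain d where "d \<in> D" "d \<in> ball (uncopy x) e" using D(2)[of "ball (uncopy x) e"] by auto
    then show "\<exists>y\<in>Copy ` D. dist y x < e"
      using dist_uncopy[of x "Copy d"] by (auto simp: Copy_inverse dist_commute)
  qed
  then have "closure (Copy ` D) = UNIV" by auto
  then show "\<exists>B :: 'a hilbert_copy set set. countable B \<and> open = generate_topology B"
    using D(1) by (intro second_countable_if_separable[of "Copy ` D"]) auto
qed

lift_definition copy_hs :: "('h::real_inner, 'x::real_inner) hilbert_schmidt \<Rightarrow> ('h, 'x hilbert_copy) hilbert_schmidt"
  is "\<lambda>T h. Copy (T h)"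
  using bounded_linear_compose[OF bounded_linear_Copy] by (auto simp: is_hilbert_schmidt_def)

lemma hs_apply_copy_hs [simp]: "hs_apply (copy_hs T) h = Copy (hs_apply T h)"
  by (simp add: copy_hs.rep_eq)

lemma norm_copy_hs [simp]: "norm (copy_hs T) = norm T"
  by (simp add: norm_hilbert_schmidt_def)

lemma copy_hs_diff: "copy_hs (S - T) = copy_hs S - copy_hs T"
  by (rule hs_apply_inject[THEN iffD1]) (simp add: fun_eq_iff Copy_simps)

lemma dist_copy_hs [simp]: "dist (copy_hs S) (copy_hs T) = dist S T"
  by (simp add: dist_norm flip: copy_hs_diff)

lemma measurable_copy_hs: "g \<in> borel_measurable M \<Longrightarrow> (\<lambda>w. copy_hs (g w)) \<in> borel_measurable M"
  by (rule measurable_compose[OF _ borel_measurable_continuous_onI]) (auto simp: continuous_on_iff)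

lemma measurable_Copy: "f \<in> borel_measurable M \<Longrightarrow> (\<lambda>w. Copy (f w)) \<in> borel_measurable M"
  by (rule measurable_compose[OF _ borel_measurable_continuous_onI[OF linear_continuous_on[OF bounded_linear_Copy]]])

lemma Lp_Copy: "f \<in> Lp M p \<Longrightarrow> (\<lambda>w. Copy (f w)) \<in> Lp M p"
  by (simp add: Lp_def measurable_Copy)

lemma Lp_copy_hs: "g \<in> Lp M p \<Longrightarrow> (\<lambda>w. copy_hs (g w)) \<in> Lp M p"
  by (simp add: Lp_def measurable_copy_hs)

lemma cyl_gradient_copy:
  assumes "cyl_gradient E f G"
  shows "cyl_gradient (Copy ` E) (\<lambda>w. Copy (f w)) (\<lambda>w. copy_hs (G w))"
proof -
  obtain N :: nat and \<phi> e where "\<forall>k<N. \<phi> k \<in> cyl \<and> e k \<in> E" "\<forall>w. f w = (\<Sum>k<N. \<phi> k w *\<^sub>R e k)"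
    "\<forall>w h. hs_apply (G w) h = (\<Sum>k<N. directional (\<phi> k) h w *\<^sub>R e k)"
    using assms unfolding cyl_gradient_def by blast
  then show ?thesis
    unfolding cyl_gradient_def
    by (intro exI[of _ N] exI[of _ \<phi>] exI[of _ "\<lambda>k. Copy (e k)"]) (simp add: Copy_simps)
qed

lemma has_weak_derivative_copy:
  assumes "has_weak_derivative M p E f g"
  shows "has_weak_derivative M p (Copy ` E) (\<lambda>w. Copy (f w)) (\<lambda>w. copy_hs (g w))"
proof -
  obtain F G where FG: "\<forall>j::nat. cyl_gradient E (F j) (G j) \<and> F j \<in> Lp M p \<and> G j \<in> Lp M p"
    "(\<lambda>j. Lp_norm M p (\<lambda>w. F j w - f w) + Lp_norm M p (\<lambda>w. G j w - g w)) \<longlonglongrightarrow> 0"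
    and fg: "f \<in> Lp M p" "g \<in> Lp M p"
    using assms unfolding has_weak_derivative_def by blast
  have "Lp_norm M p (\<lambda>w. Copy (F j w) - Copy (f w)) = Lp_norm M p (\<lambda>w. F j w - f w)"
    "Lp_norm M p (\<lambda>w. copy_hs (G j w) - copy_hs (g w)) = Lp_norm M p (\<lambda>w. G j w - g w)" for j
    by (simp_all add: Lp_norm_def flip: Copy_simps(1) copy_hs_diff)
  then show ?thesis
    unfolding has_weak_derivative_def using FG fg
    by (intro conjI exI[of _ "\<lambda>j w. Copy (F j w)"] exI[of _ "\<lambda>j w. copy_hs (G j w)"])
      (simp_all add: Lp_Copy Lp_copy_hs cyl_gradient_copy)
qed

text \<open>Frechet derivatives are unique, and the one at shift 0 recovers the field at w
  itself.\<close>

lemma H_derivative_unique: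
  assumes "has_H_derivative M u G" "has_H_derivative M u G'"
  shows "AE w in M. G w = G' w"
proof -
  have "AE w in M. \<forall>h. ((\<lambda>k. u (w + cm_path k)) has_derivative hs_apply (G (w + cm_path h))) (at h)"
    "AE w in M. \<forall>h. ((\<lambda>k. u (w + cm_path k)) has_derivative hs_apply (G' (w + cm_path h))) (at h)"
    using assms by (auto simp: has_H_derivative_def)
  then show ?thesis
  proof eventually_elim
    case (elim w)
    have "hs_apply (G (w + cm_path 0)) = hs_apply (G' (w + cm_path 0))"
      by (rule has_derivative_unique[OF elim(1)[rule_format] elim(2)[rule_format]])
    then show ?case by (simp add: hs_apply_inject)
  qed
qed

theorem theorem1:
  fixes \<mu> :: "('n::finite) wiener measure"
    and p :: real
    and E :: "'x::{real_inner, complete_space, second_countable_topology} set"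
    and f :: "'n wiener \<Rightarrow> 'x"
    and g :: "'n wiener \<Rightarrow> ('n cameron_martin, 'x) hilbert_schmidt"
  assumes "wiener_measure \<mu>"
    and "1 < p"
    and "hilbert_basis E"
    and "f \<in> sobolev \<mu> p E"
    and "has_weak_derivative \<mu> p E f g"
    and "AE w in \<mu>. \<forall>m::nat. 1 \<le> m \<longrightarrow>
           uniformly_continuous_on (cball 0 (real m)) (\<lambda>h. g (w + cm_path h))"
  shows "\<exists>f'. (AE w in \<mu>. f' w = f w) \<and> H_C1 \<mu> f' \<and>
           (\<forall>G. has_H_derivative \<mu> f' G \<longrightarrow> (AE w in \<mu>. G w = g w))"
proof -
  have reg: "AE w in \<mu>. H_regular g w" using assms(6) by (simp add: H_regular_def)
  \<comment> \<open>\<open>copy_hs\<close> preserves distances, so uniform continuity carries over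
    to the copy.\<close>
  then have "AE w in \<mu>. H_regular (\<lambda>w. copy_hs (g w)) w"
    by eventually_elim (simp add: H_regular_def uniformly_continuous_on_def)
  from weak_derivative_imp_H_derivative[OF assms(1,2) has_weak_derivative_copy[OF assms(5)] this]
  obtain u where u: "AE w in \<mu>. u w = Copy (f w)" and du: "has_H_derivative \<mu> u (\<lambda>w. copy_hs (g w))"
    by blast
  define f' where "f' w = uncopy (u w)" for w
  have "has_H_derivative \<mu> f' g"
    unfolding has_H_derivative_def H_continuous_def
  proof (intro conjI)
    have "u \<in> borel_measurable \<mu>" using du by (simp add: has_H_derivative_def)
    then show "f' \<in> borel_measurable \<mu>"
      unfolding f'_def[abs_def]
      by (rule measurable_compose[OF _ borel_measurable_continuous_onI[OF linear_continuous_on[OF bounded_linear_uncopy]]])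
    show "g \<in> borel_measurable \<mu>" using assms(5) by (simp add: has_weak_derivative_def Lp_def)
    show "AE w in \<mu>. continuous_on UNIV (\<lambda>h. g (w + cm_path h))"
      using reg by eventually_elim (rule H_regular_continuous)
    have "AE w in \<mu>. \<forall>h. ((\<lambda>k. u (w + cm_path k)) has_derivative hs_apply (copy_hs (g (w + cm_path h)))) (at h)"
      using du by (simp add: has_H_derivative_def)
    then show "AE w in \<mu>. \<forall>h. ((\<lambda>k. f' (w + cm_path k)) has_derivative hs_apply (g (w + cm_path h))) (at h)"
    proof eventually_elim
      case (elim w)
      show ?case
      proof
        fix h
        from bounded_linear.has_derivative[OF bounded_linear_uncopy elim[rule_format, of h]]
        show "((\<lambda>k. f' (w + cm_path k)) has_derivative hs_apply (g (w + cm_path h))) (at h)"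
          by (simp add: f'_def Copy_inverse)
      qed
    qed
  qed
  moreover have "AE w in \<mu>. f' w = f w"
    using u by eventually_elim (simp add: f'_def Copy_inverse)
  \<comment> \<open>The field g is one H-derivative of \<open>f'\<close>; uniqueness extends the
    identification to every other one.\<close>
  ultimately show ?thesis
    using H_derivative_unique unfolding H_C1_def by blast
qed

end
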